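(* Assume (D), (Gr) and (Sm) from the context. Assume that the value function $V$ is continuous and that $\tau_{\mathcal D}$ is an optimal stopping time for the problem defining $V$. Suppose that $$\mathbb E_x\Big[\int_0^{\tau_{\mathcal D}}e^{-rs}\,d|A_s^{\Gamma^{\mathrm{tot}}}|\Big]<\infty\quad\text{for } x\in\mathcal C,$$ and that the local martingale $M^G$ in the identity $$e^{-rt}G(X_t)-\int_0^t e^{-rs}c(X_s)\,ds=G(x)-\int_0^t e^{-rs}\,dA_s^{\Gamma^{\mathrm{tot}}}+M_t^G,$$ stopped at $\tau_{\mathcal D}$, is uniformly integrable. Then, for every $x\in\mathcal C$, $$V(x)=G(x)-R_r^{\mathcal C}\Gamma^{\mathrm{tot}}(x),\qquad H(x)=-R_r^{\mathcal C}\Gamma^{\mathrm{tot}}(x),$$ where $R_r^{\mathcal C}\Gamma^{\mathrm{tot}}(x)=\mathbb E_x\big[\int_0^{\tau_{\mathcal D}}e^{-rs}\,dA_s^{\Gamma^{\mathrm{tot}}}\big]$.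
   Context: **Reflected diffusion.** $W$ is a two-dimensional Brownian motion on a filtered probability space satisfying the usual conditions, with filtration $\mathbb F$. $X=(X^1,X^2)$ is a diffusion in $[0,\infty)^2$ solving $dX_t=\beta(X_t)dt+\sigma(X_t)dW_t+\rho_1dL_t^1+\rho_2dL_t^2$, $X_0=x$, where $\beta:[0,\infty)^2\to\mathbb R^2$, $\sigma:[0,\infty)^2\to\mathbb R^{2\times2}$, $a=\sigma\sigma^\top$, $\rho_1=(1,\theta_1)$, $\rho_2=(\theta_2,1)$ with $\theta_1,\theta_2\in\mathbb R$. Each $L^i$ is continuous, adapted, nondecreasing, $L^i_0=0$, and $\int_0^\infty \mathbf 1_{\{X^i_s>0\}}dL^i_s=0$. $F_i=\{x\in[0,\infty)^2:x_i=0\}$. $\mathbb E_x$ is expectation for $X_0=x$. The interior generator is $\mathcal L f=\beta\cdot\nabla f+\frac12\operatorname{tr}(aD^2f)$. **(D)** $\beta,\sigma$ are continuous and locally Lipschitz on $[0,\infty)^2$ with $|\beta(x)|+\|\sigma(x)\|\le K(1+|x|)$; $a$ is locally uniformly elliptic in $(0,\infty)^2$; $1-\theta_1\theta_2>0$ and the associated orthant Skorokhod problem is well posed; for every $x\in[0,\infty)^2$ the reflected SDE has a unique strong solution in $[0,\infty)^2$ and its transition semigroup is Feller; $L^1,L^2$ do not charge the corner $\{0\}$. **Stopping problem.** Fix $r>0$, $\alpha>0$, a continuous $c:[0,\infty)^2\to[0,\infty)$, and $G(x)=x_1\vee\alpha x_2$. $V(x)=\sup_\tau\mathbb E_x[e^{-r\tau}G(X_\tau)-\int_0^\tau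 e^{-rs}c(X_s)ds]$ over all $\mathbb F$-stopping times; $H=V-G$, $\mathcal C=\{H>0\}$, $\mathcal D=\{H=0\}$, $\tau_{\mathcal D}=\inf\{t\ge0:X_t\in\mathcal D\}$. **(Gr)** There are $\Psi\in C^2([0,\infty)^2)$, constants $K_\Psi,\lambda_\Psi>0$ and $m\ge1$ with $1+|x|^m\le K_\Psi\Psi(x)$, $G+c\le K_\Psi\Psi$, $\mathcal L\Psi\le\lambda_\Psi\Psi+K_\Psi$ in $(0,\infty)^2$, $\rho_i\cdot\nabla\Psi\le0$ on $F_i$ ($i=1,2$), $r>\lambda_\Psi$, and $\mathbb E_x[\sup_{t\ge0}e^{-rt}\Psi(X_t)]<\infty$ for all $x$. **Total stopping measure.** Let $E_1=\{x_1>\alpha x_2\}$, $E_2=\{x_1<\alpha x_2\}$, $Y_t=X_t^1-\alpha X_t^2$, and let $\ell^0(Y)$ be the semimartingale local time of $Y$ at $0$, normalized by $dY_t^+=\mathbf 1_{\{Y_t>0\}}dY_t+\frac12d\ell^0_t(Y)$. Put $\Gamma^{\mathrm{ac}}=c+rG-\beta_1\mathbf 1_{E_1}-\alpha\beta_2\mathbf 1_{E_2}$ and $$A_t^{\Gamma^{\mathrm{tot}}}=\int_0^t\Gamma^{\mathrm{ac}}(X_s)ds-\tfrac12\ell^0_t(Y)-\alpha\theta_1L^1_t-\theta_2L^2_t.$$ $\Gamma^{\mathrm{tot}}$ is the signed smooth measure associated (Revuz correspondence) with this signed additive functional; $|A^{\Gamma^{\mathrm{tot}}}|$ denotes its total variation.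 **(Sm)** The positive and negative variations of $\Gamma^{\mathrm{tot}}$ are smooth measures for $X$, and for every relatively compact open $O\subset[0,\infty)^2$, $\mathbb E_x[\int_0^{\tau_O}e^{-rs}d|A^{\Gamma^{\mathrm{tot}}}_s|]<\infty$ for $x\in O$, with $\tau_O=\inf\{t\ge0:X_t\notin O\}$. *)

theory Defs
  imports "HOL-Probability.Probability"
begin

text \<open>
  Time runs through \<open>[0, \<infinity>)\<close> for processes (arguments of type \<^typ>\<open>real\<close>, values at negative times
  are irrelevant) and through \<open>[0, \<infinity>]\<close>, i.e. \<^typ>\<open>ennreal\<close>, for filtrations and stopping times,
  so that the library's \<^const>\<open>stopping_time\<close> allows the value \<open>\<infinity>\<close>.
\<close>

section \<open>Filtered spaces, stopping times, Brownian motion\<close>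

text \<open>The usual conditions: \<open>F\<close> is right-continuous, \<open>M\<close> is complete, \<open>F 0\<close> has all null sets.\<close>

definition usual_filtered_space :: "'w measure \<Rightarrow> (ennreal \<Rightarrow> 'w measure) \<Rightarrow> bool" where
  "usual_filtered_space M F \<longleftrightarrow>
     prob_space M \<and> complete_measure M \<and>
     filtration (space M) F \<and> (\<forall>t. subalgebra M (F t)) \<and>
     null_sets M \<subseteq> sets (F 0) \<and>
     (\<forall>t<\<infinity>. sets (F t) = (\<Inter>s\<in>{t<..}. sets (F s)))"

definition adapted :: "(ennreal \<Rightarrow> 'w measure) \<Rightarrow> (real \<Rightarrow> 'w \<Rightarrow> 'b::topological_space) \<Rightarrow> bool" where
  "adapted F Z \<longleftrightarrow> (\<forall>t\<ge>0. Z t \<in> borel_measurable (F (ennreal t)))"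

definition continuous_paths :: "'w measure \<Rightarrow> (real \<Rightarrow> 'w \<Rightarrow> 'b::topological_space) \<Rightarrow> bool" where
  "continuous_paths M Z \<longleftrightarrow> (\<forall>\<omega>\<in>space M. continuous_on {0..} (\<lambda>t. Z t \<omega>))"

definition progressive :: "(ennreal \<Rightarrow> 'w measure) \<Rightarrow> (real \<Rightarrow> 'w \<Rightarrow> 'b::topological_space) \<Rightarrow> bool" where
  "progressive F Z \<longleftrightarrow>
     (\<forall>t\<ge>0. (\<lambda>(s, \<omega>). Z s \<omega>)
        \<in> borel_measurable (restrict_space borel {0..t} \<Otimes>\<^sub>M F (ennreal t)))"

definition stopped :: "(real \<Rightarrow> 'w \<Rightarrow> 'b) \<Rightarrow> ('w \<Rightarrow> ennreal) \<Rightarrow> real \<Rightarrow> 'w \<Rightarrow> 'b" where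
  "stopped Z \<tau> t \<omega> = Z (enn2real (min (ennreal t) (\<tau> \<omega>))) \<omega>"

text \<open>First entry time over \<open>t \<ge> 0\<close> and hitting time over \<open>t > 0\<close>; both are \<open>\<infinity>\<close> if there is none.\<close>

definition entry_time :: "(real \<Rightarrow> 'w \<Rightarrow> 'b) \<Rightarrow> 'b set \<Rightarrow> 'w \<Rightarrow> ennreal" where
  "entry_time Z B \<omega> = Inf {ennreal t | t. 0 \<le> t \<and> Z t \<omega> \<in> B}"

definition hitting_time :: "(real \<Rightarrow> 'w \<Rightarrow> 'b) \<Rightarrow> 'b set \<Rightarrow> 'w \<Rightarrow> ennreal" where
  "hitting_time Z B \<omega> = Inf {ennreal t | t. 0 < t \<and> Z t \<omega> \<in> B}"

definition localizing :: "'w measure \<Rightarrow> (ennreal \<Rightarrow> 'w measure) \<Rightarrow> (nat \<Rightarrow> 'w \<Rightarrow> ennreal) \<Rightarrow> bool" where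
  "localizing M F T \<longleftrightarrow>
     (\<forall>k. stopping_time F (T k)) \<and> (\<forall>\<omega>\<in>space M. incseq (\<lambda>k. T k \<omega>)) \<and>
     (AE \<omega> in M. (\<lambda>k. T k \<omega>) \<longlonglongrightarrow> \<infinity>)"

definition martingale :: "'w measure \<Rightarrow> (ennreal \<Rightarrow> 'w measure) \<Rightarrow> (real \<Rightarrow> 'w \<Rightarrow> real) \<Rightarrow> bool" where
  "martingale M F Z \<longleftrightarrow>
     adapted F Z \<and> (\<forall>t\<ge>0. integrable M (Z t)) \<and>
     (\<forall>s\<ge>0. \<forall>t\<ge>s. AE \<omega> in M. real_cond_exp M (F (ennreal s)) (Z t) \<omega> = Z s \<omega>)"

definition local_martingale :: "'w measure \<Rightarrow> (ennreal \<Rightarrow> 'w measure) \<Rightarrow> (real \<Rightarrow> 'w \<Rightarrow> real) \<Rightarrow> bool" where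
  "local_martingale M F Z \<longleftrightarrow>
     adapted F Z \<and> (\<forall>\<omega>\<in>space M. \<forall>t\<ge>0. continuous (at_right t) (\<lambda>s. Z s \<omega>)) \<and>
     (\<exists>T. localizing M F T \<and>
        (\<forall>k. martingale M F (\<lambda>t \<omega>. stopped Z (T k) t \<omega> - Z 0 \<omega>)))"

definition uniformly_integrable_on :: "'w measure \<Rightarrow> 'i set \<Rightarrow> ('i \<Rightarrow> 'w \<Rightarrow> real) \<Rightarrow> bool" where
  "uniformly_integrable_on M I Z \<longleftrightarrow>
     (\<forall>i\<in>I. integrable M (Z i)) \<and>
     (\<forall>\<epsilon>>0. \<exists>K. \<forall>i\<in>I. (\<integral>\<omega>. \<bar>Z i \<omega>\<bar> * indicator {\<omega>. \<bar>Z i \<omega>\<bar> > K} \<omega> \<partial>M) \<le> \<epsilon>)"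

definition brownian_motion :: "'w measure \<Rightarrow> (ennreal \<Rightarrow> 'w measure) \<Rightarrow> (real \<Rightarrow> 'w \<Rightarrow> real^2) \<Rightarrow> bool" where
  "brownian_motion M F W \<longleftrightarrow>
     adapted F W \<and> continuous_paths M W \<and> (AE \<omega> in M. W 0 \<omega> = 0) \<and>
     (\<forall>s\<ge>0. \<forall>t>s.
        prob_space.indep_set M (sets (F (ennreal s)))
          {(\<lambda>\<omega>. W t \<omega> - W s \<omega>) -` B \<inter> space M | B. B \<in> sets borel} \<and>
        distributed M lborel (\<lambda>\<omega>. W t \<omega> - W s \<omega>)
          (\<lambda>v. ennreal (\<Prod>i\<in>UNIV. normal_density 0 (sqrt (t - s)) (v $ i))))"

definition augmented_filtration :: "'w measure \<Rightarrow> (real \<Rightarrow> 'w \<Rightarrow> real^2) \<Rightarrow> ennreal \<Rightarrow> 'w measure" where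
  "augmented_filtration M W t =
     sigma (space M)
       ({W s -` B \<inter> space M | s B. 0 \<le> s \<and> ennreal s \<le> t \<and> B \<in> sets borel} \<union> null_sets M)"


section \<open>Pathwise Stieltjes integrals\<close>

text \<open>The measure on \<open>[0, \<infinity>)\<close> of a nondecreasing right-continuous function on \<open>[0, \<infinity>)\<close>
  (no mass at \<open>0\<close>).\<close>

definition stieltjes :: "(real \<Rightarrow> real) \<Rightarrow> real measure" where
  "stieltjes f = interval_measure (\<lambda>t. f (max 0 t))"

definition total_variation :: "(real \<Rightarrow> real) \<Rightarrow> real \<Rightarrow> ennreal" where
  "total_variation f t =
     (SUP p\<in>{p :: nat \<Rightarrow> real. mono p \<and> range p \<subseteq> {0..t}}. SUP n.
        (\<Sum>k<n. ennreal \<bar>f (p (Suc k)) - f (p k)\<bar>))"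

definition locally_bv :: "(real \<Rightarrow> real) \<Rightarrow> bool" where
  "locally_bv f \<longleftrightarrow> (\<forall>t\<ge>0. total_variation f t < \<infinity>)"

definition abs_var :: "(real \<Rightarrow> real) \<Rightarrow> real \<Rightarrow> real" where
  "abs_var f t = enn2real (total_variation f t)"

definition pos_var :: "(real \<Rightarrow> real) \<Rightarrow> real \<Rightarrow> real" where
  "pos_var f t = (abs_var f t + (f t - f 0)) / 2"

definition neg_var :: "(real \<Rightarrow> real) \<Rightarrow> real \<Rightarrow> real" where
  "neg_var f t = (abs_var f t - (f t - f 0)) / 2"

definition stieltjes_integral :: "(real \<Rightarrow> real) \<Rightarrow> real set \<Rightarrow> (real \<Rightarrow> real) \<Rightarrow> real" where
  "stieltjes_integral f S g =
     (LINT s:S|stieltjes (pos_var f). g s) - (LINT s:S|stieltjes (neg_var f). g s)"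

text \<open>The time interval \<open>(0, \<tau>]\<close>, intersected with \<open>(0, \<infinity>)\<close>.\<close>

definition upto_time :: "ennreal \<Rightarrow> real set" where
  "upto_time \<tau> = {s. 0 < s \<and> ennreal s \<le> \<tau>}"


section \<open>The Ito integral against a two-dimensional Brownian motion\<close>

text \<open>Simple integrands \<open>\<Sum>i<n. \<xi> i 1_{(p i, p (i+1)]}\<close> with \<open>\<xi> i\<close> bounded and
  \<open>F (p i)\<close>-measurable.\<close>

definition simple_data ::
  "'w measure \<Rightarrow> (ennreal \<Rightarrow> 'w measure) \<Rightarrow> nat \<Rightarrow> (nat \<Rightarrow> real) \<Rightarrow> (nat \<Rightarrow> 'w \<Rightarrow> real^2) \<Rightarrow> bool" where
  "simple_data M F n p \<xi> \<longleftrightarrow>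
     0 \<le> p 0 \<and> mono p \<and>
     (\<forall>i<n. \<xi> i \<in> borel_measurable (F (ennreal (p i))) \<and> bounded (\<xi> i ` space M))"

definition simple_process :: "nat \<Rightarrow> (nat \<Rightarrow> real) \<Rightarrow> (nat \<Rightarrow> 'w \<Rightarrow> real^2) \<Rightarrow> real \<Rightarrow> 'w \<Rightarrow> real^2" where
  "simple_process n p \<xi> s \<omega> = (\<Sum>i<n. indicator {p i <.. p (Suc i)} s *\<^sub>R \<xi> i \<omega>)"

definition simple_integral ::
  "(real \<Rightarrow> 'w \<Rightarrow> real^2) \<Rightarrow> nat \<Rightarrow> (nat \<Rightarrow> real) \<Rightarrow> (nat \<Rightarrow> 'w \<Rightarrow> real^2) \<Rightarrow> real \<Rightarrow> 'w \<Rightarrow> real" where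
  "simple_integral W n p \<xi> t \<omega> =
     (\<Sum>i<n. \<xi> i \<omega> \<bullet> (W (min t (p (Suc i))) \<omega> - W (min t (p i)) \<omega>))"

text \<open>\<open>J\<close> is (a continuous version of) \<open>\<integral> H \<cdot> dW\<close>: along a localizing sequence \<open>T k\<close> the truncated
  integrand is square integrable and the stopped process \<open>J\<close> is the \<open>L\<^sup>2\<close> limit of integrals of simple
  integrands that approximate the truncated integrand in \<open>L\<^sup>2(ds \<otimes> P)\<close>.\<close>

definition ito_integral ::
  "'w measure \<Rightarrow> (ennreal \<Rightarrow> 'w measure) \<Rightarrow> (real \<Rightarrow> 'w \<Rightarrow> real^2) \<Rightarrow>
     (real \<Rightarrow> 'w \<Rightarrow> real^2) \<Rightarrow> (real \<Rightarrow> 'w \<Rightarrow> real) \<Rightarrow> bool" where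
  "ito_integral M F W H J \<longleftrightarrow>
     progressive F H \<and> adapted F J \<and> continuous_paths M J \<and> (AE \<omega> in M. J 0 \<omega> = 0) \<and>
     (\<exists>T. localizing M F T \<and>
       (\<forall>k.
         (\<integral>\<^sup>+\<omega>. (\<integral>\<^sup>+s\<in>upto_time (T k \<omega>). ennreal ((norm (H s \<omega>))\<^sup>2) \<partial>lborel) \<partial>M) < \<infinity> \<and>
         (\<exists>n p \<xi>.
           (\<forall>j::nat. simple_data M F (n j) (p j) (\<xi> j)) \<and>
           (\<lambda>j. \<integral>\<^sup>+\<omega>. (\<integral>\<^sup>+s\<in>{0<..}.
                  ennreal ((norm (simple_process (n j) (p j) (\<xi> j) s \<omega>
                     - indicator (upto_time (T k \<omega>)) s *\<^sub>R H s \<omega>))\<^sup>2) \<partial>lborel) \<partial>M)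
             \<longlonglongrightarrow> 0 \<and>
           (\<forall>t\<ge>0.
             (\<lambda>j. \<integral>\<^sup>+\<omega>. ennreal ((simple_integral W (n j) (p j) (\<xi> j) t \<omega>
                     - stopped J (T k) t \<omega>)\<^sup>2) \<partial>M) \<longlonglongrightarrow> 0))))"

text \<open>Semimartingale local time at \<open>0\<close> of a continuous semimartingale \<open>Y = Y\<^sub>0 + \<integral> H \<cdot> dW + U\<close> with
  \<open>U\<close> of locally bounded variation, normalized by \<open>dY\<^sup>+ = 1_{Y>0} dY + (1/2) d\<Lambda>\<close>, where
  \<open>\<integral> 1_{Y>0} dY = \<integral> 1_{Y>0} H \<cdot> dW + \<integral> 1_{Y>0} dU\<close>.\<close>

definition local_time_at_zero ::
  "'w measure \<Rightarrow> (ennreal \<Rightarrow> 'w measure) \<Rightarrow> (real \<Rightarrow> 'w \<Rightarrow> real^2) \<Rightarrow>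
     (real \<Rightarrow> 'w \<Rightarrow> real) \<Rightarrow> (real \<Rightarrow> 'w \<Rightarrow> real) \<Rightarrow> bool" where
  "local_time_at_zero M F W Y \<Lambda> \<longleftrightarrow>
     adapted F \<Lambda> \<and> continuous_paths M \<Lambda> \<and>
     (\<forall>\<omega>\<in>space M. \<Lambda> 0 \<omega> = 0 \<and> mono_on {0..} (\<lambda>t. \<Lambda> t \<omega>)) \<and>
     (\<exists>H U N J.
        ito_integral M F W H N \<and>
        adapted F U \<and> continuous_paths M U \<and>
        (\<forall>\<omega>\<in>space M. U 0 \<omega> = 0 \<and> locally_bv (\<lambda>t. U t \<omega>)) \<and>
        (AE \<omega> in M. \<forall>t\<ge>0. Y t \<omega> = Y 0 \<omega> + N t \<omega> + U t \<omega>) \<and>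
        ito_integral M F W (\<lambda>s \<omega>. (if Y s \<omega> > 0 then H s \<omega> else 0)) J \<and>
        (AE \<omega> in M. \<forall>t\<ge>0.
           max 0 (Y t \<omega>) = max 0 (Y 0 \<omega>) + J t \<omega>
             + stieltjes_integral (\<lambda>u. U u \<omega>) {0<..t} (\<lambda>s. if Y s \<omega> > 0 then 1 else 0)
             + \<Lambda> t \<omega> / 2))"


section \<open>Reflected diffusion in the quadrant\<close>

definition orthant :: "(real^2) set" where
  "orthant = {x. \<forall>i. 0 \<le> x $ i}"

definition open_orthant :: "(real^2) set" where
  "open_orthant = {x. \<forall>i. 0 < x $ i}"

definition face :: "2 \<Rightarrow> (real^2) set" where
  "face i = {x \<in> orthant. x $ i = 0}"

definition refl_vec :: "real \<Rightarrow> real \<Rightarrow> 2 \<Rightarrow> real^2" where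
  "refl_vec \<theta>1 \<theta>2 i = (if i = 1 then vector [1, \<theta>1] else vector [\<theta>2, 1])"

text \<open>Deterministic orthant Skorokhod problem for the reflection vectors above.\<close>

definition skorokhod_solution ::
  "real \<Rightarrow> real \<Rightarrow> (real \<Rightarrow> real^2) \<Rightarrow> (real \<Rightarrow> real^2) \<Rightarrow> (real \<Rightarrow> real^2) \<Rightarrow> bool" where
  "skorokhod_solution \<theta>1 \<theta>2 w z l \<longleftrightarrow>
     continuous_on {0..} z \<and> continuous_on {0..} l \<and> l 0 = 0 \<and>
     (\<forall>t\<ge>0. z t \<in> orthant \<and> z t = w t + (\<Sum>i\<in>UNIV. (l t $ i) *\<^sub>R refl_vec \<theta>1 \<theta>2 i)) \<and>
     (\<forall>i. mono_on {0..} (\<lambda>t. l t $ i)) \<and>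
     (\<forall>i. (\<integral>\<^sup>+s\<in>{0..}. indicator {s. z s $ i > 0} s \<partial>stieltjes (\<lambda>t. l t $ i)) = 0)"

definition skorokhod_well_posed :: "real \<Rightarrow> real \<Rightarrow> bool" where
  "skorokhod_well_posed \<theta>1 \<theta>2 \<longleftrightarrow>
     (\<forall>w. continuous_on {0..} w \<and> w 0 \<in> orthant \<longrightarrow>
        (\<exists>z l. skorokhod_solution \<theta>1 \<theta>2 w z l) \<and>
        (\<forall>z l z' l'. skorokhod_solution \<theta>1 \<theta>2 w z l \<and> skorokhod_solution \<theta>1 \<theta>2 w z' l' \<longrightarrow>
           (\<forall>t\<ge>0. z t = z' t \<and> l t = l' t)))"

definition reflected_solution ::
  "'w measure \<Rightarrow> (ennreal \<Rightarrow> 'w measure) \<Rightarrow> (real \<Rightarrow> 'w \<Rightarrow> real^2) \<Rightarrow>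
     (real^2 \<Rightarrow> real^2) \<Rightarrow> (real^2 \<Rightarrow> real^2^2) \<Rightarrow> real \<Rightarrow> real \<Rightarrow> real^2 \<Rightarrow>
     (real \<Rightarrow> 'w \<Rightarrow> real^2) \<Rightarrow> (real \<Rightarrow> 'w \<Rightarrow> real^2) \<Rightarrow> bool" where
  "reflected_solution M F W \<beta> \<sigma> \<theta>1 \<theta>2 x X L \<longleftrightarrow>
     adapted F X \<and> continuous_paths M X \<and> (\<forall>\<omega>\<in>space M. \<forall>t\<ge>0. X t \<omega> \<in> orthant) \<and>
     adapted F L \<and> continuous_paths M L \<and>
     (\<forall>\<omega>\<in>space M. L 0 \<omega> = 0 \<and> (\<forall>i. mono_on {0..} (\<lambda>t. L t \<omega> $ i))) \<and>
     (\<forall>i. AE \<omega> in M.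
        (\<integral>\<^sup>+s\<in>{0..}. indicator {s. X s \<omega> $ i > 0} s \<partial>stieltjes (\<lambda>t. L t \<omega> $ i)) = 0) \<and>
     (\<exists>J. (\<forall>i. ito_integral M F W (\<lambda>s \<omega>. \<sigma> (X s \<omega>) $ i) (\<lambda>t \<omega>. J t \<omega> $ i)) \<and>
        (AE \<omega> in M. \<forall>t\<ge>0.
           X t \<omega> = x + (LBINT s:{0..t}. \<beta> (X s \<omega>)) + J t \<omega>
             + (\<Sum>i\<in>UNIV. (L t \<omega> $ i) *\<^sub>R refl_vec \<theta>1 \<theta>2 i)))"

text \<open>Strong solution: adapted to the augmented filtration of \<open>W\<close>; unique: any solution on the given
  filtered space with the same driving \<open>W\<close> is indistinguishable from it.\<close>

definition unique_strong_solution ::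
  "'w measure \<Rightarrow> (ennreal \<Rightarrow> 'w measure) \<Rightarrow> (real \<Rightarrow> 'w \<Rightarrow> real^2) \<Rightarrow>
     (real^2 \<Rightarrow> real^2) \<Rightarrow> (real^2 \<Rightarrow> real^2^2) \<Rightarrow> real \<Rightarrow> real \<Rightarrow> real^2 \<Rightarrow>
     (real \<Rightarrow> 'w \<Rightarrow> real^2) \<Rightarrow> (real \<Rightarrow> 'w \<Rightarrow> real^2) \<Rightarrow> bool" where
  "unique_strong_solution M F W \<beta> \<sigma> \<theta>1 \<theta>2 x X L \<longleftrightarrow>
     reflected_solution M F W \<beta> \<sigma> \<theta>1 \<theta>2 x X L \<and>
     adapted (augmented_filtration M W) X \<and> adapted (augmented_filtration M W) L \<and>
     (\<forall>X' L'. reflected_solution M F W \<beta> \<sigma> \<theta>1 \<theta>2 x X' L' \<longrightarrow>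
        (AE \<omega> in M. \<forall>t\<ge>0. X' t \<omega> = X t \<omega> \<and> L' t \<omega> = L t \<omega>))"

text \<open>From here on \<open>X x\<close> and \<open>L x\<close> are the solution started at \<open>x\<close>, all built on one space, so that
  \<open>E\<^sub>x[\<Phi>(X)]\<close> is the expectation of \<open>\<Phi>(X x)\<close> under \<open>M\<close>.\<close>

definition transition :: "'w measure \<Rightarrow> (real^2 \<Rightarrow> real \<Rightarrow> 'w \<Rightarrow> real^2) \<Rightarrow> real \<Rightarrow>
    (real^2 \<Rightarrow> real) \<Rightarrow> real^2 \<Rightarrow> real" where
  "transition M X t f x = (\<integral>\<omega>. f (X x t \<omega>) \<partial>M)"

definition C0_orthant :: "(real^2 \<Rightarrow> real) set" where
  "C0_orthant = {f. continuous_on orthant f \<and> (f \<longlongrightarrow> 0) (inf at_infinity (principal orthant))}"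

definition feller :: "'w measure \<Rightarrow> (real^2 \<Rightarrow> real \<Rightarrow> 'w \<Rightarrow> real^2) \<Rightarrow> bool" where
  "feller M X \<longleftrightarrow>
     (\<forall>f\<in>C0_orthant.
        (\<forall>t\<ge>0. transition M X t f \<in> C0_orthant) \<and>
        (\<forall>s\<ge>0. \<forall>t\<ge>0. \<forall>x\<in>orthant.
           transition M X (s + t) f x = transition M X s (transition M X t f) x) \<and>
        uniform_limit orthant (\<lambda>t. transition M X t f) f (at_right 0))"

definition condition_D ::
  "'w measure \<Rightarrow> (ennreal \<Rightarrow> 'w measure) \<Rightarrow> (real \<Rightarrow> 'w \<Rightarrow> real^2) \<Rightarrow>
     (real^2 \<Rightarrow> real^2) \<Rightarrow> (real^2 \<Rightarrow> real^2^2) \<Rightarrow> real \<Rightarrow> real \<Rightarrow>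
     (real^2 \<Rightarrow> real \<Rightarrow> 'w \<Rightarrow> real^2) \<Rightarrow> (real^2 \<Rightarrow> real \<Rightarrow> 'w \<Rightarrow> real^2) \<Rightarrow> bool" where
  "condition_D M F W \<beta> \<sigma> \<theta>1 \<theta>2 X L \<longleftrightarrow>
     continuous_on orthant \<beta> \<and> continuous_on orthant \<sigma> \<and>
     (\<forall>x\<in>orthant. \<exists>\<epsilon>>0. \<exists>C. C-lipschitz_on (cball x \<epsilon> \<inter> orthant) \<beta> \<and>
        C-lipschitz_on (cball x \<epsilon> \<inter> orthant) \<sigma>) \<and>
     (\<exists>K. \<forall>x\<in>orthant. norm (\<beta> x) + norm (\<sigma> x) \<le> K * (1 + norm x)) \<and>
     (\<forall>Q. compact Q \<and> Q \<subseteq> open_orthant \<longrightarrow>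
        (\<exists>\<kappa>>0. \<forall>x\<in>Q. \<forall>v. \<kappa> * (norm v)\<^sup>2 \<le> v \<bullet> ((\<sigma> x ** transpose (\<sigma> x)) *v v))) \<and>
     1 - \<theta>1 * \<theta>2 > 0 \<and> skorokhod_well_posed \<theta>1 \<theta>2 \<and>
     (\<forall>x\<in>orthant. unique_strong_solution M F W \<beta> \<sigma> \<theta>1 \<theta>2 x (X x) (L x)) \<and>
     feller M X \<and>
     (\<forall>x\<in>orthant. \<forall>i. AE \<omega> in M.
        (\<integral>\<^sup>+s\<in>{0..}. indicator {s. X x s \<omega> = 0} s \<partial>stieltjes (\<lambda>t. L x t \<omega> $ i)) = 0)"


section \<open>The stopping problem\<close>

definition gain :: "real \<Rightarrow> real^2 \<Rightarrow> real" where
  "gain \<alpha> x = max (x $ 1) (\<alpha> * x $ 2)"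

text \<open>Convention on \<open>\<tau> = \<infinity>\<close>: \<open>e^{-r\<tau>} G(X\<^sub>\<tau>) = 0\<close>. The running cost may be infinite there, hence
  the extended real value.\<close>

definition payoff ::
  "real \<Rightarrow> real \<Rightarrow> (real^2 \<Rightarrow> real) \<Rightarrow> (real \<Rightarrow> 'w \<Rightarrow> real^2) \<Rightarrow> ('w \<Rightarrow> ennreal) \<Rightarrow> 'w \<Rightarrow> ereal" where
  "payoff r \<alpha> c X \<tau> \<omega> =
     (if \<tau> \<omega> = \<infinity> then 0
      else ereal (exp (- r * enn2real (\<tau> \<omega>)) * gain \<alpha> (X (enn2real (\<tau> \<omega>)) \<omega>)))
     - enn2ereal (\<integral>\<^sup>+s\<in>upto_time (\<tau> \<omega>). ennreal (exp (- r * s) * c (X s \<omega>)) \<partial>lborel)"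

definition ext_expectation :: "'w measure \<Rightarrow> ('w \<Rightarrow> ereal) \<Rightarrow> ereal" where
  "ext_expectation M f =
     enn2ereal (\<integral>\<^sup>+\<omega>. e2ennreal (f \<omega>) \<partial>M) - enn2ereal (\<integral>\<^sup>+\<omega>. e2ennreal (- f \<omega>) \<partial>M)"

definition value_fun ::
  "'w measure \<Rightarrow> (ennreal \<Rightarrow> 'w measure) \<Rightarrow> real \<Rightarrow> real \<Rightarrow> (real^2 \<Rightarrow> real) \<Rightarrow>
     (real^2 \<Rightarrow> real \<Rightarrow> 'w \<Rightarrow> real^2) \<Rightarrow> real^2 \<Rightarrow> ereal" where
  "value_fun M F r \<alpha> c X x =
     (SUP \<tau>\<in>{\<tau>. stopping_time F \<tau>}. ext_expectation M (payoff r \<alpha> c (X x) \<tau>))"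

definition optimal_stopping_time ::
  "'w measure \<Rightarrow> (ennreal \<Rightarrow> 'w measure) \<Rightarrow> real \<Rightarrow> real \<Rightarrow> (real^2 \<Rightarrow> real) \<Rightarrow>
     (real^2 \<Rightarrow> real \<Rightarrow> 'w \<Rightarrow> real^2) \<Rightarrow> real^2 \<Rightarrow> ('w \<Rightarrow> ennreal) \<Rightarrow> bool" where
  "optimal_stopping_time M F r \<alpha> c X x \<tau> \<longleftrightarrow>
     stopping_time F \<tau> \<and>
     ext_expectation M (payoff r \<alpha> c (X x) \<tau>) = value_fun M F r \<alpha> c X x"

definition excess :: "real \<Rightarrow> (real^2 \<Rightarrow> ereal) \<Rightarrow> real^2 \<Rightarrow> ereal" where
  "excess \<alpha> V x = V x - ereal (gain \<alpha> x)"

definition continuation_set :: "real \<Rightarrow> (real^2 \<Rightarrow> ereal) \<Rightarrow> (real^2) set" where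
  "continuation_set \<alpha> V = {x \<in> orthant. excess \<alpha> V x > 0}"

definition stopping_set :: "real \<Rightarrow> (real^2 \<Rightarrow> ereal) \<Rightarrow> (real^2) set" where
  "stopping_set \<alpha> V = {x \<in> orthant. excess \<alpha> V x = 0}"

text \<open>\<open>f\<close> is \<open>C\<^sup>2\<close> on the closed quadrant with gradient \<open>g\<close> and Hessian \<open>h\<close> (one-sided at the
  boundary).\<close>

definition C2_orthant :: "(real^2 \<Rightarrow> real) \<Rightarrow> (real^2 \<Rightarrow> real^2) \<Rightarrow> (real^2 \<Rightarrow> real^2^2) \<Rightarrow> bool" where
  "C2_orthant f g h \<longleftrightarrow>
     (\<forall>x\<in>orthant. (f has_derivative (\<lambda>v. g x \<bullet> v)) (at x within orthant)) \<and>
     (\<forall>x\<in>orthant. (g has_derivative (\<lambda>v. h x *v v)) (at x within orthant)) \<and>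
     continuous_on orthant h"

definition generator ::
  "(real^2 \<Rightarrow> real^2) \<Rightarrow> (real^2 \<Rightarrow> real^2^2) \<Rightarrow> (real^2 \<Rightarrow> real^2) \<Rightarrow> (real^2 \<Rightarrow> real^2^2) \<Rightarrow> real^2 \<Rightarrow> real" where
  "generator \<beta> \<sigma> g h x = \<beta> x \<bullet> g x + trace ((\<sigma> x ** transpose (\<sigma> x)) ** h x) / 2"

definition condition_Gr ::
  "'w measure \<Rightarrow> (real^2 \<Rightarrow> real^2) \<Rightarrow> (real^2 \<Rightarrow> real^2^2) \<Rightarrow> real \<Rightarrow> real \<Rightarrow> real \<Rightarrow> real \<Rightarrow>
     (real^2 \<Rightarrow> real) \<Rightarrow> (real^2 \<Rightarrow> real \<Rightarrow> 'w \<Rightarrow> real^2) \<Rightarrow> bool" where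
  "condition_Gr M \<beta> \<sigma> \<theta>1 \<theta>2 r \<alpha> c X \<longleftrightarrow>
     (\<exists>\<Psi> g h K \<kappa> m.
        C2_orthant \<Psi> g h \<and> K > 0 \<and> \<kappa> > 0 \<and> m \<ge> 1 \<and>
        (\<forall>x\<in>orthant. 1 + norm x powr m \<le> K * \<Psi> x) \<and>
        (\<forall>x\<in>orthant. gain \<alpha> x + c x \<le> K * \<Psi> x) \<and>
        (\<forall>x\<in>open_orthant. generator \<beta> \<sigma> g h x \<le> \<kappa> * \<Psi> x + K) \<and>
        (\<forall>i. \<forall>x\<in>face i. refl_vec \<theta>1 \<theta>2 i \<bullet> g x \<le> 0) \<and>
        r > \<kappa> \<and>
        (\<forall>x\<in>orthant. (\<integral>\<^sup>+\<omega>. (SUP t\<in>{0..}. ennreal (exp (- r * t) * \<Psi> (X x t \<omega>))) \<partial>M) < \<infinity>))"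


section \<open>The total stopping measure\<close>

definition diag_process :: "real \<Rightarrow> (real \<Rightarrow> 'w \<Rightarrow> real^2) \<Rightarrow> real \<Rightarrow> 'w \<Rightarrow> real" where
  "diag_process \<alpha> X t \<omega> = X t \<omega> $ 1 - \<alpha> * X t \<omega> $ 2"

definition Gamma_ac :: "real \<Rightarrow> real \<Rightarrow> (real^2 \<Rightarrow> real) \<Rightarrow> (real^2 \<Rightarrow> real^2) \<Rightarrow> real^2 \<Rightarrow> real" where
  "Gamma_ac r \<alpha> c \<beta> x =
     c x + r * gain \<alpha> x - \<beta> x $ 1 * indicator {x. x $ 1 > \<alpha> * x $ 2} x
       - \<alpha> * \<beta> x $ 2 * indicator {x. x $ 1 < \<alpha> * x $ 2} x"

definition A_tot ::
  "real \<Rightarrow> real \<Rightarrow> (real^2 \<Rightarrow> real) \<Rightarrow> (real^2 \<Rightarrow> real^2) \<Rightarrow> real \<Rightarrow> real \<Rightarrow>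
     (real \<Rightarrow> 'w \<Rightarrow> real^2) \<Rightarrow> (real \<Rightarrow> 'w \<Rightarrow> real^2) \<Rightarrow> (real \<Rightarrow> 'w \<Rightarrow> real) \<Rightarrow> real \<Rightarrow> 'w \<Rightarrow> real" where
  "A_tot r \<alpha> c \<beta> \<theta>1 \<theta>2 X L \<Lambda> t \<omega> =
     (LBINT s:{0..t}. Gamma_ac r \<alpha> c \<beta> (X s \<omega>)) - \<Lambda> t \<omega> / 2
       - \<alpha> * \<theta>1 * L t \<omega> $ 1 - \<theta>2 * L t \<omega> $ 2"

text \<open>Discounted functionals up to \<open>\<tau>\<close> of the path of a signed functional \<open>A\<close>:
  \<open>\<integral>\<^sub>0\<^sup>\<tau> e^{-rs} d|A|\<^sub>s\<close> and \<open>\<integral>\<^sub>0\<^sup>\<tau> e^{-rs} dA\<^sub>s\<close>.\<close>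

definition disc_abs_var :: "real \<Rightarrow> (real \<Rightarrow> 'w \<Rightarrow> real) \<Rightarrow> ennreal \<Rightarrow> 'w \<Rightarrow> ennreal" where
  "disc_abs_var r A \<tau> \<omega> =
     (\<integral>\<^sup>+s\<in>upto_time \<tau>. ennreal (exp (- r * s)) \<partial>stieltjes (abs_var (\<lambda>t. A t \<omega>)))"

definition disc_functional :: "real \<Rightarrow> (real \<Rightarrow> 'w \<Rightarrow> real) \<Rightarrow> ennreal \<Rightarrow> 'w \<Rightarrow> real" where
  "disc_functional r A \<tau> \<omega> =
     stieltjes_integral (\<lambda>t. A t \<omega>) (upto_time \<tau>) (\<lambda>s. exp (- r * s))"

definition resolvent_functional ::
  "'w measure \<Rightarrow> real \<Rightarrow> (real^2 \<Rightarrow> real \<Rightarrow> 'w \<Rightarrow> real) \<Rightarrow> (real^2 \<Rightarrow> 'w \<Rightarrow> ennreal) \<Rightarrow> real^2 \<Rightarrow> real" where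
  "resolvent_functional M r A \<tau> x = (\<integral>\<omega>. disc_functional r (A x) (\<tau> x \<omega>) \<omega> \<partial>M)"

text \<open>Revuz correspondence and smoothness are relative to a reference measure \<open>m\<close>, here any
  \<open>\<sigma>\<close>-finite measure with full support in the quadrant that is excessive for the discounted semigroup
  \<open>e^{-rt} P\<^sub>t\<close> (in particular any invariant or excessive measure of \<open>P\<^sub>t\<close> with full support).\<close>

definition borel_measure_on_orthant :: "(real^2) measure \<Rightarrow> bool" where
  "borel_measure_on_orthant \<mu> \<longleftrightarrow> sets \<mu> = sets borel \<and> emeasure \<mu> (- orthant) = 0"

definition reference_measure ::
  "'w measure \<Rightarrow> (real^2 \<Rightarrow> real \<Rightarrow> 'w \<Rightarrow> real^2) \<Rightarrow> real \<Rightarrow> (real^2) measure \<Rightarrow> bool" where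
  "reference_measure M X r m \<longleftrightarrow>
     borel_measure_on_orthant m \<and> sigma_finite_measure m \<and>
     (\<forall>O'. openin (top_of_set orthant) O' \<and> O' \<noteq> {} \<longrightarrow> emeasure m O' > 0) \<and>
     (\<forall>t\<ge>0. \<forall>B\<in>sets borel.
        (\<integral>\<^sup>+x. ennreal (exp (- r * t)) * emeasure M {\<omega>\<in>space M. X x t \<omega> \<in> B} \<partial>m) \<le> emeasure m B)"

text \<open>\<open>\<integral> f d\<mu> = lim\<^sub>t\<^sub>\<down>\<^sub>0 (1/t) E\<^sub>m[\<integral>\<^sub>0\<^sup>t f(X\<^sub>s) dA\<^sub>s]\<close> for a nondecreasing functional \<open>A\<close>.\<close>

definition revuz_measure ::
  "'w measure \<Rightarrow> (real^2 \<Rightarrow> real \<Rightarrow> 'w \<Rightarrow> real^2) \<Rightarrow> (real^2) measure \<Rightarrow>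
     (real^2 \<Rightarrow> real \<Rightarrow> 'w \<Rightarrow> real) \<Rightarrow> (real^2) measure \<Rightarrow> bool" where
  "revuz_measure M X m A \<mu> \<longleftrightarrow>
     borel_measure_on_orthant \<mu> \<and>
     (\<forall>f \<in> borel_measurable borel.
        ((\<lambda>t. (\<integral>\<^sup>+x. \<integral>\<^sup>+\<omega>. (\<integral>\<^sup>+s\<in>{0<..t}. f (X x s \<omega>) \<partial>stieltjes (\<lambda>u. A x u \<omega>)) \<partial>M \<partial>m)
              / ennreal t) \<longlongrightarrow> (\<integral>\<^sup>+x. f x \<partial>\<mu>)) (at_right 0))"

text \<open>A signed smooth measure \<open>\<Gamma> = \<Gamma>p - \<Gamma>n\<close> need not be a set function (\<open>\<infinity> - \<infinity>\<close>), so it is given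
  by the pair of its (mutually singular) positive and negative variations, which correspond to the
  positive and negative variations of the signed functional.\<close>

definition signed_revuz_measure ::
  "'w measure \<Rightarrow> (real^2 \<Rightarrow> real \<Rightarrow> 'w \<Rightarrow> real^2) \<Rightarrow> (real^2) measure \<Rightarrow>
     (real^2 \<Rightarrow> real \<Rightarrow> 'w \<Rightarrow> real) \<Rightarrow> (real^2) measure \<Rightarrow> (real^2) measure \<Rightarrow> bool" where
  "signed_revuz_measure M X m A \<Gamma>p \<Gamma>n \<longleftrightarrow>
     revuz_measure M X m (\<lambda>x t \<omega>. pos_var (\<lambda>u. A x u \<omega>) t) \<Gamma>p \<and>
     revuz_measure M X m (\<lambda>x t \<omega>. neg_var (\<lambda>u. A x u \<omega>) t) \<Gamma>n \<and>
     (\<exists>B\<in>sets borel. emeasure \<Gamma>p (- B) = 0 \<and> emeasure \<Gamma>n B = 0)"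

definition polar_set ::
  "'w measure \<Rightarrow> (real^2 \<Rightarrow> real \<Rightarrow> 'w \<Rightarrow> real^2) \<Rightarrow> (real^2) measure \<Rightarrow> (real^2) set \<Rightarrow> bool" where
  "polar_set M X m B \<longleftrightarrow>
     B \<in> sets borel \<and> B \<subseteq> orthant \<and> (AE x in m. AE \<omega> in M. hitting_time (X x) B \<omega> = \<infinity>)"

text \<open>Smooth: no charge on exceptional sets, and finite on the members of a nest of closed sets which
  carries the measure and whose complements are not reached in the limit.\<close>

definition smooth_measure ::
  "'w measure \<Rightarrow> (real^2 \<Rightarrow> real \<Rightarrow> 'w \<Rightarrow> real^2) \<Rightarrow> (real^2) measure \<Rightarrow> (real^2) measure \<Rightarrow> bool" where
  "smooth_measure M X m \<mu> \<longleftrightarrow>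
     borel_measure_on_orthant \<mu> \<and>
     (\<forall>B. polar_set M X m B \<longrightarrow> emeasure \<mu> B = 0) \<and>
     (\<exists>Q :: nat \<Rightarrow> (real^2) set.
        incseq Q \<and> (\<forall>n. closed (Q n) \<and> Q n \<subseteq> orthant \<and> emeasure \<mu> (Q n) < \<infinity>) \<and>
        emeasure \<mu> (orthant - (\<Union>n. Q n)) = 0 \<and>
        (AE x in m. AE \<omega> in M. (\<lambda>n. hitting_time (X x) (orthant - Q n) \<omega>) \<longlonglongrightarrow> \<infinity>))"

definition condition_Sm ::
  "'w measure \<Rightarrow> (real^2 \<Rightarrow> real \<Rightarrow> 'w \<Rightarrow> real^2) \<Rightarrow> real \<Rightarrow> (real^2) measure \<Rightarrow>
     (real^2 \<Rightarrow> real \<Rightarrow> 'w \<Rightarrow> real) \<Rightarrow> (real^2) measure \<Rightarrow> (real^2) measure \<Rightarrow> bool" where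
  "condition_Sm M X r m A \<Gamma>p \<Gamma>n \<longleftrightarrow>
     smooth_measure M X m \<Gamma>p \<and> smooth_measure M X m \<Gamma>n \<and>
     (\<forall>O'. openin (top_of_set orthant) O' \<and> compact (closure O') \<longrightarrow>
        (\<forall>x\<in>O'. (\<integral>\<^sup>+\<omega>. disc_abs_var r (A x) (entry_time (X x) (- O') \<omega>) \<omega> \<partial>M) < \<infinity>))"

end

theory Submission
  imports Defs
begin

text \<open>
  Fix \<open>x \<in> C\<close> and \<open>\<tau> = \<tau>\<^sub>D\<close>. On \<open>[0, t \<and> \<tau>]\<close> the process \<open>M\<^sup>G\<close> is dominated by an integrable variable, namely
  a multiple of \<open>sup\<^sub>s e\<^sup>-\<^sup>r\<^sup>s \<Psi>(X\<^sub>s)\<close> plus \<open>\<integral>\<^sub>0\<^sup>\<tau> e\<^sup>-\<^sup>r\<^sup>s d|A|\<^sub>s\<close>, so the stopped local martingale has mean zero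
  and \<open>E[payoff(\<tau> \<and> n)] = G(x) - E[\<integral>\<^sub>0\<^sup>\<tau>\<^sup>\<and>\<^sup>n e\<^sup>-\<^sup>r\<^sup>s dA\<^sub>s]\<close>. Since \<open>V(x)\<close> dominates the left-hand side, \<open>n \<rightarrow> \<infinity>\<close> gives
  \<open>V \<ge> G - R\<close>. Conversely \<open>G \<ge> 0\<close> and monotone convergence of the running cost give
  \<open>E[payoff(\<tau>)] \<le> lim E[payoff(\<tau> \<and> n)]\<close>, and \<open>V(x) = E[payoff(\<tau>)]\<close> by optimality. In particular no growth
  estimate for \<open>e\<^sup>-\<^sup>r\<^sup>t G(X\<^sub>t)\<close> on \<open>{\<tau> = \<infinity>}\<close> is needed: optimality of \<open>\<tau>\<close> already excludes a residual gain there.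
\<close>

section \<open>Right-continuous processes\<close>

text \<open>Measurability is the first obstacle. The discounted functional is a difference of
  integrals against two random Stieltjes measures, built from a total variation that is a supremum
  over uncountably many partitions. Continuity of the paths reduces this supremum to uniform grids,
  and Fubini trades the random measure for Lebesgue measure. This makes the dominating variable
  measurable; the functional at \<tau> itself is then treated as an almost sure limit on a complete
  space. The second obstacle is the running cost. (Gr) bounds only its rate by an integrable
  variable, which gives integrability on bounded horizons. Integrability of the cost up to \<tau> is
  read off from the expectation identity: gain and functional have means bounded uniformly in the
  horizon, hence so has the cost.\<close>

lemma at_right_tendsto_eventually_ge:
  fixes f :: "real \<Rightarrow> 'b::topological_space"
  assumes "continuous (at_right a) f" "\<forall>\<^sub>F n in Q. a \<le> x n" "(x \<longlongrightarrow> a) Q"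
  shows "((\<lambda>n. f (x n)) \<longlongrightarrow> f a) Q"
proof -
  have "{a..} - {a} = {a<..}" by auto
  then have "at a within {a..} = at_right a"
    by (simp add: at_within_def)
  then have "continuous (at a within {a..}) f"
    using assms(1) by simp
  then show ?thesis
    by (rule continuous_within_tendsto_compose[OF _ _ assms(3)]) (use assms(2) in simp)
qed

lemma at_right_tendsto_ge:
  fixes f :: "real \<Rightarrow> 'b::topological_space"
  assumes "continuous (at_right a) f" "\<And>n. a \<le> x n" "(x \<longlongrightarrow> a) Q"
  shows "((\<lambda>n. f (x n)) \<longlongrightarrow> f a) Q"
  by (rule at_right_tendsto_eventually_ge[OF assms(1) _ assms(3)]) (simp add: assms(2))

lemma continuous_on_imp_at_right:
  fixes f :: "real \<Rightarrow> 'b::topological_space"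
  assumes "continuous_on {0..} f" "0 \<le> a"
  shows "continuous (at_right a) f"
proof -
  have "continuous (at a within {0..}) f"
    using assms by (simp add: continuous_on_eq_continuous_within)
  then show ?thesis
    by (rule continuous_within_subset) (use assms in auto)
qed

text \<open>Rounding up to the grid of mesh \<open>1 / Suc i\<close> approaches \<open>t\<close>
  from the right (\<open>le_ceiling_grid\<close>), so right-continuity is enough to pass to the
  limit along countably many times.\<close>

lemma ceiling_grid_tendsto:
  "(\<lambda>i. real_of_int \<lceil>t * real (Suc i)\<rceil> / real (Suc i)) \<longlonglongrightarrow> t"
proof (rule tendsto_sandwich)
  show "\<forall>\<^sub>F i in sequentially. t \<le> real_of_int \<lceil>t * real (Suc i)\<rceil> / real (Suc i)"
    by (intro always_eventually allI) (simp add: pos_le_divide_eq del: of_nat_Suc)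
  show "\<forall>\<^sub>F i in sequentially. real_of_int \<lceil>t * real (Suc i)\<rceil> / real (Suc i) \<le> t + inverse (real (Suc i))"
  proof (intro always_eventually allI)
    fix i
    have "real_of_int \<lceil>t * real (Suc i)\<rceil> \<le> t * real (Suc i) + 1"
      by linarith
    also have "\<dots> = (t + inverse (real (Suc i))) * real (Suc i)"
      by (simp add: field_simps)
    finally show "real_of_int \<lceil>t * real (Suc i)\<rceil> / real (Suc i) \<le> t + inverse (real (Suc i))"
      by (simp add: pos_divide_le_eq del: of_nat_Suc)
  qed
  show "(\<lambda>i. t + inverse (real (Suc i))) \<longlonglongrightarrow> t"
    using tendsto_add[OF tendsto_const LIMSEQ_inverse_real_of_nat] by simp
qed auto

lemma le_ceiling_grid: "t \<le> real_of_int \<lceil>t * real (Suc i)\<rceil> / real (Suc i)"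
  by (simp add: pos_le_divide_eq del: of_nat_Suc)

text \<open>For a fixed index the grid approximation uses countably many times, so joint
  measurability reduces to that of each \<open>Z t\<close>; right-continuity carries it to the
  limit. The \<open>max 0\<close> sends negative arguments, where nothing is assumed of
  \<open>Z\<close>, to time \<open>0\<close>.\<close>

lemma measurable_right_continuous_process:
  fixes Z :: "real \<Rightarrow> 'w \<Rightarrow> 'b::metric_space"
  assumes meas: "\<And>t. 0 \<le> t \<Longrightarrow> Z t \<in> borel_measurable M"
    and cont: "\<And>\<omega> t. \<omega> \<in> space M \<Longrightarrow> 0 \<le> t \<Longrightarrow> continuous (at_right t) (\<lambda>s. Z s \<omega>)"
  shows "(\<lambda>(t, \<omega>). Z (max 0 t) \<omega>) \<in> borel_measurable (borel \<Otimes>\<^sub>M M)"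
proof (rule borel_measurable_LIMSEQ_metric)
  define f :: "nat \<Rightarrow> real \<times> 'w \<Rightarrow> 'b"
    where "f i x = Z (max 0 (real_of_int \<lceil>fst x * real (Suc i)\<rceil> / real (Suc i))) (snd x)" for i x
  show "f i \<in> borel_measurable (borel \<Otimes>\<^sub>M M)" for i
    unfolding f_def
  proof (rule measurable_compose_countable[where f="\<lambda>k x. Z (max 0 (real_of_int k / real (Suc i))) (snd x)"
        and g="\<lambda>x. \<lceil>fst x * real (Suc i)\<rceil>"])
    show "(\<lambda>x. Z (max 0 (real_of_int k / real (Suc i))) (snd x)) \<in> borel_measurable (borel \<Otimes>\<^sub>M M)" for k
      by (rule measurable_compose[OF measurable_snd meas]) simp
    show "(\<lambda>x. \<lceil>fst x * real (Suc i)\<rceil>) \<in> borel \<Otimes>\<^sub>M M \<rightarrow>\<^sub>M count_space UNIV"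
      by measurable
  qed
  fix x assume "x \<in> space (borel \<Otimes>\<^sub>M M :: (real \<times> 'w) measure)"
  then have x: "snd x \<in> space M"
    by (auto simp: space_pair_measure)
  have "(\<lambda>i. Z (max 0 (real_of_int \<lceil>fst x * real (Suc i)\<rceil> / real (Suc i))) (snd x))
      \<longlonglongrightarrow> Z (max 0 (fst x)) (snd x)"
  proof (rule at_right_tendsto_ge[OF cont[OF x]])
    show "(\<lambda>i. max 0 (real_of_int \<lceil>fst x * real (Suc i)\<rceil> / real (Suc i))) \<longlonglongrightarrow> max 0 (fst x)"
      by (intro tendsto_max tendsto_const ceiling_grid_tendsto)
    show "max 0 (fst x) \<le> max 0 (real_of_int \<lceil>fst x * real (Suc i)\<rceil> / real (Suc i))" for i
      using le_ceiling_grid[of "fst x" i] by (auto intro: max.mono)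
  qed simp
  then show "(\<lambda>i. f i x) \<longlonglongrightarrow> (case x of (t, \<omega>) \<Rightarrow> Z (max 0 t) \<omega>)"
    by (simp add: f_def case_prod_beta)
qed

lemma measurable_process_at_time:
  fixes Z :: "real \<Rightarrow> 'w \<Rightarrow> 'b::metric_space"
  assumes Z: "(\<lambda>(t, \<omega>). Z (max 0 t) \<omega>) \<in> borel_measurable (borel \<Otimes>\<^sub>M M)"
    and T: "T \<in> borel_measurable N" and h: "h \<in> N \<rightarrow>\<^sub>M M" and "\<And>x. x \<in> space N \<Longrightarrow> 0 \<le> T x"
  shows "(\<lambda>x. Z (T x) (h x)) \<in> borel_measurable N"
proof -
  have "(\<lambda>x. (\<lambda>(t, \<omega>). Z (max 0 t) \<omega>) (T x, h x)) \<in> borel_measurable N"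
    by (rule measurable_compose[OF _ Z]) (use T h in measurable)
  then show ?thesis
    by (rule measurable_cong[THEN iffD1, rotated]) (use assms(4) in \<open>auto simp: max_def\<close>)
qed

text \<open>Every \<open>f t\<close> is a limit of values at rational times, obtained by rounding
  up. The countable supremum is what makes the running supremum of a continuous process
  measurable.\<close>

lemma SUP_continuous_eq_SUP_Rats:
  fixes f :: "real \<Rightarrow> real"
  assumes "continuous_on {0..} f"
  shows "(SUP t\<in>{0..}. ennreal (f t)) = (SUP t\<in>{0..} \<inter> \<rat>. ennreal (f t))"
proof (rule antisym)
  show "(SUP t\<in>{0..}. ennreal (f t)) \<le> (SUP t\<in>{0..} \<inter> \<rat>. ennreal (f t))"
  proof (rule SUP_least)
    fix t :: real assume t: "t \<in> {0..}"
    let ?q = "\<lambda>i. real_of_int \<lceil>t * real (Suc i)\<rceil> / real (Suc i)"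
    have "(\<lambda>i. ennreal (f (?q i))) \<longlonglongrightarrow> ennreal (f t)"
      by (intro tendsto_ennrealI at_right_tendsto_ge[OF continuous_on_imp_at_right[OF assms]]
          ceiling_grid_tendsto le_ceiling_grid) (use t in auto)
    moreover have "ennreal (f (?q i)) \<le> (SUP t\<in>{0..} \<inter> \<rat>. ennreal (f t))" for i
      by (rule SUP_upper) (use t le_ceiling_grid[of t i] in \<open>auto intro!: Rats_divide Rats_of_int\<close>)
    ultimately show "ennreal (f t) \<le> (SUP t\<in>{0..} \<inter> \<rat>. ennreal (f t))"
      by - (rule LIMSEQ_le_const2, assumption, blast)
  qed
qed (auto intro: SUP_subset_mono)

section \<open>Total variation of continuous paths\<close>

text \<open>A continuous path of locally bounded variation, certified on each \<open>{0..T}\<close>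
  by a continuous majorant of its increments; such a \<open>g\<close> is nondecreasing there.
  Certificates add and scale, and the same \<open>g\<close> controls the increments of
  \<open>abs_var\<close>, so continuity of the variation comes along with its finiteness.\<close>

definition continuously_controlled :: "(real \<Rightarrow> real) \<Rightarrow> bool" where
  "continuously_controlled f \<longleftrightarrow>
     (\<forall>T\<ge>0. \<exists>g. continuous_on {0..T} g \<and> (\<forall>s\<ge>0. \<forall>t\<ge>s. t \<le> T \<longrightarrow> \<bar>f t - f s\<bar> \<le> g t - g s))"

lemma continuously_controlledE:
  assumes "continuously_controlled f" "0 \<le> T"
  obtains g where "continuous_on {0..T} g"
    "\<forall>s\<ge>0. \<forall>t\<ge>s. t \<le> T \<longrightarrow> \<bar>f t - f s\<bar> \<le> g t - g s"
  using assms unfolding continuously_controlled_def by blast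

lemma continuous_on_dominated_increments:
  fixes f g :: "real \<Rightarrow> real"
  assumes g: "continuous_on S g"
    and le: "\<And>s t. s \<in> S \<Longrightarrow> t \<in> S \<Longrightarrow> s \<le> t \<Longrightarrow> \<bar>f t - f s\<bar> \<le> g t - g s"
  shows "continuous_on S f"
proof (rule continuous_onI)
  fix x e :: real assume "x \<in> S" "0 < e"
  then obtain d where "d > 0" and d: "\<And>x'. x' \<in> S \<Longrightarrow> dist x' x < d \<Longrightarrow> dist (g x') (g x) < e"
    using g unfolding continuous_on_iff by meson
  have "dist (f x') (f x) \<le> e" if "x' \<in> S" "dist x' x < d" for x'
  proof (cases "x' \<le> x")
    case True
    then show ?thesis
      using le[of x' x] d[of x'] that \<open>x \<in> S\<close> by (auto simp: dist_real_def)
  next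
    case False
    then show ?thesis
      using le[of x x'] d[of x'] that \<open>x \<in> S\<close> by (auto simp: dist_real_def)
  qed
  then show "\<exists>d>0. \<forall>x'\<in>S. dist x' x < d \<longrightarrow> dist (f x') (f x) \<le> e"
    using \<open>d > 0\<close> by blast
qed

lemma continuous_on_atLeast_real:
  fixes f :: "real \<Rightarrow> real"
  assumes "\<And>T. 0 \<le> T \<Longrightarrow> continuous_on {0..T} f"
  shows "continuous_on {0..} f"
  unfolding continuous_on_eq_continuous_within
proof
  fix x :: real assume x: "x \<in> {0..}"
  have "continuous (at x within {0..x+1}) f"
    using assms[of "x+1"] x by (simp add: continuous_on_eq_continuous_within)
  moreover have "at x within {0..x+1} = at x within {0..}"
    by (rule at_within_nhd[where S="{..<x+1}"]) auto
  ultimately show "continuous (at x within {0..}) f"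
    by simp
qed

lemma continuously_controlled_imp_continuous:
  assumes "continuously_controlled f"
  shows "continuous_on {0..} f"
proof (rule continuous_on_atLeast_real)
  fix T :: real assume "0 \<le> T"
  obtain g where g: "continuous_on {0..T} g"
    "\<forall>s\<ge>0. \<forall>t\<ge>s. t \<le> T \<longrightarrow> \<bar>f t - f s\<bar> \<le> g t - g s"
    using continuously_controlledE[OF assms \<open>0 \<le> T\<close>] by blast
  show "continuous_on {0..T} f"
    by (rule continuous_on_dominated_increments[OF g(1)]) (use g(2) in auto)
qed

lemma sum_le_total_variation:
  fixes p :: "nat \<Rightarrow> real"
  assumes "mono p" "range p \<subseteq> {0..t}"
  shows "(\<Sum>k<n. ennreal \<bar>f (p (Suc k)) - f (p k)\<bar>) \<le> total_variation f t"
  unfolding total_variation_def using assms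
  by (intro SUP_upper2[of p] SUP_upper) auto

lemma total_variation_leI:
  assumes "\<And>(p :: nat \<Rightarrow> real) n. mono p \<Longrightarrow> range p \<subseteq> {0..t} \<Longrightarrow>
    (\<Sum>k<n. \<bar>f (p (Suc k)) - f (p k)\<bar>) \<le> B" "0 \<le> B"
  shows "total_variation f t \<le> ennreal B"
  unfolding total_variation_def
  by (intro SUP_least) (use assms in \<open>auto simp: sum_ennreal ennreal_leI\<close>)

text \<open>Splitting each partition point \<open>p\<close> into \<open>min p s\<close> and \<open>max p s\<close> makes the increments beyond \<open>s\<close>
  telescope against the control.\<close>

lemma total_variation_increment_le:
  assumes g: "\<And>s t. 0 \<le> s \<Longrightarrow> s \<le> t \<Longrightarrow> t \<le> T \<Longrightarrow> \<bar>f t - f s\<bar> \<le> g t - g s"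
    and st: "0 \<le> s" "s \<le> t" "t \<le> T"
  shows "total_variation f t \<le> total_variation f s + ennreal (g t - g s)"
  unfolding total_variation_def[of f t]
proof (intro SUP_least)
  fix p :: "nat \<Rightarrow> real" and n assume "p \<in> {p. mono p \<and> range p \<subseteq> {0..t}}"
  then have p: "mono p" "\<And>k. 0 \<le> p k" "\<And>k. p k \<le> t" by (auto simp: image_subset_iff)
  let ?q = "\<lambda>k. min (p k) s" and ?u = "\<lambda>k. max (p k) s"
  have mono_p: "p k \<le> p (Suc k)" for k using p(1) by (simp add: monoD)
  have step: "\<bar>f (p (Suc k)) - f (p k)\<bar> \<le> \<bar>f (?q (Suc k)) - f (?q k)\<bar> + (g (?u (Suc k)) - g (?u k))" for k
  proof -
    \<comment> \<open>Only an interval straddling \<open>s\<close> needs both terms: its part before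
      \<open>s\<close> remains an increment of \<open>f\<close>, its part after \<open>s\<close> is
      charged to \<open>g\<close>. In the other two cases one term vanishes.\<close>
    consider "p (Suc k) \<le> s" | "p k \<le> s" "s \<le> p (Suc k)" | "s \<le> p k" by linarith
    then show ?thesis
    proof cases
      case 1 then show ?thesis using mono_p[of k] by (simp add: min_def max_def)
    next
      case 2
      have "\<bar>f (p (Suc k)) - f s\<bar> \<le> g (p (Suc k)) - g s"
        using g[of s "p (Suc k)"] 2 st p(3)[of "Suc k"] by auto
      moreover have "?q (Suc k) = s" "?q k = p k" "?u (Suc k) = p (Suc k)" "?u k = s"
        using 2 by auto
      ultimately show ?thesis by linarith
    next
      case 3
      then have "?q (Suc k) = s" "?q k = s" "?u (Suc k) = p (Suc k)" "?u k = p k"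
        using mono_p[of k] by auto
      moreover have "\<bar>f (p (Suc k)) - f (p k)\<bar> \<le> g (p (Suc k)) - g (p k)"
        using mono_p[of k] p(2)[of k] p(3)[of "Suc k"] st by (intro g) auto
      ultimately show ?thesis by simp
    qed
  qed
  have u_nonneg: "0 \<le> g (?u (Suc k)) - g (?u k)" for k
    using g[of "?u k" "?u (Suc k)"] mono_p[of k] p(3)[of "Suc k"] st
    by (smt (verit) abs_ge_zero)
  have "(\<Sum>k<n. ennreal \<bar>f (p (Suc k)) - f (p k)\<bar>)
      \<le> (\<Sum>k<n. ennreal \<bar>f (?q (Suc k)) - f (?q k)\<bar> + ennreal (g (?u (Suc k)) - g (?u k)))"
  proof (rule sum_mono)
    fix k
    show "ennreal \<bar>f (p (Suc k)) - f (p k)\<bar> \<le> ennreal \<bar>f (?q (Suc k)) - f (?q k)\<bar> + ennreal (g (?u (Suc k)) - g (?u k))"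
      using ennreal_leI[OF step[of k]] by (subst (asm) ennreal_plus) (use u_nonneg[of k] in auto)
  qed
  also have "\<dots> = (\<Sum>k<n. ennreal \<bar>f (?q (Suc k)) - f (?q k)\<bar>) + ennreal (\<Sum>k<n. g (?u (Suc k)) - g (?u k))"
    using u_nonneg by (simp add: sum.distrib sum_ennreal)
  also have "\<dots> \<le> total_variation f s + ennreal (g t - g s)"
  proof (intro add_mono ennreal_leI)
    show "(\<Sum>k<n. ennreal \<bar>f (?q (Suc k)) - f (?q k)\<bar>) \<le> total_variation f s"
      by (rule sum_le_total_variation) (use p st mono_p in \<open>auto intro!: mono_iff_le_Suc[THEN iffD2] min.mono\<close>)
    have "(\<Sum>k<n. g (?u (Suc k)) - g (?u k)) = g (?u n) - g (?u 0)"
      by (rule sum_lessThan_telescope)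
    also have "\<dots> \<le> g t - g s"
    proof -
      have "g (?u n) \<le> g t"
        using g[of "?u n" t] p(3)[of n] st by (smt (verit))
      moreover have "g s \<le> g (?u 0)"
        using g[of s "?u 0"] p(3)[of 0] st by (smt (verit))
      ultimately show ?thesis by simp
    qed
    finally show "(\<Sum>k<n. g (?u (Suc k)) - g (?u k)) \<le> g t - g s" .
  qed
  finally show "(\<Sum>k<n. ennreal \<bar>f (p (Suc k)) - f (p k)\<bar>) \<le> total_variation f s + ennreal (g t - g s)" .
qed

lemma total_variation_0: "total_variation f 0 = 0"
proof -
  have "total_variation f 0 \<le> ennreal 0"
  proof (rule total_variation_leI)
    fix p :: "nat \<Rightarrow> real" and n assume "range p \<subseteq> {0..0}"
    then have "p k = 0" for k by auto
    then show "(\<Sum>k<n. \<bar>f (p (Suc k)) - f (p k)\<bar>) \<le> 0" by simp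
  qed simp
  then show ?thesis by simp
qed

lemma total_variation_finite:
  assumes "continuously_controlled f" "0 \<le> t"
  shows "total_variation f t < \<infinity>"
proof -
  obtain g where "continuous_on {0..t} g"
    and g: "\<forall>s\<ge>0. \<forall>u\<ge>s. u \<le> t \<longrightarrow> \<bar>f u - f s\<bar> \<le> g u - g s"
    using continuously_controlledE[OF assms] by blast
  have "total_variation f t \<le> total_variation f 0 + ennreal (g t - g 0)"
    using assms using g by (intro total_variation_increment_le[where T=t]) auto
  also have "\<dots> < \<infinity>"
    by (simp add: total_variation_0)
  finally show ?thesis .
qed

text \<open>A partition of \<open>[0,s]\<close> followed by \<open>s\<close> and \<open>t\<close> is
  a partition of \<open>[0,t]\<close>. The infinite case is split off so that the increment can be
  subtracted in the reals.\<close>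

lemma total_variation_increment_ge:
  assumes "0 \<le> s" "s \<le> t"
  shows "total_variation f s + ennreal \<bar>f t - f s\<bar> \<le> total_variation f t"
proof -
  let ?d = "ennreal \<bar>f t - f s\<bar>"
  have *: "(\<Sum>k<n. ennreal \<bar>f (p (Suc k)) - f (p k)\<bar>) + ?d \<le> total_variation f t"
    if "mono p" "range p \<subseteq> {0..s}" for p :: "nat \<Rightarrow> real" and n
  proof -
    \<comment> \<open>Partitions are infinite sequences of which finitely many increments are
      summed, so cutting after index \<open>n\<close> leaves room for \<open>s\<close> and
      \<open>t\<close>. The increment from \<open>p n\<close> to \<open>s\<close> is nonnegative and
      gets discarded.\<close>
    define q where "q k = (if k \<le> n then p k else if k = Suc n then s else t)" for k
    have p: "\<And>k. p k \<le> p (Suc k)" "\<And>k. 0 \<le> p k" "\<And>k. p k \<le> s"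
      using that by (auto simp: monoD image_subset_iff)
    have "mono q"
      unfolding mono_iff_le_Suc
    proof
      fix k show "q k \<le> q (Suc k)"
        using p(1,3)[of k] p(3)[of "Suc k"] assms unfolding q_def by auto
    qed
    moreover have "range q \<subseteq> {0..t}"
    proof safe
      fix k show "q k \<in> {0..t}"
        using p(2,3)[of k] assms unfolding q_def by auto
    qed
    ultimately have "(\<Sum>k<Suc (Suc n). ennreal \<bar>f (q (Suc k)) - f (q k)\<bar>) \<le> total_variation f t"
      by (rule sum_le_total_variation)
    moreover have "(\<Sum>k<n. ennreal \<bar>f (q (Suc k)) - f (q k)\<bar>) = (\<Sum>k<n. ennreal \<bar>f (p (Suc k)) - f (p k)\<bar>)"
      by (intro sum.cong) (auto simp: q_def)
    ultimately have "(\<Sum>k<n. ennreal \<bar>f (p (Suc k)) - f (p k)\<bar>) + ennreal \<bar>f s - f (p n)\<bar> + ?d \<le> total_variation f t"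
      by (simp add: q_def)
    then show ?thesis
      by (rule order_trans[rotated]) (simp add: add_right_mono)
  qed
  show ?thesis
  proof (cases "total_variation f t = \<infinity>")
    case False
    then obtain B where B: "total_variation f t = ennreal B" "0 \<le> B"
      by (cases "total_variation f t") auto
    have "total_variation f s \<le> ennreal (B - \<bar>f t - f s\<bar>)"
    proof (rule total_variation_leI)
      fix p :: "nat \<Rightarrow> real" and n assume "mono p" "range p \<subseteq> {0..s}"
      from *[OF this, of n] show "(\<Sum>k<n. \<bar>f (p (Suc k)) - f (p k)\<bar>) \<le> B - \<bar>f t - f s\<bar>"
        by (simp add: B sum_ennreal sum_nonneg flip: ennreal_plus)
    next
      \<comment> \<open>The empty sum in \<open>*\<close> leaves the single increment from
        \<open>s\<close> to \<open>t\<close>, which is therefore at most \<open>B\<close>.\<close>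
      show "0 \<le> B - \<bar>f t - f s\<bar>"
        using *[of "\<lambda>_. 0" 0] assms B by (simp add: mono_def)
    qed
    then have "total_variation f s + ?d \<le> ennreal (B - \<bar>f t - f s\<bar>) + ?d"
      by (rule add_right_mono)
    also have "\<dots> = ennreal B"
      using *[of "\<lambda>_. 0" 0] assms B by (simp add: mono_def flip: ennreal_plus)
    finally show ?thesis by (simp add: B)
  qed simp
qed

section \<open>The variation as a continuous nondecreasing function of time\<close>

lemma ennreal_abs_var:
  assumes "continuously_controlled f" "0 \<le> t"
  shows "ennreal (abs_var f t) = total_variation f t"
  using total_variation_finite[OF assms] by (simp add: abs_var_def)

lemma abs_var_nonneg: "0 \<le> abs_var f t"
  by (simp add: abs_var_def)

lemma abs_var_0: "abs_var f 0 = 0"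
  by (simp add: abs_var_def total_variation_0)

text \<open>The inequality behind the Jordan decomposition: \<open>abs_var\<close> plus or minus the
  path is nondecreasing, and taken from time \<open>0\<close> it bounds \<open>pos_var\<close> and
  \<open>neg_var\<close> by \<open>abs_var\<close>.\<close>

lemma abs_var_increment_ge:
  assumes "continuously_controlled f" "0 \<le> s" "s \<le> t"
  shows "\<bar>f t - f s\<bar> \<le> abs_var f t - abs_var f s"
proof -
  have "ennreal (abs_var f s + \<bar>f t - f s\<bar>) \<le> ennreal (abs_var f t)"
    using total_variation_increment_ge[OF assms(2,3), of f] assms
    by (simp add: ennreal_abs_var abs_var_nonneg)
  then have "abs_var f s + \<bar>f t - f s\<bar> \<le> abs_var f t"
    by (subst (asm) ennreal_le_iff) (simp_all add: abs_var_nonneg)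
  then show ?thesis
    by simp
qed

text \<open>An increment of \<open>abs_var\<close> lies between \<open>0\<close> and the increment
  of the control, so continuity passes from \<open>g\<close> to \<open>abs_var\<close>.\<close>

lemma continuous_on_abs_var:
  assumes f: "continuously_controlled f"
  shows "continuous_on {0..} (abs_var f)"
proof (rule continuous_on_atLeast_real)
  fix T :: real assume "0 \<le> T"
  obtain g where g_all: "continuous_on {0..T} g"
    "\<forall>s\<ge>0. \<forall>t\<ge>s. t \<le> T \<longrightarrow> \<bar>f t - f s\<bar> \<le> g t - g s"
    using continuously_controlledE[OF f \<open>0 \<le> T\<close>] by blast
  have g: "continuous_on {0..T} g"
    "\<And>s t. 0 \<le> s \<Longrightarrow> s \<le> t \<Longrightarrow> t \<le> T \<Longrightarrow> \<bar>f t - f s\<bar> \<le> g t - g s"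
    using g_all by auto
  show "continuous_on {0..T} (abs_var f)"
  proof (rule continuous_on_dominated_increments[OF g(1)])
    fix s t assume st: "s \<in> {0..T}" "t \<in> {0..T}" "s \<le> t"
    have gst: "0 \<le> g t - g s"
      using g(2)[of s t] st by auto
    have "ennreal (abs_var f t) \<le> ennreal (abs_var f s + (g t - g s))"
      using total_variation_increment_le[OF g(2), where s=s and t=t] st gst
      by (simp add: ennreal_abs_var[OF f] abs_var_nonneg)
    then have "abs_var f t \<le> abs_var f s + (g t - g s)"
      by (subst (asm) ennreal_le_iff) (use gst in \<open>simp_all add: abs_var_nonneg\<close>)
    then show "\<bar>abs_var f t - abs_var f s\<bar> \<le> g t - g s"
      using abs_var_increment_ge[OF f, of s t] st by auto
  qed
qed

text \<open>The triangle inequality on each block of consecutive indices. The index map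
  \<open>i\<close> selects the coarser partition and may repeat indices, which gives empty
  blocks.\<close>

lemma sum_coarse_le_sum_fine:
  fixes h :: "nat \<Rightarrow> real"
  assumes "mono i"
  shows "(\<Sum>k<N. \<bar>h (i (Suc k)) - h (i k)\<bar>) \<le> (\<Sum>j\<in>{i 0..<i N}. \<bar>h (Suc j) - h j\<bar>)"
proof (induction N)
  case (Suc N)
  have le: "i N \<le> i (Suc N)" "i 0 \<le> i N"
    using assms by (auto simp: monoD)
  have "h (i (Suc N)) - h (i N) = (\<Sum>j\<in>{i N..<i (Suc N)}. h (Suc j) - h j)"
    using le by (simp add: sum_Suc_diff')
  then have "\<bar>h (i (Suc N)) - h (i N)\<bar> \<le> (\<Sum>j\<in>{i N..<i (Suc N)}. \<bar>h (Suc j) - h j\<bar>)"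
    by simp
  with Suc have "(\<Sum>k<Suc N. \<bar>h (i (Suc k)) - h (i k)\<bar>)
    \<le> (\<Sum>j\<in>{i 0..<i N}. \<bar>h (Suc j) - h j\<bar>) + (\<Sum>j\<in>{i N..<i (Suc N)}. \<bar>h (Suc j) - h j\<bar>)"
    by simp
  also have "\<dots> = (\<Sum>j\<in>{i 0..<i (Suc N)}. \<bar>h (Suc j) - h j\<bar>)"
    by (rule sum.atLeastLessThan_concat) (use le in auto)
  finally show ?case .
qed simp

definition grid_variation :: "(real \<Rightarrow> real) \<Rightarrow> real \<Rightarrow> nat \<Rightarrow> real" where
  "grid_variation f t n = (\<Sum>j<n. \<bar>f (t * real (Suc j) / real n) - f (t * real j / real n)\<bar>)"

text \<open>A countable family of partitions suffices, which makes the variation of a process measurable.\<close>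

lemma total_variation_eq_SUP_grid:
  assumes f: "continuous_on {0..} f" and t: "0 \<le> t"
  shows "total_variation f t = (SUP n. ennreal (grid_variation f t n))"
proof (rule antisym)
  show "(SUP n. ennreal (grid_variation f t n)) \<le> total_variation f t"
  proof (rule SUP_least)
    fix n
    \<comment> \<open>Capping the index at \<open>n\<close> keeps the infinite sequence inside
      \<open>{0..t}\<close> without adding increments. For \<open>n = 0\<close> all points are
      \<open>0\<close>.\<close>
    define p where "p j = t * real (min j n) / real n" for j
    have "p j \<le> t" for j
      using t by (cases "n = 0") (auto simp: p_def field_simps mult_left_mono)
    moreover have "0 \<le> p j" for j
      using t by (simp add: p_def)
    moreover have "mono p"
      unfolding p_def mono_def using t
      by (auto intro!: divide_right_mono mult_left_mono min.mono simp del: of_nat_min)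
    ultimately have "(\<Sum>j<n. ennreal \<bar>f (p (Suc j)) - f (p j)\<bar>) \<le> total_variation f t"
      by (intro sum_le_total_variation) auto
    moreover have "(\<Sum>j<n. ennreal \<bar>f (p (Suc j)) - f (p j)\<bar>) = ennreal (grid_variation f t n)"
      unfolding grid_variation_def by (subst sum_ennreal[symmetric]) (auto intro!: sum.cong simp: p_def)
    ultimately show "ennreal (grid_variation f t n) \<le> total_variation f t" by simp
  qed
  let ?S = "SUP n. ennreal (grid_variation f t n)"
  show "total_variation f t \<le> ?S"
    unfolding total_variation_def
  proof (intro SUP_least)
    fix p :: "nat \<Rightarrow> real" and N assume "p \<in> {p. mono p \<and> range p \<subseteq> {0..t}}"
    then have p: "mono p" "\<And>k. 0 \<le> p k" "\<And>k. p k \<le> t" by (auto simp: image_subset_iff)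
    show "(\<Sum>k<N. ennreal \<bar>f (p (Suc k)) - f (p k)\<bar>) \<le> ?S"
    proof (cases "t = 0")
      case True
      then have "p k = 0" for k using p(2,3)[of k] by auto
      then show ?thesis by simp
    next
      case False
      then have t: "0 < t" using t by simp
      \<comment> \<open>Partition points are rounded up to the grid of mesh
        \<open>t / Suc n\<close>. Rounded points stay ordered, do not exceed \<open>t\<close>, and
        tend to \<open>p k\<close> from the right, so the sum over \<open>p\<close> is a limit of
        sums over coarsenings of the grid.\<close>
      define i where "i n k = nat \<lceil>p k / t * real (Suc n)\<rceil>" for n k
      have real_i: "real (i n k) = real_of_int \<lceil>p k / t * real (Suc n)\<rceil>" for n k
      proof -
        have "0 \<le> p k / t * real (Suc n)" using p(2)[of k] t by simp
        then show ?thesis unfolding i_def by (simp add: of_nat_nat)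
      qed
      define u where "u n k = t * real (i n k) / real (Suc n)" for n k
      have u_lim: "(\<lambda>n. u n k) \<longlonglongrightarrow> p k" for k
      proof -
        have "(\<lambda>n. t * (real_of_int \<lceil>p k / t * real (Suc n)\<rceil> / real (Suc n))) \<longlonglongrightarrow> t * (p k / t)"
          by (intro tendsto_mult tendsto_const ceiling_grid_tendsto)
        then show ?thesis using t by (simp add: u_def real_i)
      qed
      have u_ge: "p k \<le> u n k" for n k
      proof -
        have "t * (p k / t) \<le> t * (real_of_int \<lceil>p k / t * real (Suc n)\<rceil> / real (Suc n))"
          using t by (intro mult_left_mono le_ceiling_grid) auto
        then show ?thesis using t by (simp add: u_def real_i)
      qed
      have f_lim: "(\<lambda>n. f (u n k)) \<longlonglongrightarrow> f (p k)" for k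
        by (rule at_right_tendsto_ge[OF continuous_on_imp_at_right[OF f p(2)] u_ge u_lim])
      have mono_i: "mono (i n)" for n
        unfolding i_def using t
        by (intro monoI nat_mono ceiling_mono mult_right_mono divide_right_mono monoD[OF p(1)]) auto
      have i_le: "i n k \<le> Suc n" for n k
      proof -
        have "p k / t * real (Suc n) \<le> 1 * real (Suc n)"
          using p(3)[of k] t by (intro mult_right_mono) (auto simp: field_simps)
        then have "\<lceil>p k / t * real (Suc n)\<rceil> \<le> int (Suc n)"
          by (simp add: ceiling_le_iff)
        then show ?thesis unfolding i_def by (simp add: nat_le_iff)
      qed
      have "(\<Sum>k<N. \<bar>f (u n (Suc k)) - f (u n k)\<bar>) \<le> grid_variation f t (Suc n)" for n
      proof -
        have "(\<Sum>k<N. \<bar>f (u n (Suc k)) - f (u n k)\<bar>)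
          \<le> (\<Sum>j\<in>{i n 0..<i n N}. \<bar>f (t * real (Suc j) / real (Suc n)) - f (t * real j / real (Suc n))\<bar>)"
          using sum_coarse_le_sum_fine[OF mono_i[of n], of "\<lambda>j. f (t * real j / real (Suc n))" N]
          by (simp add: u_def)
        also have "\<dots> \<le> grid_variation f t (Suc n)"
          unfolding grid_variation_def using i_le[of n N] by (intro sum_mono2) auto
        finally show ?thesis .
      qed
      then have bd: "ennreal (\<Sum>k<N. \<bar>f (u n (Suc k)) - f (u n k)\<bar>) \<le> ?S" for n
        by (intro SUP_upper2[of "Suc n"] ennreal_leI) auto
      have "(\<lambda>n. ennreal (\<Sum>k<N. \<bar>f (u n (Suc k)) - f (u n k)\<bar>)) \<longlonglongrightarrow> ennreal (\<Sum>k<N. \<bar>f (p (Suc k)) - f (p k)\<bar>)"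
        by (intro tendsto_ennrealI tendsto_sum tendsto_rabs tendsto_diff f_lim)
      then have "ennreal (\<Sum>k<N. \<bar>f (p (Suc k)) - f (p k)\<bar>) \<le> ?S"
        by (rule LIMSEQ_le_const2) (use bd in blast)
      then show ?thesis by (simp add: sum_ennreal)
    qed
  qed
qed

section \<open>Discounted Stieltjes integrals\<close>

lemma pos_var_0: "pos_var f 0 = 0" and neg_var_0: "neg_var f 0 = 0"
  by (simp_all add: pos_var_def neg_var_def abs_var_0)

lemma mono_on_abs_var:
  assumes "continuously_controlled f"
  shows "mono_on {0..} (abs_var f)"
proof (rule mono_onI)
  fix s t :: real assume "s \<in> {0..}" "s \<le> t"
  then show "abs_var f s \<le> abs_var f t"
    using abs_var_increment_ge[OF assms, of s t] by auto
qed

lemma mono_on_pos_var: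
  assumes "continuously_controlled f"
  shows "mono_on {0..} (pos_var f)"
proof (rule mono_onI)
  fix s t :: real assume "s \<in> {0..}" "s \<le> t"
  then show "pos_var f s \<le> pos_var f t"
    using abs_var_increment_ge[OF assms, of s t] unfolding pos_var_def by auto
qed

lemma mono_on_neg_var:
  assumes "continuously_controlled f"
  shows "mono_on {0..} (neg_var f)"
proof (rule mono_onI)
  fix s t :: real assume "s \<in> {0..}" "s \<le> t"
  then show "neg_var f s \<le> neg_var f t"
    using abs_var_increment_ge[OF assms, of s t] unfolding neg_var_def by auto
qed

lemma continuous_on_pos_var: "continuously_controlled f \<Longrightarrow> continuous_on {0..} (pos_var f)"
  unfolding pos_var_def [abs_def]
  by (intro continuous_intros continuous_on_abs_var continuously_controlled_imp_continuous) auto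

lemma continuous_on_neg_var: "continuously_controlled f \<Longrightarrow> continuous_on {0..} (neg_var f)"
  unfolding neg_var_def [abs_def]
  by (intro continuous_intros continuous_on_abs_var continuously_controlled_imp_continuous) auto

lemma pos_var_le_abs_var: "continuously_controlled f \<Longrightarrow> 0 \<le> t \<Longrightarrow> pos_var f t \<le> abs_var f t"
  using abs_var_increment_ge[of f 0 t] by (simp add: pos_var_def abs_var_0)

lemma neg_var_le_abs_var: "continuously_controlled f \<Longrightarrow> 0 \<le> t \<Longrightarrow> neg_var f t \<le> abs_var f t"
  using abs_var_increment_ge[of f 0 t] by (simp add: neg_var_def abs_var_0)

section \<open>Stieltjes measures of nondecreasing continuous paths\<close>

context
  fixes v :: "real \<Rightarrow> real"
  assumes mono: "mono_on {0..} v" and cont: "continuous_on {0..} v"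
begin

lemma continuous_extend_const: "continuous (at_right a) (\<lambda>t. v (max 0 t))"
proof -
  have "continuous_on UNIV (\<lambda>t. v (max 0 t))"
    by (rule continuous_on_compose2[OF cont]) (auto intro!: continuous_intros)
  then show ?thesis
    by (auto intro: continuous_at_imp_continuous_at_within simp: continuous_on_eq_continuous_at)
qed

lemma mono_extend_const: "a \<le> b \<Longrightarrow> v (max 0 a) \<le> v (max 0 b)"
  by (rule mono_onD[OF mono]) auto

lemma emeasure_stieltjes_Ioc:
  assumes "0 \<le> a" "a \<le> b"
  shows "emeasure (stieltjes v) {a<..b} = ennreal (v b - v a)"
  unfolding stieltjes_def
  by (subst emeasure_interval_measure_Ioc)
    (use assms in \<open>auto intro: mono_extend_const continuous_extend_const\<close>)

lemma sigma_finite_stieltjes: "sigma_finite_measure (stieltjes v)"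
  unfolding stieltjes_def
  by (rule sigma_finite_interval_measure) (auto intro: mono_extend_const continuous_extend_const)

end

lemma sets_stieltjes [simp, measurable_cong]: "sets (stieltjes v) = sets borel"
  by (simp add: stieltjes_def)

lemma space_stieltjes [simp]: "space (stieltjes v) = UNIV"
  by (simp add: stieltjes_def)

lemma upto_time_measurable [measurable]: "upto_time \<tau> \<in> sets borel"
  unfolding upto_time_def by measurable

lemma upto_time_mono: "\<sigma> \<le> \<tau> \<Longrightarrow> upto_time \<sigma> \<subseteq> upto_time \<tau>"
  unfolding upto_time_def by auto

lemma nn_integral_exp_tail:
  assumes "0 < r"
  shows "(\<integral>\<^sup>+u. ennreal (r * exp (- r * u)) * indicator {s..} u \<partial>lborel) = ennreal (exp (- r * s))"
proof -
  have "(\<integral>\<^sup>+u. ennreal (r * exp (- r * u)) * indicator {s..} u \<partial>lborel) = ennreal (0 - (- exp (- r * s)))"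
  proof (rule nn_integral_FTC_atLeast)
    show "((\<lambda>u. - exp (- r * u)) has_real_derivative r * exp (- r * u)) (at u)" for u
      by (auto intro!: derivative_eq_intros)
    have "filterlim (\<lambda>u. r * u) at_top at_top"
      using assms by (rule filterlim_tendsto_pos_mult_at_top[OF tendsto_const _ filterlim_ident])
    then have "((\<lambda>u. exp (- (r * u))) \<longlongrightarrow> 0) at_top"
      by (rule filterlim_compose[OF exp_at_bot filterlim_compose[OF filterlim_uminus_at_bot_at_top]])
    then show "((\<lambda>u. - exp (- r * u)) \<longlongrightarrow> 0) at_top"
      using tendsto_minus by fastforce
  qed (use assms in auto)
  then show ?thesis by simp
qed

text \<open>Fubini after writing \<open>e\<^sup>-\<^sup>r\<^sup>s = \<integral>\<^sub>s\<^sup>\<infinity> r e\<^sup>-\<^sup>r\<^sup>u du\<close>. The right-hand side involves only the values of \<open>v\<close>,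
  hence is measurable, monotone and additive in \<open>v\<close>.\<close>

lemma nn_integral_stieltjes_exp:
  assumes r: "0 < r" and v: "mono_on {0..} v" "continuous_on {0..} v" "v 0 = 0"
  shows "(\<integral>\<^sup>+s\<in>upto_time \<tau>. ennreal (exp (- r * s)) \<partial>stieltjes v)
    = (\<integral>\<^sup>+u\<in>{0..}. ennreal (r * exp (- r * u)) * ennreal (v (enn2real (min (ennreal u) \<tau>))) \<partial>lborel)"
proof -
  interpret S: sigma_finite_measure "stieltjes v"
    by (rule sigma_finite_stieltjes[OF v(1,2)])
  interpret P: pair_sigma_finite "stieltjes v" lborel
    by (simp add: pair_sigma_finite_def S.sigma_finite_measure_axioms lborel.sigma_finite_measure_axioms)
  let ?k = "\<lambda>u. ennreal (r * exp (- r * u))"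
  \<comment> \<open>Integrating this kernel over \<open>u\<close> gives the discount factor at
    \<open>s\<close>. Integrating over \<open>s\<close> gives the mass that \<open>v\<close> puts on
    \<open>(0, u]\<close> cut at \<tau>, which is a value of \<open>v\<close> itself because
    \<open>v 0 = 0\<close>.\<close>
  let ?F = "\<lambda>s u. ?k u * (if s \<le> u then 1 else 0) * indicator (upto_time \<tau>) s"
  have F: "(\<lambda>(s, u). ?F s u) \<in> borel_measurable (stieltjes v \<Otimes>\<^sub>M lborel)"
    by measurable
  have "(\<integral>\<^sup>+s\<in>upto_time \<tau>. ennreal (exp (- r * s)) \<partial>stieltjes v)
      = (\<integral>\<^sup>+s. (\<integral>\<^sup>+u. ?F s u \<partial>lborel) \<partial>stieltjes v)"
  proof (rule nn_integral_cong)
    fix s :: real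
    have "(\<integral>\<^sup>+u. ?F s u \<partial>lborel) = (\<integral>\<^sup>+u. ?k u * indicator {s..} u * indicator (upto_time \<tau>) s \<partial>lborel)"
      by (intro nn_integral_cong) (auto simp: indicator_def)
    also have "\<dots> = (\<integral>\<^sup>+u. ?k u * indicator {s..} u \<partial>lborel) * indicator (upto_time \<tau>) s"
      by (rule nn_integral_multc) measurable
    finally show "ennreal (exp (- r * s)) * indicator (upto_time \<tau>) s = (\<integral>\<^sup>+u. ?F s u \<partial>lborel)"
      by (simp only: nn_integral_exp_tail[OF r])
  qed
  also have "\<dots> = (\<integral>\<^sup>+u. (\<integral>\<^sup>+s. ?F s u \<partial>stieltjes v) \<partial>lborel)"
    using P.Fubini'[OF F] by simp
  also have "\<dots> = (\<integral>\<^sup>+u\<in>{0..}. ?k u * ennreal (v (enn2real (min (ennreal u) \<tau>))) \<partial>lborel)"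
  proof (rule nn_integral_cong)
    fix u :: real
    have "(\<integral>\<^sup>+s. ?F s u \<partial>stieltjes v) = (\<integral>\<^sup>+s. ?k u * indicator (upto_time \<tau> \<inter> {..u}) s \<partial>stieltjes v)"
      by (intro nn_integral_cong) (auto simp: indicator_def)
    also have "\<dots> = ?k u * emeasure (stieltjes v) (upto_time \<tau> \<inter> {..u})"
      by (rule nn_integral_cmult_indicator) simp
    also have "\<dots> = ?k u * ennreal (v (enn2real (min (ennreal u) \<tau>))) * indicator {0..} u"
    proof (cases "0 \<le> u")
      case True
      have "upto_time \<tau> \<inter> {..u} = {0<..enn2real (min (ennreal u) \<tau>)}"
      proof (cases \<tau>)
        case (real t)
        then show ?thesis using True
          by (auto simp: upto_time_def min_def)
      next
        case top
        then show ?thesis using True by (auto simp: upto_time_def)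
      qed
      then show ?thesis
        using True v(3) by (simp add: emeasure_stieltjes_Ioc[OF v(1,2)])
    next
      case False
      then have "upto_time \<tau> \<inter> {..u} = {}" by (auto simp: upto_time_def)
      then show ?thesis using False by simp
    qed
    finally show "(\<integral>\<^sup>+s. ?F s u \<partial>stieltjes v) = ?k u * ennreal (v (enn2real (min (ennreal u) \<tau>))) * indicator {0..} u" .
  qed
  finally show ?thesis .
qed

text \<open>No finiteness is assumed: a divergent Bochner integral has the value \<open>0\<close>,
  and so has \<open>enn2real\<close> at infinity.\<close>

lemma set_integral_exp_eq_enn2real:
  "(LINT s:upto_time \<tau>|stieltjes v. exp (- r * s))
    = enn2real (\<integral>\<^sup>+s\<in>upto_time \<tau>. ennreal (exp (- r * s)) \<partial>stieltjes v)"
proof -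
  have "(LINT s:upto_time \<tau>|stieltjes v. exp (- r * s))
    = enn2real (\<integral>\<^sup>+s. ennreal (indicator (upto_time \<tau>) s *\<^sub>R exp (- r * s)) \<partial>stieltjes v)"
    unfolding set_lebesgue_integral_def
    by (rule integral_eq_nn_integral) (auto simp: indicator_def)
  also have "(\<integral>\<^sup>+s. ennreal (indicator (upto_time \<tau>) s *\<^sub>R exp (- r * s)) \<partial>stieltjes v)
      = (\<integral>\<^sup>+s\<in>upto_time \<tau>. ennreal (exp (- r * s)) \<partial>stieltjes v)"
    by (intro nn_integral_cong) (auto simp: indicator_def)
  finally show ?thesis .
qed

text \<open>The order \<open>v \<le> w\<close> of the functions does not order their Stieltjes
  measures; the integrals are ordered because the discount factor is decreasing, so that the Fubini
  form weights the values of \<open>v\<close> and \<open>w\<close> nonnegatively.\<close>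

lemma nn_integral_stieltjes_exp_mono_var:
  assumes r: "0 < r" and v: "mono_on {0..} v" "continuous_on {0..} v" "v 0 = 0"
    and w: "mono_on {0..} w" "continuous_on {0..} w" "w 0 = 0"
    and le: "\<And>t. 0 \<le> t \<Longrightarrow> v t \<le> w t" and "\<sigma> \<le> \<tau>"
  shows "(\<integral>\<^sup>+s\<in>upto_time \<sigma>. ennreal (exp (- r * s)) \<partial>stieltjes v)
    \<le> (\<integral>\<^sup>+s\<in>upto_time \<tau>. ennreal (exp (- r * s)) \<partial>stieltjes w)"
proof -
  have "(\<integral>\<^sup>+s\<in>upto_time \<sigma>. ennreal (exp (- r * s)) \<partial>stieltjes v)
      \<le> (\<integral>\<^sup>+s\<in>upto_time \<sigma>. ennreal (exp (- r * s)) \<partial>stieltjes w)"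
    unfolding nn_integral_stieltjes_exp[OF r v] nn_integral_stieltjes_exp[OF r w]
    by (intro nn_integral_mono mult_right_mono mult_left_mono ennreal_leI le) auto
  also have "\<dots> \<le> (\<integral>\<^sup>+s\<in>upto_time \<tau>. ennreal (exp (- r * s)) \<partial>stieltjes w)"
    using upto_time_mono[OF \<open>\<sigma> \<le> \<tau>\<close>] by (intro nn_integral_mono) (auto simp: indicator_def)
  finally show ?thesis .
qed

text \<open>Monotone convergence over the growing intervals. As \<open>upto_time\<close> contains
  finite times only, the truncations also exhaust it when \<tau> is infinite. Finiteness of the
  limit is needed to return to real values.\<close>

lemma stieltjes_exp_upto_tendsto:
  assumes "(\<integral>\<^sup>+s\<in>upto_time \<tau>. ennreal (exp (- r * s)) \<partial>stieltjes v) < \<infinity>"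
  shows "(\<lambda>n. LINT s:upto_time (min \<tau> (ennreal (real n)))|stieltjes v. exp (- r * s))
    \<longlonglongrightarrow> (LINT s:upto_time \<tau>|stieltjes v. exp (- r * s))"
  unfolding set_integral_exp_eq_enn2real
proof (rule tendsto_enn2real)
  show "(\<lambda>n. \<integral>\<^sup>+s\<in>upto_time (min \<tau> (ennreal (real n))). ennreal (exp (- r * s)) \<partial>stieltjes v)
    \<longlonglongrightarrow> ennreal (enn2real (\<integral>\<^sup>+s\<in>upto_time \<tau>. ennreal (exp (- r * s)) \<partial>stieltjes v))"
  proof -
    have "(\<lambda>n. \<integral>\<^sup>+s\<in>upto_time (min \<tau> (ennreal (real n))). ennreal (exp (- r * s)) \<partial>stieltjes v)
      \<longlonglongrightarrow> (\<integral>\<^sup>+s\<in>upto_time \<tau>. ennreal (exp (- r * s)) \<partial>stieltjes v)"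
    proof (rule nn_integral_LIMSEQ)
      fix s :: real
      show "incseq (\<lambda>n s. ennreal (exp (- r * s)) * indicator (upto_time (min \<tau> (ennreal (real n)))) s)"
        unfolding incseq_def le_fun_def
        by (auto intro!: mult_left_mono simp: indicator_def upto_time_def ennreal_le_iff2)
      show "(\<lambda>n. ennreal (exp (- r * s)) * indicator (upto_time (min \<tau> (ennreal (real n)))) s)
        \<longlonglongrightarrow> ennreal (exp (- r * s)) * indicator (upto_time \<tau>) s"
      proof (rule tendsto_eventually)
        have "\<forall>\<^sub>F n in sequentially. s \<le> real n"
          using filterlim_real_sequentially by (simp add: filterlim_at_top)
        then show "\<forall>\<^sub>F n in sequentially. ennreal (exp (- r * s)) * indicator (upto_time (min \<tau> (ennreal (real n)))) s
          = ennreal (exp (- r * s)) * indicator (upto_time \<tau>) s"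
          by eventually_elim (auto simp: indicator_def upto_time_def ennreal_leI)
      qed
    qed measurable
    then show ?thesis using assms by simp
  qed
qed simp

lemma stieltjes_exp_pos_neg_var_le_disc_abs_var:
  assumes r: "0 < r" and A: "continuously_controlled (\<lambda>t. A t \<omega>)" and "\<sigma> \<le> \<tau>"
  shows "(\<integral>\<^sup>+s\<in>upto_time \<sigma>. ennreal (exp (- r * s)) \<partial>stieltjes (pos_var (\<lambda>t. A t \<omega>))) \<le> disc_abs_var r A \<tau> \<omega>"
    and "(\<integral>\<^sup>+s\<in>upto_time \<sigma>. ennreal (exp (- r * s)) \<partial>stieltjes (neg_var (\<lambda>t. A t \<omega>))) \<le> disc_abs_var r A \<tau> \<omega>"
  unfolding disc_abs_var_def
  using nn_integral_stieltjes_exp_mono_var[OF r mono_on_pos_var[OF A] continuous_on_pos_var[OF A] pos_var_0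
      mono_on_abs_var[OF A] continuous_on_abs_var[OF A] abs_var_0 pos_var_le_abs_var[OF A] assms(3)]
    nn_integral_stieltjes_exp_mono_var[OF r mono_on_neg_var[OF A] continuous_on_neg_var[OF A] neg_var_0
      mono_on_abs_var[OF A] continuous_on_abs_var[OF A] abs_var_0 neg_var_le_abs_var[OF A] assms(3)]
  by simp_all

text \<open>Two numbers between \<open>0\<close> and the discounted total variation differ by at
  most that variation. The bound is uniform in \<sigma> up to and including \<tau>, so one random
  variable dominates the whole stopped functional.\<close>

lemma disc_abs_var_bound:
  assumes "0 < r" "continuously_controlled (\<lambda>t. A t \<omega>)"
    and fin: "disc_abs_var r A \<tau> \<omega> < \<infinity>" and "\<sigma> \<le> \<tau>"
  shows "\<bar>disc_functional r A \<sigma> \<omega>\<bar> \<le> enn2real (disc_abs_var r A \<tau> \<omega>)"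
proof -
  note le = stieltjes_exp_pos_neg_var_le_disc_abs_var[where A=A and \<omega>=\<omega>, OF assms(1,2,4)]
  have "\<bar>enn2real p - enn2real q\<bar> \<le> enn2real d" if "p \<le> d" "q \<le> d" "d < \<infinity>" for p q d :: ennreal
  proof -
    have "enn2real p \<le> enn2real d" "enn2real q \<le> enn2real d"
      using that by (auto intro: enn2real_mono)
    then show ?thesis
      using enn2real_nonneg[of p] enn2real_nonneg[of q] by linarith
  qed
  from this[OF le fin] show ?thesis
    unfolding disc_functional_def stieltjes_integral_def set_integral_exp_eq_enn2real .
qed

lemma disc_functional_tendsto:
  assumes "0 < r" "continuously_controlled (\<lambda>t. A t \<omega>)"
    and fin: "disc_abs_var r A \<tau> \<omega> < \<infinity>"
  shows "(\<lambda>n. disc_functional r A (min \<tau> (ennreal (real n))) \<omega>) \<longlonglongrightarrow> disc_functional r A \<tau> \<omega>"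
  unfolding disc_functional_def stieltjes_integral_def
  by (intro tendsto_diff stieltjes_exp_upto_tendsto
      le_less_trans[OF stieltjes_exp_pos_neg_var_le_disc_abs_var(1)[where A=A and \<omega>=\<omega>] fin]
      le_less_trans[OF stieltjes_exp_pos_neg_var_le_disc_abs_var(2)[where A=A and \<omega>=\<omega>] fin] assms order_refl)

text \<open>The Stieltjes measure depends on \<omega>, so Fubini is applied first: what remains is a
  Lebesgue integral of the variation at times cut at \<tau>. The grid formula turns that variation
  into a countable supremum of jointly measurable evaluations of \<open>A\<close>.\<close>

lemma measurable_disc_abs_var:
  assumes r: "0 < r" and A: "\<And>t. 0 \<le> t \<Longrightarrow> A t \<in> borel_measurable M"
    and ctl: "\<And>\<omega>. \<omega> \<in> space M \<Longrightarrow> continuously_controlled (\<lambda>t. A t \<omega>)"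
    and \<tau>: "\<tau> \<in> borel_measurable M"
  shows "(\<lambda>\<omega>. disc_abs_var r A (\<tau> \<omega>) \<omega>) \<in> borel_measurable M"
proof -
  note [measurable] = \<tau>
  note cont = continuously_controlled_imp_continuous[OF ctl]
  have A': "(\<lambda>(t, \<omega>). A (max 0 t) \<omega>) \<in> borel_measurable (borel \<Otimes>\<^sub>M M)"
    by (rule measurable_right_continuous_process[OF A continuous_on_imp_at_right[OF cont]])
  define V where "V \<omega> u = (SUP n. ennreal (grid_variation (\<lambda>t. A t \<omega>) (enn2real (min (ennreal u) (\<tau> \<omega>))) n))" for \<omega> u
  have eq: "disc_abs_var r A (\<tau> \<omega>) \<omega> = (\<integral>\<^sup>+u\<in>{0..}. ennreal (r * exp (- r * u)) * V \<omega> u \<partial>lborel)"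
    if \<omega>: "\<omega> \<in> space M" for \<omega>
  proof -
    have "disc_abs_var r A (\<tau> \<omega>) \<omega> = (\<integral>\<^sup>+u\<in>{0..}. ennreal (r * exp (- r * u)) *
        ennreal (abs_var (\<lambda>t. A t \<omega>) (enn2real (min (ennreal u) (\<tau> \<omega>)))) \<partial>lborel)"
      unfolding disc_abs_var_def
      by (intro nn_integral_stieltjes_exp r mono_on_abs_var continuous_on_abs_var abs_var_0 ctl \<omega>)
    also have "\<dots> = (\<integral>\<^sup>+u\<in>{0..}. ennreal (r * exp (- r * u)) * V \<omega> u \<partial>lborel)"
      unfolding V_def
      by (simp add: ennreal_abs_var[OF ctl[OF \<omega>]] total_variation_eq_SUP_grid[OF cont[OF \<omega>]])
    finally show ?thesis .
  qed
  have [measurable]: "(\<lambda>x. A (enn2real (min (ennreal (snd x)) (\<tau> (fst x))) * real j / real n) (fst x))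
      \<in> borel_measurable (M \<Otimes>\<^sub>M lborel)" for j n
  proof (rule measurable_process_at_time[OF A'])
    show "(\<lambda>x. enn2real (min (ennreal (snd x)) (\<tau> (fst x))) * real j / real n) \<in> borel_measurable (M \<Otimes>\<^sub>M lborel)"
      by measurable
  qed auto
  have [measurable]: "(\<lambda>x. indicator {0..} (snd x) :: ennreal) \<in> borel_measurable (M \<Otimes>\<^sub>M (lborel :: real measure))"
    by (rule measurable_compose[OF measurable_snd]) measurable
  have "(\<lambda>\<omega>. \<integral>\<^sup>+u\<in>{0..}. ennreal (r * exp (- r * u)) * V \<omega> u \<partial>lborel) \<in> borel_measurable M"
    unfolding V_def grid_variation_def
    by (rule lborel.borel_measurable_nn_integral) (unfold case_prod_beta, measurable)
  then show ?thesis
    by (rule measurable_cong[THEN iffD2, rotated]) (rule eq)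
qed

section \<open>Optional stopping\<close>

lemma usual_filtered_space_subalgebra:
  "usual_filtered_space M F \<Longrightarrow> subalgebra M (F t)"
  by (simp add: usual_filtered_space_def)

lemma stopping_time_measurable:
  assumes "usual_filtered_space M F" "stopping_time F \<tau>"
  shows "\<tau> \<in> borel_measurable M"
  using assms usual_filtered_space_subalgebra[OF assms(1)]
  by (intro measurable_stopping_time[of F]) (auto simp: subalgebra_def)

lemma adapted_measurable:
  assumes "usual_filtered_space M F" "adapted F Z" "0 \<le> t"
  shows "Z t \<in> borel_measurable M"
  using assms usual_filtered_space_subalgebra[OF assms(1)]
  by (auto simp: adapted_def intro: measurable_from_subalg)

text \<open>A bounded factor known at time \<open>s\<close> can be pulled into the conditional
  expectation. Both the mean and the convex domination in optional stopping are obtained from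
  weighted increments of this kind.\<close>

lemma martingale_increment_orthogonal:
  assumes sp: "usual_filtered_space M F" and N: "martingale M F N" and st: "0 \<le> s" "s \<le> t"
    and \<xi>: "\<xi> \<in> borel_measurable (F (ennreal s))" "\<And>\<omega>. \<bar>\<xi> \<omega>\<bar> \<le> B"
  shows "integrable M (\<lambda>\<omega>. \<xi> \<omega> * (N t \<omega> - N s \<omega>))"
    and "(\<integral>\<omega>. \<xi> \<omega> * (N t \<omega> - N s \<omega>) \<partial>M) = 0"
proof -
  interpret prob_space M
    using sp by (simp add: usual_filtered_space_def)
  interpret finite_measure_subalgebra M "F (ennreal s)"
    using usual_filtered_space_subalgebra[OF sp] by unfold_locales
  have \<xi>M: "\<xi> \<in> borel_measurable M"
    by (rule measurable_from_subalg[OF subalg \<xi>(1)])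
  have int: "integrable M (N u)" if "0 \<le> u" for u
    using N that by (simp add: martingale_def)
  have int_\<xi>: "integrable M (\<lambda>\<omega>. \<xi> \<omega> * N u \<omega>)" if "0 \<le> u" for u
  proof (rule Bochner_Integration.integrable_bound[of _ "\<lambda>\<omega>. B * N u \<omega>"])
    have "norm (\<xi> \<omega> * N u \<omega>) \<le> norm (B * N u \<omega>)" for \<omega>
      using mult_right_mono[OF order_trans[OF \<xi>(2)[of \<omega>] abs_ge_self] abs_ge_zero[of "N u \<omega>"]]
      by (simp add: abs_mult)
    then show "AE \<omega> in M. norm (\<xi> \<omega> * N u \<omega>) \<le> norm (B * N u \<omega>)"
      by simp
  qed (use int[OF that] \<xi>M in auto)
  show "integrable M (\<lambda>\<omega>. \<xi> \<omega> * (N t \<omega> - N s \<omega>))"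
    using int_\<xi>[of t] int_\<xi>[of s] st by (simp add: right_diff_distrib)
  have "(\<integral>\<omega>. \<xi> \<omega> * N t \<omega> \<partial>M) = (\<integral>\<omega>. \<xi> \<omega> * real_cond_exp M (F (ennreal s)) (N t) \<omega> \<partial>M)"
    using int[of t] int_\<xi>[of t] st \<xi>(1) by (intro real_cond_exp_intg(2)[symmetric]) auto
  also have "\<dots> = (\<integral>\<omega>. \<xi> \<omega> * N s \<omega> \<partial>M)"
  proof (rule integral_cong_AE)
    have "AE \<omega> in M. real_cond_exp M (F (ennreal s)) (N t) \<omega> = N s \<omega>"
      using N st by (simp add: martingale_def)
    then show "AE \<omega> in M. \<xi> \<omega> * real_cond_exp M (F (ennreal s)) (N t) \<omega> = \<xi> \<omega> * N s \<omega>"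
      by eventually_elim simp
  qed (use \<xi>M int[of s] st in auto)
  finally show "(\<integral>\<omega>. \<xi> \<omega> * (N t \<omega> - N s \<omega>) \<partial>M) = 0"
    using int_\<xi>[of t] int_\<xi>[of s] st by (simp add: right_diff_distrib)
qed

text \<open>Vitali's theorem with uniform integrability expressed through the convex functions
  \<open>y \<mapsto> (\<bar>y\<bar> - K)\<^sup>+\<close>, for which optional sampling gives the domination directly.\<close>

lemma (in finite_measure) integral_eq_of_convex_domination:
  fixes Y :: "nat \<Rightarrow> 'a \<Rightarrow> real"
  assumes int: "\<And>n. integrable M (Y n)" and f: "integrable M f"
    and lim: "\<And>\<omega>. \<omega> \<in> space M \<Longrightarrow> (\<lambda>n. Y n \<omega>) \<longlonglongrightarrow> Z \<omega>"
    and c: "\<And>n. (\<integral>\<omega>. Y n \<omega> \<partial>M) = c"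
    and dom: "\<And>n K. 0 \<le> K \<Longrightarrow> (\<integral>\<omega>. max 0 (\<bar>Y n \<omega>\<bar> - K) \<partial>M) \<le> (\<integral>\<omega>. max 0 (\<bar>f \<omega>\<bar> - K) \<partial>M)"
  shows "integrable M Z" and "(\<integral>\<omega>. Z \<omega> \<partial>M) = c"
proof -
  have Y[measurable]: "Y n \<in> borel_measurable M" for n
    using int by auto
  have Z[measurable]: "Z \<in> borel_measurable M"
    by (rule borel_measurable_LIMSEQ_real[OF lim Y])
  \<comment> \<open>Fatou, with the domination at \<open>K = 0\<close>, bounds the first absolute
    moment of the limit by that of \<open>f\<close>.\<close>
  show Z_int: "integrable M Z"
  proof (rule integrableI_bounded[OF Z])
    have "(\<integral>\<^sup>+\<omega>. ennreal (norm (Z \<omega>)) \<partial>M) = (\<integral>\<^sup>+\<omega>. liminf (\<lambda>n. ennreal (norm (Y n \<omega>))) \<partial>M)"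
    proof (rule nn_integral_cong)
      fix \<omega> assume "\<omega> \<in> space M"
      from lim[OF this] have "(\<lambda>n. ennreal (norm (Y n \<omega>))) \<longlonglongrightarrow> ennreal (norm (Z \<omega>))"
        by (intro tendsto_ennrealI tendsto_norm)
      then show "ennreal (norm (Z \<omega>)) = liminf (\<lambda>n. ennreal (norm (Y n \<omega>)))"
        using lim_imp_Liminf by force
    qed
    also have "\<dots> \<le> liminf (\<lambda>n. \<integral>\<^sup>+\<omega>. ennreal (norm (Y n \<omega>)) \<partial>M)"
      by (rule nn_integral_liminf) measurable
    also have "\<dots> \<le> liminf (\<lambda>n::nat. ennreal (\<integral>\<omega>. \<bar>f \<omega>\<bar> \<partial>M))"
    proof (intro Liminf_mono always_eventually allI)
      fix n
      have "(\<integral>\<^sup>+\<omega>. ennreal (norm (Y n \<omega>)) \<partial>M) = ennreal (\<integral>\<omega>. \<bar>Y n \<omega>\<bar> \<partial>M)"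
        using int[of n] by (subst nn_integral_eq_integral) auto
      also have "\<dots> \<le> ennreal (\<integral>\<omega>. \<bar>f \<omega>\<bar> \<partial>M)"
        using dom[of 0 n] by (auto intro!: ennreal_leI)
      finally show "(\<integral>\<^sup>+\<omega>. ennreal (norm (Y n \<omega>)) \<partial>M) \<le> ennreal (\<integral>\<omega>. \<bar>f \<omega>\<bar> \<partial>M)" .
    qed
    also have "\<dots> < \<infinity>"
      by (simp add: Liminf_const)
    finally show "(\<integral>\<^sup>+\<omega>. ennreal (norm (Z \<omega>)) \<partial>M) < \<infinity>" .
  qed
  \<comment> \<open>Truncation at level \<open>K\<close> removes a part of absolute value exactly
    \<open>max 0 (|y| - K)\<close>, the function in \<open>dom\<close>. The truncated variables are
    bounded by a constant, so \<open>n\<close> tends to infinity at fixed \<open>K\<close>, and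
    \<open>K\<close> afterwards.\<close>
  define tr where "tr K y = max (- K) (min K y)" for K y :: real
  have tr: "\<bar>tr K y\<bar> \<le> K" "\<bar>tr K y\<bar> \<le> \<bar>y\<bar>" "\<bar>y - tr K y\<bar> = max 0 (\<bar>y\<bar> - K)" if "0 \<le> K" for K y
    using that unfolding tr_def by (auto simp: max_def min_def)
  have tr_meas [measurable]: "(\<lambda>\<omega>. tr K (g \<omega>)) \<in> borel_measurable M" if "g \<in> borel_measurable M" for K g
    using that unfolding tr_def by measurable
  have tr_lim: "(\<lambda>n. tr K (g n)) \<longlonglongrightarrow> tr K y" if "g \<longlonglongrightarrow> y" for K g y
    unfolding tr_def by (intro tendsto_max tendsto_min tendsto_const that)
  have bound: "\<bar>c - (\<integral>\<omega>. tr K (Z \<omega>) \<partial>M)\<bar> \<le> (\<integral>\<omega>. max 0 (\<bar>f \<omega>\<bar> - K) \<partial>M)" if K: "0 \<le> K" for K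
  proof (rule LIMSEQ_le_const2)
    show "(\<lambda>n. \<bar>c - (\<integral>\<omega>. tr K (Y n \<omega>) \<partial>M)\<bar>) \<longlonglongrightarrow> \<bar>c - (\<integral>\<omega>. tr K (Z \<omega>) \<partial>M)\<bar>"
    proof (intro tendsto_rabs tendsto_diff tendsto_const integral_dominated_convergence[where w="\<lambda>_. K"])
      show "AE \<omega> in M. (\<lambda>n. tr K (Y n \<omega>)) \<longlonglongrightarrow> tr K (Z \<omega>)"
        using lim tr_lim by auto
    qed (use tr(1)[OF K] in auto)
    show "\<exists>N. \<forall>n\<ge>N. \<bar>c - (\<integral>\<omega>. tr K (Y n \<omega>) \<partial>M)\<bar> \<le> (\<integral>\<omega>. max 0 (\<bar>f \<omega>\<bar> - K) \<partial>M)"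
    proof (intro exI allI impI)
      fix n
      have it: "integrable M (\<lambda>\<omega>. tr K (Y n \<omega>))"
        by (rule integrable_const_bound[where B=K]) (use tr(1)[OF K] in auto)
      have "\<bar>c - (\<integral>\<omega>. tr K (Y n \<omega>) \<partial>M)\<bar> = \<bar>\<integral>\<omega>. Y n \<omega> - tr K (Y n \<omega>) \<partial>M\<bar>"
        using int[of n] it by (simp add: c)
      also have "\<dots> \<le> (\<integral>\<omega>. \<bar>Y n \<omega> - tr K (Y n \<omega>)\<bar> \<partial>M)"
        by (rule integral_abs_bound)
      also have "\<dots> \<le> (\<integral>\<omega>. max 0 (\<bar>f \<omega>\<bar> - K) \<partial>M)"
        using dom[OF K, of n] tr(3)[OF K] by simp
      finally show "\<bar>c - (\<integral>\<omega>. tr K (Y n \<omega>) \<partial>M)\<bar> \<le> (\<integral>\<omega>. max 0 (\<bar>f \<omega>\<bar> - K) \<partial>M)" .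
    qed
  qed
  have "\<bar>c - (\<integral>\<omega>. Z \<omega> \<partial>M)\<bar> \<le> (\<integral>\<omega>. 0 \<partial>M)"
  proof (rule LIMSEQ_le)
    show "(\<lambda>k. \<bar>c - (\<integral>\<omega>. tr (real k) (Z \<omega>) \<partial>M)\<bar>) \<longlonglongrightarrow> \<bar>c - (\<integral>\<omega>. Z \<omega> \<partial>M)\<bar>"
    proof (intro tendsto_rabs tendsto_diff tendsto_const integral_dominated_convergence[where w="\<lambda>\<omega>. \<bar>Z \<omega>\<bar>"])
      have "\<forall>\<^sub>F k in sequentially. tr (real k) y = y" for y
      proof -
        have "\<forall>\<^sub>F k in sequentially. \<bar>y\<bar> \<le> real k"
          using filterlim_real_sequentially by (simp add: filterlim_at_top)
        then show ?thesis by eventually_elim (auto simp: tr_def)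
      qed
      then show "AE \<omega> in M. (\<lambda>k. tr (real k) (Z \<omega>)) \<longlonglongrightarrow> Z \<omega>"
        by (auto intro: tendsto_eventually)
    qed (use tr(2) Z_int in auto)
    show "(\<lambda>k. \<integral>\<omega>. max 0 (\<bar>f \<omega>\<bar> - real k) \<partial>M) \<longlonglongrightarrow> (\<integral>\<omega>. 0 \<partial>M)"
    proof (intro integral_dominated_convergence[where w="\<lambda>\<omega>. \<bar>f \<omega>\<bar>"])
      have "\<forall>\<^sub>F k in sequentially. max 0 (\<bar>y\<bar> - real k) = 0" for y
      proof -
        have "\<forall>\<^sub>F k in sequentially. \<bar>y\<bar> \<le> real k"
          using filterlim_real_sequentially by (simp add: filterlim_at_top)
        then show ?thesis by eventually_elim auto
      qed
      then show "AE \<omega> in M. (\<lambda>k. max 0 (\<bar>f \<omega>\<bar> - real k)) \<longlonglongrightarrow> 0"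
        by (auto intro: tendsto_eventually)
    qed (use f in auto)
    show "\<exists>N. \<forall>k\<ge>N. \<bar>c - (\<integral>\<omega>. tr (real k) (Z \<omega>) \<partial>M)\<bar> \<le> (\<integral>\<omega>. max 0 (\<bar>f \<omega>\<bar> - real k) \<partial>M)"
      using bound by auto
  qed
  then show "(\<integral>\<omega>. Z \<omega> \<partial>M) = c" by simp
qed

text \<open>The time \<tau> cut at \<open>t\<close> is rounded up to a finite grid, where
  \<open>N\<close> becomes a sum of weighted increments with known mean. Right-continuity identifies
  the limit, and conditional convexity, in the form of a subgradient inequality, compares each
  approximation with \<open>N t\<close>.\<close>

lemma optional_stopping:
  assumes sp: "usual_filtered_space M F" and N: "martingale M F N"
    and rc: "\<And>\<omega> u. \<omega> \<in> space M \<Longrightarrow> 0 \<le> u \<Longrightarrow> continuous (at_right u) (\<lambda>s. N s \<omega>)"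
    and \<tau>: "stopping_time F \<tau>" and t: "0 < t"
  shows "integrable M (stopped N \<tau> t)" and "(\<integral>\<omega>. stopped N \<tau> t \<omega> \<partial>M) = (\<integral>\<omega>. N 0 \<omega> \<partial>M)"
proof -
  interpret prob_space M
    using sp by (simp add: usual_filtered_space_def)
  have int: "integrable M (N u)" if "0 \<le> u" for u
    using N that by (simp add: martingale_def)
  have Fmeas: "N u \<in> borel_measurable (F (ennreal u))" if "0 \<le> u" for u
    using N that by (simp add: martingale_def adapted_def)
  define g where "g n j = t * real j / real (Suc n)" for n j
  have g: "0 \<le> g n j" "g n j \<le> g n (Suc j)" "g n 0 = 0" "g n (Suc n) = t" for n j
    unfolding g_def using t by (auto intro!: divide_right_mono)
  \<comment> \<open>The weight is \<open>1\<close> on cells whose left end lies strictly before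
    \<tau>. It is known at that left end, and summing with these weights rounds the stopping time up
    to the grid.\<close>
  define \<xi> where "\<xi> n j \<omega> = (if ennreal (g n j) < \<tau> \<omega> then 1 else 0 :: real)" for n j \<omega>
  have \<xi>: "\<xi> n j \<in> borel_measurable (F (ennreal (g n j)))" "\<bar>\<xi> n j \<omega>\<bar> \<le> 1" "0 \<le> \<xi> n j \<omega>" "\<xi> n j \<omega> \<le> 1" for n j \<omega>
    using stopping_timeD2[OF \<tau>, of "ennreal (g n j)"] unfolding \<xi>_def by auto
  \<comment> \<open>In this form the mean is immediate; \<open>Y_eq\<close> identifies the sum with
    \<open>N\<close> at the rounded time, the form in which the limit is taken.\<close>
  define Y where "Y n \<omega> = N 0 \<omega> + (\<Sum>j<Suc n. \<xi> n j \<omega> * (N (g n (Suc j)) \<omega> - N (g n j) \<omega>))" for n \<omega>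
  define i where "i n \<omega> = nat \<lceil>enn2real (min (ennreal t) (\<tau> \<omega>)) / t * real (Suc n)\<rceil>" for n \<omega>
  have cut: "0 \<le> enn2real (min (ennreal t) (\<tau> \<omega>))" "enn2real (min (ennreal t) (\<tau> \<omega>)) \<le> t" for \<omega>
    using t enn2real_mono[of "min (ennreal t) (\<tau> \<omega>)" "ennreal t"] by auto
  have i_le: "i n \<omega> \<le> Suc n" for n \<omega>
  proof -
    have "enn2real (min (ennreal t) (\<tau> \<omega>)) / t * real (Suc n) \<le> 1 * real (Suc n)"
      using cut(2)[of \<omega>] t by (intro mult_right_mono) (auto simp: field_simps)
    then show ?thesis
      unfolding i_def by (simp add: nat_le_iff ceiling_le_iff)
  qed
  have \<xi>_eq: "\<xi> n j \<omega> = (if j < i n \<omega> then 1 else 0)" if "j < Suc n" for n j \<omega>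
  proof -
    have "g n j < t"
      using mult_strict_left_mono[of "real j" "real (Suc n)" t] that t
      unfolding g_def by (simp add: pos_divide_less_eq del: of_nat_Suc)
    then have "ennreal (g n j) < \<tau> \<omega> \<longleftrightarrow> ennreal (g n j) < min (ennreal t) (\<tau> \<omega>)"
      using g(1)[of n j] by (auto simp: ennreal_less_iff)
    also have "\<dots> \<longleftrightarrow> ennreal (g n j) < ennreal (enn2real (min (ennreal t) (\<tau> \<omega>)))"
      by (subst ennreal_enn2real) (auto simp: min_less_iff_disj)
    also have "\<dots> \<longleftrightarrow> g n j < enn2real (min (ennreal t) (\<tau> \<omega>))"
      using g(1)[of n j] by (simp add: ennreal_less_iff)
    also have "\<dots> \<longleftrightarrow> real j < enn2real (min (ennreal t) (\<tau> \<omega>)) / t * real (Suc n)"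
      unfolding g_def using t by (simp add: field_simps del: of_nat_Suc)
    also have "\<dots> \<longleftrightarrow> j < i n \<omega>"
      unfolding i_def by (simp add: less_ceiling_iff zless_nat_eq_int_zless)
    finally show ?thesis unfolding \<xi>_def by simp
  qed
  have sum_split: "(\<Sum>j<Suc n. \<xi> n j \<omega> * (h (Suc j) - h j)) = h (i n \<omega>) - h 0"
    for n \<omega> and h :: "nat \<Rightarrow> real"
  proof -
    have "(\<Sum>j<Suc n. \<xi> n j \<omega> * (h (Suc j) - h j)) = (\<Sum>j<Suc n. if j < i n \<omega> then h (Suc j) - h j else 0)"
      by (intro sum.cong) (auto simp: \<xi>_eq)
    also have "\<dots> = (\<Sum>j<i n \<omega>. h (Suc j) - h j)"
      using i_le[of n \<omega>] by (intro sum.mono_neutral_cong_right) auto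
    finally show ?thesis by (simp add: sum_lessThan_telescope)
  qed
  have Y_eq: "Y n \<omega> = N (g n (i n \<omega>)) \<omega>" for n \<omega>
    unfolding Y_def using sum_split[of n \<omega> "\<lambda>j. N (g n j) \<omega>"] by (simp add: g)
  have Y_int: "integrable M (Y n)" for n
    unfolding Y_def
    by (intro Bochner_Integration.integrable_add int Bochner_Integration.integrable_sum
        martingale_increment_orthogonal(1)[OF sp N _ _ \<xi>(1,2)] g) simp
  have Y_exp: "(\<integral>\<omega>. Y n \<omega> \<partial>M) = (\<integral>\<omega>. N 0 \<omega> \<partial>M)" for n
  proof -
    have "(\<integral>\<omega>. Y n \<omega> \<partial>M) = (\<integral>\<omega>. N 0 \<omega> \<partial>M) + (\<Sum>j<Suc n. \<integral>\<omega>. \<xi> n j \<omega> * (N (g n (Suc j)) \<omega> - N (g n j) \<omega>) \<partial>M)"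
      unfolding Y_def
      by (subst Bochner_Integration.integral_add Bochner_Integration.integral_sum;
          intro int Bochner_Integration.integrable_sum martingale_increment_orthogonal(1)[OF sp N _ _ \<xi>(1,2)] g refl arg_cong2[where f="(+)"] Bochner_Integration.integral_sum; simp)
    also have "\<dots> = (\<integral>\<omega>. N 0 \<omega> \<partial>M)"
      by (simp add: martingale_increment_orthogonal(2)[OF sp N g(1,2) \<xi>(1,2)] del: sum.lessThan_Suc)
    finally show ?thesis .
  qed
  have dom: "(\<integral>\<omega>. max 0 (\<bar>Y n \<omega>\<bar> - K) \<partial>M) \<le> (\<integral>\<omega>. max 0 (\<bar>N t \<omega>\<bar> - K) \<partial>M)" if K: "0 \<le> K" for n K
  proof -
    define \<phi> where "\<phi> y = max 0 (\<bar>y\<bar> - K)" for y :: real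
    \<comment> \<open>A subgradient of the convex function \<open>\<phi>\<close>, set to
      \<open>0\<close> at the kinks. It is bounded by \<open>1\<close>, as an integrand has to
      be.\<close>
    define d where "d y = (if y > K then 1 else if y < - K then - 1 else 0 :: real)" for y
    have sub: "d y * (y' - y) \<le> \<phi> y' - \<phi> y" for y y'
      unfolding d_def \<phi>_def using K by auto
    have d_meas: "d \<in> borel_measurable borel"
      unfolding d_def by measurable
    have \<eta>: "(\<lambda>\<omega>. (1 - \<xi> n j \<omega>) * d (N (g n j) \<omega>)) \<in> borel_measurable (F (ennreal (g n j)))"
      "\<bar>(1 - \<xi> n j \<omega>) * d (N (g n j) \<omega>)\<bar> \<le> 1" for j \<omega>
    proof -
      show "(\<lambda>\<omega>. (1 - \<xi> n j \<omega>) * d (N (g n j) \<omega>)) \<in> borel_measurable (F (ennreal (g n j)))"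
        using \<xi>(1)[of n j] measurable_compose[OF Fmeas[OF g(1)] d_meas, of n j] by measurable
      show "\<bar>(1 - \<xi> n j \<omega>) * d (N (g n j) \<omega>)\<bar> \<le> 1"
        unfolding \<xi>_def d_def by auto
    qed
    have \<phi>_int: "integrable M (\<lambda>\<omega>. \<phi> (f \<omega>))" if "integrable M f" for f
      unfolding \<phi>_def using that by (intro integrable_max) auto
    \<comment> \<open>The increments of \<open>N\<close> after the rounded stopping time, weighted
      by the subgradient. The sum has mean zero, and the subgradient inequality bounds it by a
      telescoping sum, \<open>\<phi>\<close> at \<open>N t\<close> minus \<open>\<phi>\<close> at
      \<open>Y n\<close>.\<close>
    let ?D = "\<lambda>\<omega>. \<Sum>j<Suc n. ((1 - \<xi> n j \<omega>) * d (N (g n j) \<omega>)) * (N (g n (Suc j)) \<omega> - N (g n j) \<omega>)"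
    have le: "?D \<omega> \<le> \<phi> (N t \<omega>) - \<phi> (Y n \<omega>)" for \<omega>
    proof -
      have "?D \<omega> \<le> (\<Sum>j<Suc n. (1 - \<xi> n j \<omega>) * (\<phi> (N (g n (Suc j)) \<omega>) - \<phi> (N (g n j) \<omega>)))"
        unfolding mult.assoc using \<xi>(4)[of n _ \<omega>] by (intro sum_mono mult_left_mono sub) simp
      also have "\<dots> = (\<Sum>j<Suc n. \<phi> (N (g n (Suc j)) \<omega>) - \<phi> (N (g n j) \<omega>))
          - (\<Sum>j<Suc n. \<xi> n j \<omega> * (\<phi> (N (g n (Suc j)) \<omega>) - \<phi> (N (g n j) \<omega>)))"
        by (simp only: sum_subtractf[symmetric] left_diff_distrib mult_1)
      also have "\<dots> = \<phi> (N t \<omega>) - \<phi> (Y n \<omega>)"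
        unfolding Y_eq sum_split[of n \<omega> "\<lambda>j. \<phi> (N (g n j) \<omega>)"]
        using sum_lessThan_telescope[of "\<lambda>j. \<phi> (N (g n j) \<omega>)" "Suc n"] by (simp add: g del: sum.lessThan_Suc)
      finally show ?thesis .
    qed
    have D_int: "integrable M ?D"
      by (intro Bochner_Integration.integrable_sum martingale_increment_orthogonal(1)[OF sp N g(1,2) \<eta>])
    have "(\<integral>\<omega>. ?D \<omega> \<partial>M) = (\<Sum>j<Suc n. \<integral>\<omega>. ((1 - \<xi> n j \<omega>) * d (N (g n j) \<omega>)) * (N (g n (Suc j)) \<omega> - N (g n j) \<omega>) \<partial>M)"
      by (intro Bochner_Integration.integral_sum martingale_increment_orthogonal(1)[OF sp N g(1,2) \<eta>])
    also have "\<dots> = 0"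
      by (intro sum.neutral ballI martingale_increment_orthogonal(2)[OF sp N g(1,2) \<eta>])
    finally have "0 \<le> (\<integral>\<omega>. \<phi> (N t \<omega>) - \<phi> (Y n \<omega>) \<partial>M)"
      using integral_mono[OF D_int Bochner_Integration.integrable_diff[OF \<phi>_int[OF int[of t]] \<phi>_int[OF Y_int[of n]]] le] t
      by simp
    then have "(\<integral>\<omega>. \<phi> (Y n \<omega>) \<partial>M) \<le> (\<integral>\<omega>. \<phi> (N t \<omega>) \<partial>M)"
      using \<phi>_int[OF int[of t]] \<phi>_int[OF Y_int[of n]] t by simp
    then show ?thesis by (simp add: \<phi>_def)
  qed
  have lim: "(\<lambda>n. Y n \<omega>) \<longlonglongrightarrow> stopped N \<tau> t \<omega>" if \<omega>: "\<omega> \<in> space M" for \<omega>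
    unfolding Y_eq stopped_def
  proof (rule at_right_tendsto_ge[OF rc[OF \<omega> cut(1)]])
    let ?s = "enn2real (min (ennreal t) (\<tau> \<omega>))"
    have g_eq: "g n (i n \<omega>) = t * (real_of_int \<lceil>?s / t * real (Suc n)\<rceil> / real (Suc n))" for n
    proof -
      have "0 \<le> ?s / t * real (Suc n)" using cut(1)[of \<omega>] t by simp
      then have "real (i n \<omega>) = real_of_int \<lceil>?s / t * real (Suc n)\<rceil>"
        unfolding i_def by (simp add: of_nat_nat)
      then show ?thesis unfolding g_def by simp
    qed
    have "(\<lambda>n. t * (real_of_int \<lceil>?s / t * real (Suc n)\<rceil> / real (Suc n))) \<longlonglongrightarrow> t * (?s / t)"
      by (intro tendsto_mult tendsto_const ceiling_grid_tendsto)
    then show "(\<lambda>n. g n (i n \<omega>)) \<longlonglongrightarrow> ?s"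
      using t by (simp add: g_eq)
    show "?s \<le> g n (i n \<omega>)" for n
    proof -
      have "t * (?s / t) \<le> t * (real_of_int \<lceil>?s / t * real (Suc n)\<rceil> / real (Suc n))"
        using t by (intro mult_left_mono le_ceiling_grid) auto
      then show ?thesis using t by (simp add: g_eq)
    qed
  qed
  show "integrable M (stopped N \<tau> t)" "(\<integral>\<omega>. stopped N \<tau> t \<omega> \<partial>M) = (\<integral>\<omega>. N 0 \<omega> \<partial>M)"
    using integral_eq_of_convex_domination[OF Y_int int[of t] lim Y_exp dom] t by auto
qed

section \<open>Stopped processes and removal of the localization\<close>

lemma stopped_time_bounds:
  assumes "0 \<le> t"
  shows "0 \<le> enn2real (min (ennreal t) \<tau>)" "enn2real (min (ennreal t) \<tau>) \<le> t"
    "ennreal (enn2real (min (ennreal t) \<tau>)) = min (ennreal t) \<tau>"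
proof -
  show eq: "ennreal (enn2real (min (ennreal t) \<tau>)) = min (ennreal t) \<tau>"
    by (rule ennreal_enn2real) (auto simp: min_less_iff_disj)
  show "enn2real (min (ennreal t) \<tau>) \<le> t"
    using assms by (intro enn2real_leI) auto
qed simp

text \<open>As \<open>s\<close> decreases to \<open>u\<close>, the stopped time decreases to its
  value at \<open>u\<close> or is already there, so only right limits of \<open>Z\<close> are
  seen.\<close>

lemma continuous_at_right_stopped:
  fixes Z :: "real \<Rightarrow> 'w \<Rightarrow> 'b::topological_space"
  assumes rc: "\<And>u. 0 \<le> u \<Longrightarrow> continuous (at_right u) (\<lambda>s. Z s \<omega>)" and u: "0 \<le> u"
  shows "continuous (at_right u) (\<lambda>s. stopped Z T s \<omega>)"
  unfolding continuous_within stopped_def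
proof (rule at_right_tendsto_eventually_ge[OF rc])
  show "\<forall>\<^sub>F s in at_right u. enn2real (min (ennreal u) (T \<omega>)) \<le> enn2real (min (ennreal s) (T \<omega>))"
    unfolding eventually_at_right_field
    using u by (intro exI[of _ "u + 1"]) (auto intro!: enn2real_mono min.mono ennreal_leI simp: min_less_iff_disj)
  have "((\<lambda>s. min (ennreal s) (T \<omega>)) \<longlongrightarrow> min (ennreal u) (T \<omega>)) (at_right u)"
    by (intro tendsto_min tendsto_const tendsto_ennrealI tendsto_ident_at)
  then show "((\<lambda>s. enn2real (min (ennreal s) (T \<omega>))) \<longlongrightarrow> enn2real (min (ennreal u) (T \<omega>))) (at_right u)"
    using u by (intro tendsto_enn2real) (simp_all add: stopped_time_bounds)
qed simp

lemma measurable_stopped: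
  fixes Z :: "real \<Rightarrow> 'w \<Rightarrow> 'b::metric_space"
  assumes "\<And>t. 0 \<le> t \<Longrightarrow> Z t \<in> borel_measurable M"
    and "\<And>\<omega> t. \<omega> \<in> space M \<Longrightarrow> 0 \<le> t \<Longrightarrow> continuous (at_right t) (\<lambda>s. Z s \<omega>)"
    and [measurable]: "\<tau> \<in> borel_measurable M"
  shows "stopped Z \<tau> t \<in> borel_measurable M"
  unfolding stopped_def [abs_def]
  by (rule measurable_process_at_time[OF measurable_right_continuous_process[OF assms(1,2)]]) auto

text \<open>A local martingale dominated up to \<open>\<tau> \<and> t\<close> is of class DL there, so that localization can be
  removed.\<close>

lemma integral_stopped_local_martingale:
  assumes sp: "usual_filtered_space M F" and Z: "local_martingale M F Z"
    and \<tau>: "stopping_time F \<tau>" and t: "0 < t" and w: "integrable M w"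
    and bd: "AE \<omega> in M. \<forall>s. 0 \<le> s \<longrightarrow> s \<le> t \<longrightarrow> ennreal s \<le> \<tau> \<omega> \<longrightarrow> \<bar>Z s \<omega>\<bar> \<le> w \<omega>"
  shows "integrable M (stopped Z \<tau> t)" and "(\<integral>\<omega>. stopped Z \<tau> t \<omega> \<partial>M) = (\<integral>\<omega>. Z 0 \<omega> \<partial>M)"
proof -
  interpret prob_space M
    using sp by (simp add: usual_filtered_space_def)
  obtain T where T: "localizing M F T" "\<And>k. martingale M F (\<lambda>t \<omega>. stopped Z (T k) t \<omega> - Z 0 \<omega>)"
    using Z unfolding local_martingale_def by blast
  have rc: "continuous (at_right u) (\<lambda>s. Z s \<omega>)" if "\<omega> \<in> space M" "0 \<le> u" for \<omega> u
    using Z that by (simp add: local_martingale_def)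
  have meas: "Z u \<in> borel_measurable M" if "0 \<le> u" for u
    using Z that by (intro adapted_measurable[OF sp]) (auto simp: local_martingale_def)
  note [measurable] = meas[OF order_refl] measurable_stopped[OF meas rc stopping_time_measurable[OF sp \<tau>], of t]
  have Z0: "AE \<omega> in M. \<bar>Z 0 \<omega>\<bar> \<le> w \<omega>"
    using bd by eventually_elim (use t in simp)
  have Zt: "AE \<omega> in M. \<bar>stopped Z \<tau> t \<omega>\<bar> \<le> w \<omega>"
    using bd
  proof eventually_elim
    case (elim \<omega>)
    from elim[rule_format, of "enn2real (min (ennreal t) (\<tau> \<omega>))"] show ?case
      using t by (simp add: stopped_def stopped_time_bounds)
  qed
  have Z0_int: "integrable M (Z 0)"
    by (rule Bochner_Integration.integrable_bound[OF w]) (use Z0 in auto)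
  show Zt_int: "integrable M (stopped Z \<tau> t)"
    by (rule Bochner_Integration.integrable_bound[OF w]) (use Zt in auto)
  \<comment> \<open>Centered as in \<open>local_martingale\<close>, which does not require the
    initial value to be integrable.\<close>
  define N where "N k = (\<lambda>t \<omega>. stopped Z (T k) t \<omega> - Z 0 \<omega>)" for k
  have N_rc: "continuous (at_right u) (\<lambda>s. N k s \<omega>)" if "\<omega> \<in> space M" "0 \<le> u" for k \<omega> u
    unfolding N_def using that
    by (intro continuous_intros continuous_at_right_stopped rc)
  note N_stop = optional_stopping[OF sp T(2)[folded N_def] N_rc \<tau> t]
  have "(\<lambda>k. \<integral>\<omega>. stopped (N k) \<tau> t \<omega> \<partial>M) \<longlonglongrightarrow> (\<integral>\<omega>. stopped Z \<tau> t \<omega> - Z 0 \<omega> \<partial>M)"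
  proof (rule integral_dominated_convergence[where w="\<lambda>\<omega>. 2 * w \<omega>"])
    have "AE \<omega> in M. (\<lambda>k. T k \<omega>) \<longlonglongrightarrow> \<infinity>"
      using T(1) by (simp add: localizing_def)
    then show "AE \<omega> in M. (\<lambda>k. stopped (N k) \<tau> t \<omega>) \<longlonglongrightarrow> stopped Z \<tau> t \<omega> - Z 0 \<omega>"
    proof eventually_elim
      case (elim \<omega>)
      \<comment> \<open>Once \<open>T k\<close> exceeds \<open>t\<close> the localization no longer
        acts, so for almost every \<omega> the sequence is eventually constant.\<close>
      have "\<forall>\<^sub>F k in sequentially. ennreal t < T k \<omega>"
        by (rule order_tendstoD(1)[OF elim]) simp
      then have "\<forall>\<^sub>F k in sequentially. stopped (N k) \<tau> t \<omega> = stopped Z \<tau> t \<omega> - Z 0 \<omega>"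
      proof eventually_elim
        case (elim k)
        have "min (min (ennreal t) (\<tau> \<omega>)) (T k \<omega>) = min (ennreal t) (\<tau> \<omega>)"
          using elim by (auto simp: min_def)
        then show ?case
          using t by (simp add: stopped_def N_def stopped_time_bounds)
      qed
      then show ?case by (rule tendsto_eventually)
    qed
    show "AE \<omega> in M. norm (stopped (N k) \<tau> t \<omega>) \<le> 2 * w \<omega>" for k
      using bd Z0
    proof eventually_elim
      case (elim \<omega>)
      let ?u = "enn2real (min (ennreal t) (\<tau> \<omega>))"
      \<comment> \<open>The least of \<open>t\<close>, \<tau> and \<open>T k\<close>, at which
        \<open>Z\<close> is evaluated; it stays in the range of \<open>bd\<close>. The second
        \<open>w\<close> in \<open>2 * w\<close> pays for subtracting \<open>Z 0\<close>.\<close>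
      let ?s = "enn2real (min (ennreal ?u) (T k \<omega>))"
      have u: "0 \<le> ?u" "?u \<le> t" "ennreal ?u \<le> \<tau> \<omega>"
        using t by (simp_all add: stopped_time_bounds)
      have "0 \<le> ?s" "?s \<le> ?u"
        using u by (simp_all add: stopped_time_bounds)
      moreover have "ennreal ?s \<le> \<tau> \<omega>"
        using u(3) ennreal_leI[OF \<open>?s \<le> ?u\<close>] by (rule order_trans[rotated])
      ultimately have "\<bar>Z ?s \<omega>\<bar> \<le> w \<omega>"
        using elim(1) u(2) by force
      moreover have "stopped (N k) \<tau> t \<omega> = Z ?s \<omega> - Z 0 \<omega>"
        by (simp add: stopped_def N_def)
      ultimately show ?case using elim(2) by simp
    qed
  qed (use w N_stop(1) in auto)
  moreover have "(\<integral>\<omega>. stopped (N k) \<tau> t \<omega> \<partial>M) = 0" for k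
    using N_stop(2)[of k] by (simp add: N_def stopped_def)
  ultimately have "(\<integral>\<omega>. stopped Z \<tau> t \<omega> - Z 0 \<omega> \<partial>M) = 0"
    using LIMSEQ_unique[OF _ tendsto_const] by force
  then show "(\<integral>\<omega>. stopped Z \<tau> t \<omega> \<partial>M) = (\<integral>\<omega>. Z 0 \<omega> \<partial>M)"
    using Z0_int Zt_int by simp
qed

section \<open>The value of an optimal stopping time\<close>

text \<open>On a complete space the exceptional set and each of its subsets are measurable, so
  preimages may be altered there. It serves for variables known only as almost sure limits.\<close>

lemma (in complete_measure) measurable_AE_eq:
  fixes f g :: "'a \<Rightarrow> real"
  assumes g: "g \<in> borel_measurable M" and ae: "AE x in M. f x = g x"
  shows "f \<in> borel_measurable M"
proof (rule borel_measurableI)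
  fix S :: "real set" assume "open S"
  then have S: "g -` S \<inter> space M \<in> sets M"
    by (intro measurable_sets[OF g]) simp
  obtain N where N: "{x \<in> space M. \<not> f x = g x} \<subseteq> N" "N \<in> null_sets M"
    using ae unfolding eventually_ae_filter by blast
  define E where "E = {x \<in> space M. f x \<noteq> g x}"
  define E' where "E' = {x \<in> space M. f x \<noteq> g x \<and> f x \<in> S}"
  have "E \<in> sets M" "E' \<in> sets M"
    using N(1) by (auto intro!: complete[OF _ N(2)] simp: E_def E'_def)
  moreover have "f -` S \<inter> space M = (g -` S \<inter> space M - E) \<union> E'"
    by (auto simp: E_def E'_def)
  ultimately show "f -` S \<inter> space M \<in> sets M"
    using S by (simp add: sets.Un sets.Diff)
qed

lemma integrable_enn2real_of_nn_integral:
  assumes f: "f \<in> borel_measurable M" and fin: "(\<integral>\<^sup>+\<omega>. f \<omega> \<partial>M) < \<infinity>"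
  shows "AE \<omega> in M. f \<omega> \<noteq> \<infinity>" and "integrable M (\<lambda>\<omega>. enn2real (f \<omega>))"
proof -
  show ae: "AE \<omega> in M. f \<omega> \<noteq> \<infinity>"
    by (rule nn_integral_PInf_AE[OF f]) (use fin in simp)
  have "(\<integral>\<^sup>+\<omega>. ennreal (enn2real (f \<omega>)) \<partial>M) = (\<integral>\<^sup>+\<omega>. f \<omega> \<partial>M)"
    by (rule nn_integral_cong_AE) (use ae in \<open>eventually_elim, simp add: less_top\<close>)
  then show "integrable M (\<lambda>\<omega>. enn2real (f \<omega>))"
    using f fin by (intro integrableI_bounded) auto
qed

lemma ext_expectation_real:
  assumes f: "integrable M f" and ae: "AE \<omega> in M. p \<omega> = ereal (f \<omega>)"
  shows "ext_expectation M p = ereal (\<integral>\<omega>. f \<omega> \<partial>M)"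
proof -
  have 1: "(\<integral>\<^sup>+\<omega>. e2ennreal (p \<omega>) \<partial>M) = (\<integral>\<^sup>+\<omega>. ennreal (f \<omega>) \<partial>M)"
    by (rule nn_integral_cong_AE) (use ae in eventually_elim, simp add: ennreal.abs_eq e2ennreal_def ennreal_def)
  have 2: "(\<integral>\<^sup>+\<omega>. e2ennreal (- p \<omega>) \<partial>M) = (\<integral>\<^sup>+\<omega>. ennreal (- f \<omega>) \<partial>M)"
    by (rule nn_integral_cong_AE) (use ae in eventually_elim, simp add: e2ennreal_def ennreal_def)
  have fin: "(\<integral>\<^sup>+\<omega>. ennreal (f \<omega>) \<partial>M) \<noteq> \<infinity>" "(\<integral>\<^sup>+\<omega>. ennreal (- f \<omega>) \<partial>M) \<noteq> \<infinity>"
    using real_integrable_def[of M f] f by auto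
  have real: "enn2ereal q = ereal (enn2real q)" if "q \<noteq> \<infinity>" for q
    using that by (cases q) (auto simp: enn2ereal_ennreal)
  show ?thesis
    unfolding ext_expectation_def 1 2 real_lebesgue_integral_def[OF f] real[OF fin(1)] real[OF fin(2)]
    by simp
qed

text \<open>The two time intervals differ by the point \<open>0\<close>, which is Lebesgue
  null.\<close>

lemma nn_integral_upto_time_continuous:
  assumes f: "continuous_on {0..} f" "\<And>s. 0 \<le> s \<Longrightarrow> 0 \<le> f s" and u: "0 \<le> u"
  shows "(\<integral>\<^sup>+s\<in>upto_time (ennreal u). ennreal (f s) \<partial>lborel) = ennreal (LBINT s:{0..u}. f s)"
    and "0 \<le> (LBINT s:{0..u}. f s)"
proof -
  have int: "set_integrable lborel {0..u} f"
    by (rule borel_integrable_atLeastAtMost') (use f(1) in \<open>auto elim: continuous_on_subset\<close>)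
  have "(\<integral>\<^sup>+s\<in>upto_time (ennreal u). ennreal (f s) \<partial>lborel) = (\<integral>\<^sup>+s. ennreal (indicator {0..u} s *\<^sub>R f s) \<partial>lborel)"
  proof (rule nn_integral_cong_AE)
    show "AE s in lborel. ennreal (f s) * indicator (upto_time (ennreal u)) s = ennreal (indicator {0..u} s *\<^sub>R f s)"
      using AE_lborel_singleton[of 0] by eventually_elim (use u in \<open>auto simp: indicator_def upto_time_def\<close>)
  qed
  also have "\<dots> = ennreal (LBINT s:{0..u}. f s)"
    unfolding set_lebesgue_integral_def using int f(2)
    by (intro nn_integral_eq_integral) (auto simp: set_integrable_def indicator_def)
  finally show "(\<integral>\<^sup>+s\<in>upto_time (ennreal u). ennreal (f s) \<partial>lborel) = ennreal (LBINT s:{0..u}. f s)" .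
  show "0 \<le> (LBINT s:{0..u}. f s)"
    unfolding set_lebesgue_integral_def using f(2)
    by (intro integral_nonneg_AE) (auto simp: indicator_def)
qed

text \<open>Membership in the random interval is rewritten as a condition measurable jointly in
  \<open>s\<close> and \<omega>; the \<open>max 0\<close> is harmless since the interval contains
  positive times only.\<close>

lemma measurable_nn_integral_upto_time:
  assumes k: "\<And>t. 0 \<le> t \<Longrightarrow> k t \<in> borel_measurable M"
    and cont: "\<And>\<omega>. \<omega> \<in> space M \<Longrightarrow> continuous_on {0..} (\<lambda>t. k t \<omega> :: real)"
    and [measurable]: "\<sigma> \<in> borel_measurable M"
  shows "(\<lambda>\<omega>. \<integral>\<^sup>+s\<in>upto_time (\<sigma> \<omega>). ennreal (k s \<omega>) \<partial>lborel) \<in> borel_measurable M"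
proof -
  have "(\<lambda>x. k (max 0 (snd x)) (fst x)) \<in> borel_measurable (M \<Otimes>\<^sub>M lborel)"
    by (rule measurable_process_at_time[OF measurable_right_continuous_process[OF k continuous_on_imp_at_right[OF cont]]]) auto
  then have [measurable]: "(\<lambda>x. ennreal (k (max 0 (snd x)) (fst x))) \<in> borel_measurable (M \<Otimes>\<^sub>M lborel)"
    by measurable
  have "(\<lambda>\<omega>. \<integral>\<^sup>+s. ennreal (k (max 0 s) \<omega>) * (if 0 < s \<and> ennreal s \<le> \<sigma> \<omega> then 1 else 0) \<partial>lborel) \<in> borel_measurable M"
    by (rule lborel.borel_measurable_nn_integral) (unfold case_prod_beta, measurable)
  also have "(\<lambda>\<omega>. \<integral>\<^sup>+s. ennreal (k (max 0 s) \<omega>) * (if 0 < s \<and> ennreal s \<le> \<sigma> \<omega> then 1 else 0) \<partial>lborel)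
      = (\<lambda>\<omega>. \<integral>\<^sup>+s\<in>upto_time (\<sigma> \<omega>). ennreal (k s \<omega>) \<partial>lborel)"
    by (intro ext nn_integral_cong) (auto simp: upto_time_def indicator_def)
  finally show ?thesis .
qed

text \<open>The probabilistic core, freed from the diffusion: \<open>g\<close> is the discounted
  gain, \<open>k\<close> the discounted cost rate, \<open>b\<close> the initial gain, and
  \<open>\<Delta> \<sigma>\<close> the functional up to \<sigma>. Optimality enters only as the
  comparison \<open>opt\<close> with other stopping times.\<close>

lemma optimal_stopping_value_eq:
  fixes g k :: "real \<Rightarrow> 'w \<Rightarrow> real" and \<Delta> :: "ennreal \<Rightarrow> 'w \<Rightarrow> real"
  defines "payoff' \<equiv> \<lambda>\<sigma> \<omega>. (if \<sigma> \<omega> = \<infinity> then 0 else ereal (g (enn2real (\<sigma> \<omega>)) \<omega>))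
      - enn2ereal (\<integral>\<^sup>+s\<in>upto_time (\<sigma> \<omega>). ennreal (k s \<omega>) \<partial>lborel)"
  assumes sp: "usual_filtered_space M F" and \<tau>: "stopping_time F \<tau>"
    and g: "\<And>t. 0 \<le> t \<Longrightarrow> g t \<in> borel_measurable M" "\<And>\<omega>. \<omega> \<in> space M \<Longrightarrow> continuous_on {0..} (\<lambda>t. g t \<omega>)"
      "\<And>t \<omega>. \<omega> \<in> space M \<Longrightarrow> 0 \<le> t \<Longrightarrow> 0 \<le> g t \<omega>"
    and k: "\<And>t. 0 \<le> t \<Longrightarrow> k t \<in> borel_measurable M" "\<And>\<omega>. \<omega> \<in> space M \<Longrightarrow> continuous_on {0..} (\<lambda>t. k t \<omega>)"
      "\<And>t \<omega>. \<omega> \<in> space M \<Longrightarrow> 0 \<le> t \<Longrightarrow> 0 \<le> k t \<omega>"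
    and S: "integrable M S" "AE \<omega> in M. \<forall>t\<ge>0. g t \<omega> \<le> S \<omega> \<and> k t \<omega> \<le> S \<omega>"
    and h: "integrable M h" "AE \<omega> in M. \<forall>\<sigma>\<le>\<tau> \<omega>. \<bar>\<Delta> \<sigma> \<omega>\<bar> \<le> h \<omega>"
    and \<Delta>_lim: "AE \<omega> in M. (\<lambda>n. \<Delta> (min (\<tau> \<omega>) (ennreal (real n))) \<omega>) \<longlonglongrightarrow> \<Delta> (\<tau> \<omega>) \<omega>"
    and Z: "local_martingale M F Z" "(\<integral>\<omega>. Z 0 \<omega> \<partial>M) = 0"
    and ident: "AE \<omega> in M. \<forall>t\<ge>0. g t \<omega> - (LBINT s:{0..t}. k s \<omega>) = b - \<Delta> (ennreal t) \<omega> + Z t \<omega>"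
    and opt: "\<And>\<sigma>. stopping_time F \<sigma> \<Longrightarrow> ext_expectation M (payoff' \<sigma>) \<le> ext_expectation M (payoff' \<tau>)"
  shows "ext_expectation M (payoff' \<tau>) = ereal (b - (\<integral>\<omega>. \<Delta> (\<tau> \<omega>) \<omega> \<partial>M))"
proof -
  interpret prob_space M
    using sp by (simp add: usual_filtered_space_def)
  interpret complete_measure M
    using sp by (simp add: usual_filtered_space_def)
  note [measurable] = stopping_time_measurable[OF sp \<tau>]
  define I where "I u \<omega> = (LBINT s:{0..u}. k s \<omega>)" for u \<omega>
  define cut where "cut n \<omega> = enn2real (min (ennreal (real n)) (\<tau> \<omega>))" for n \<omega>
  have cut: "0 \<le> cut n \<omega>" "cut n \<omega> \<le> real n" "ennreal (cut n \<omega>) = min (\<tau> \<omega>) (ennreal (real n))" "ennreal (cut n \<omega>) \<le> \<tau> \<omega>" for n \<omega>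
    using stopped_time_bounds[of "real n" "\<tau> \<omega>"] unfolding cut_def
    by (simp_all add: min.commute[of "ennreal (real n)"])
  have cost: "(\<integral>\<^sup>+s\<in>upto_time (ennreal u). ennreal (k s \<omega>) \<partial>lborel) = ennreal (I u \<omega>)" "0 \<le> I u \<omega>"
    if "\<omega> \<in> space M" "0 \<le> u" for u \<omega>
    using nn_integral_upto_time_continuous[OF k(2,3)] that unfolding I_def by auto
  \<comment> \<open>\<open>S\<close> dominates the cost rate, so the cost up to \<open>u\<close> is
    bounded by \<open>u * S\<close>, a bound that grows with the horizon.\<close>
  have S_bounds: "AE \<omega> in M. 0 \<le> S \<omega> \<and> (\<forall>u\<ge>0. g u \<omega> \<le> S \<omega> \<and> I u \<omega> \<le> u * S \<omega>)"
    using S(2) AE_space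
  proof eventually_elim
    case (elim \<omega>)
    have S0: "0 \<le> S \<omega>"
      using elim g(3)[of \<omega> 0] by force
    have "I u \<omega> \<le> u * S \<omega>" if u: "0 \<le> u" for u
    proof -
      have "ennreal (I u \<omega>) = (\<integral>\<^sup>+s\<in>upto_time (ennreal u). ennreal (k s \<omega>) \<partial>lborel)"
        using cost elim u by simp
      also have "\<dots> \<le> (\<integral>\<^sup>+s. ennreal (S \<omega>) * indicator {0..u} s \<partial>lborel)"
        using elim u by (intro nn_integral_mono) (auto simp: indicator_def upto_time_def intro!: ennreal_leI)
      also have "\<dots> = ennreal (u * S \<omega>)"
        using u S0 by (simp add: nn_integral_cmult_indicator ennreal_mult' mult.commute)
      finally show ?thesis
        using u S0 by (simp add: ennreal_le_iff)
    qed
    then show ?case using S0 elim by auto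
  qed
  define gn where "gn n \<omega> = g (cut n \<omega>) \<omega>" for n \<omega>
  define In where "In n \<omega> = I (cut n \<omega>) \<omega>" for n \<omega>
  define Zn where "Zn n = stopped Z \<tau> (real n)" for n
  \<comment> \<open>The functional at \<tau> cut at \<open>n\<close>, solved for in
    \<open>ident\<close>. Its measurability comes from the other terms, since none is assumed of
    \<open>\<Delta>\<close>.\<close>
  define Dn where "Dn n \<omega> = b + Zn n \<omega> - gn n \<omega> + In n \<omega>" for n \<omega>
  have gn_meas[measurable]: "gn n \<in> borel_measurable M" for n
    using measurable_stopped[OF g(1) continuous_on_imp_at_right[OF g(2)], of \<tau> "real n"]
    by (simp add: gn_def [abs_def] cut_def stopped_def [abs_def])
  have In_eq: "ennreal (In n \<omega>) = (\<integral>\<^sup>+s\<in>upto_time (min (\<tau> \<omega>) (ennreal (real n))). ennreal (k s \<omega>) \<partial>lborel)"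
    and In_nonneg: "0 \<le> In n \<omega>" if "\<omega> \<in> space M" for n \<omega>
    using cost[OF that cut(1)] by (simp_all add: In_def cut(3))
  have cost_meas: "(\<lambda>\<omega>. \<integral>\<^sup>+s\<in>upto_time (\<sigma> \<omega>). ennreal (k s \<omega>) \<partial>lborel) \<in> borel_measurable M"
    if "\<sigma> \<in> borel_measurable M" for \<sigma>
    by (rule measurable_nn_integral_upto_time[OF k(1,2) that])
  have In_meas[measurable]: "In n \<in> borel_measurable M" for n
  proof -
    have "(\<lambda>\<omega>. enn2real (\<integral>\<^sup>+s\<in>upto_time (min (\<tau> \<omega>) (ennreal (real n))). ennreal (k s \<omega>) \<partial>lborel)) \<in> borel_measurable M"
      by (intro borel_measurable_enn2real cost_meas) measurable
    then show ?thesis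
      by (rule measurable_cong[THEN iffD2, rotated]) (metis In_eq In_nonneg enn2real_ennreal)
  qed
  have gn_int: "integrable M (gn n)" for n
  proof (rule Bochner_Integration.integrable_bound[OF S(1)])
    show "AE \<omega> in M. norm (gn n \<omega>) \<le> norm (S \<omega>)"
      using S_bounds AE_space by eventually_elim (use g(3) cut(1) in \<open>auto simp: gn_def\<close>)
  qed simp
  have In_int: "integrable M (In n)" for n
  proof (rule Bochner_Integration.integrable_bound)
    show "integrable M (\<lambda>\<omega>. real n * S \<omega>)"
      using S(1) by simp
    show "AE \<omega> in M. norm (In n \<omega>) \<le> norm (real n * S \<omega>)"
      using S_bounds AE_space
    proof eventually_elim
      case (elim \<omega>)
      have "In n \<omega> \<le> cut n \<omega> * S \<omega>"
        using elim cut(1) by (auto simp: In_def)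
      also have "\<dots> \<le> real n * S \<omega>"
        using elim cut(2) by (intro mult_right_mono) auto
      finally show ?case using In_nonneg elim by auto
    qed
  qed simp
  have Zn: "integrable M (Zn n)" "(\<integral>\<omega>. Zn n \<omega> \<partial>M) = 0" if n: "0 < n" for n
  proof -
    define w where "w \<omega> = S \<omega> + real n * S \<omega> + \<bar>b\<bar> + h \<omega>" for \<omega>
    have w: "integrable M w"
      unfolding w_def using S(1) h(1) by simp
    have bd: "AE \<omega> in M. \<forall>s. 0 \<le> s \<longrightarrow> s \<le> real n \<longrightarrow> ennreal s \<le> \<tau> \<omega> \<longrightarrow> \<bar>Z s \<omega>\<bar> \<le> w \<omega>"
      using S_bounds AE_space ident h(2)
    proof eventually_elim
      case (elim \<omega>)
      show ?case
      proof (intro allI impI)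
        fix s assume s: "0 \<le> s" "s \<le> real n" "ennreal s \<le> \<tau> \<omega>"
        have "Z s \<omega> = g s \<omega> - I s \<omega> - b + \<Delta> (ennreal s) \<omega>"
          using elim(3) s by (simp add: I_def)
        moreover have "0 \<le> g s \<omega>" "g s \<omega> \<le> S \<omega>" "0 \<le> I s \<omega>" "I s \<omega> \<le> s * S \<omega>"
          using g(3) cost(2) elim(1,2) s by auto
        moreover have "s * S \<omega> \<le> real n * S \<omega>"
          using elim(1) s by (intro mult_right_mono) auto
        moreover have "\<bar>\<Delta> (ennreal s) \<omega>\<bar> \<le> h \<omega>"
          using elim(4) s by auto
        ultimately show "\<bar>Z s \<omega>\<bar> \<le> w \<omega>"
          unfolding w_def by linarith
      qed
    qed
    show "integrable M (Zn n)" "(\<integral>\<omega>. Zn n \<omega> \<partial>M) = 0"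
      unfolding Zn_def using integral_stopped_local_martingale[OF sp Z(1) \<tau> _ w bd] n Z(2) by auto
  qed
  have Dn_eq: "AE \<omega> in M. \<forall>n. Dn n \<omega> = \<Delta> (min (\<tau> \<omega>) (ennreal (real n))) \<omega>"
    using ident
  proof eventually_elim
    case (elim \<omega>)
    show ?case
    proof
      fix n
      have "gn n \<omega> - In n \<omega> = b - \<Delta> (ennreal (cut n \<omega>)) \<omega> + Zn n \<omega>"
        using elim[rule_format, OF cut(1)[of n \<omega>]]
        by (simp add: gn_def In_def I_def Zn_def stopped_def cut_def)
      then show "Dn n \<omega> = \<Delta> (min (\<tau> \<omega>) (ennreal (real n))) \<omega>"
        by (simp add: Dn_def cut(3))
    qed
  qed
  have Dn_int: "integrable M (Dn n)" if "0 < n" for n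
    unfolding Dn_def using gn_int[of n] In_int[of n] Zn(1)[OF that] by simp
  have Dn_exp: "(\<integral>\<omega>. gn n \<omega> \<partial>M) - (\<integral>\<omega>. In n \<omega> \<partial>M) = b - (\<integral>\<omega>. Dn n \<omega> \<partial>M)" if "0 < n" for n
    unfolding Dn_def using gn_int[of n] In_int[of n] Zn[OF that] by (simp add: prob_space)
  have Dn_bound: "AE \<omega> in M. \<forall>n. norm (Dn n \<omega>) \<le> h \<omega>"
    using Dn_eq h(2) by eventually_elim auto
  \<comment> \<open>The index is shifted because the martingale argument requires a positive
    horizon.\<close>
  have Dn_lim: "AE \<omega> in M. (\<lambda>n. Dn (Suc n) \<omega>) \<longlonglongrightarrow> \<Delta> (\<tau> \<omega>) \<omega>"
    using Dn_eq \<Delta>_lim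
  proof eventually_elim
    case (elim \<omega>)
    then have "(\<lambda>n. Dn n \<omega>) \<longlonglongrightarrow> \<Delta> (\<tau> \<omega>) \<omega>" by simp
    then show ?case by (rule LIMSEQ_Suc)
  qed
  have \<Delta>_meas: "(\<lambda>\<omega>. \<Delta> (\<tau> \<omega>) \<omega>) \<in> borel_measurable M"
  proof (rule measurable_AE_eq)
    show "(\<lambda>\<omega>. lim (\<lambda>n. Dn (Suc n) \<omega>)) \<in> borel_measurable M"
      using Dn_int by (intro borel_measurable_lim_metric) auto
    show "AE \<omega> in M. \<Delta> (\<tau> \<omega>) \<omega> = lim (\<lambda>n. Dn (Suc n) \<omega>)"
      using Dn_lim by eventually_elim (simp add: limI)
  qed
  define R where "R = (\<integral>\<omega>. \<Delta> (\<tau> \<omega>) \<omega> \<partial>M)"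
  have R_lim: "(\<lambda>n. \<integral>\<omega>. Dn (Suc n) \<omega> \<partial>M) \<longlonglongrightarrow> R"
    unfolding R_def
  proof (rule integral_dominated_convergence[OF _ _ h(1) Dn_lim])
    show "AE \<omega> in M. norm (Dn (Suc n) \<omega>) \<le> h \<omega>" for n
      using Dn_bound by eventually_elim auto
  qed (use \<Delta>_meas Dn_int in auto)

  have "ereal (b - R) \<le> ext_expectation M (payoff' \<tau>)"
  proof (rule LIMSEQ_le_const2)
    show "(\<lambda>n. ereal (b - (\<integral>\<omega>. Dn (Suc n) \<omega> \<partial>M))) \<longlonglongrightarrow> ereal (b - R)"
      by (intro tendsto_intros R_lim)
    have "ereal (b - (\<integral>\<omega>. Dn (Suc n) \<omega> \<partial>M)) \<le> ext_expectation M (payoff' \<tau>)" for n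
    proof -
      let ?\<sigma> = "\<lambda>\<omega>. min (\<tau> \<omega>) (ennreal (real (Suc n)))"
      have "ext_expectation M (payoff' ?\<sigma>) = ereal (\<integral>\<omega>. gn (Suc n) \<omega> - In (Suc n) \<omega> \<partial>M)"
      proof (rule ext_expectation_real)
        show "AE \<omega> in M. payoff' ?\<sigma> \<omega> = ereal (gn (Suc n) \<omega> - In (Suc n) \<omega>)"
          using AE_space
        proof eventually_elim
          case (elim \<omega>)
          have "?\<sigma> \<omega> \<noteq> \<infinity>" "enn2real (?\<sigma> \<omega>) = cut (Suc n) \<omega>"
            by (auto simp: cut_def min.commute min_def top_unique)
          then show ?case
            unfolding payoff'_def In_eq[OF elim, symmetric]
            using In_nonneg[OF elim] by (simp add: gn_def enn2ereal_ennreal)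
        qed
      qed (use gn_int In_int in simp)
      also have "\<dots> = ereal (b - (\<integral>\<omega>. Dn (Suc n) \<omega> \<partial>M))"
        using Dn_exp[of "Suc n"] gn_int[of "Suc n"] In_int[of "Suc n"] by simp
      finally show ?thesis
        using opt[OF stopping_time_min[OF \<tau> stopping_time_const, of "ennreal (real (Suc n))"]] by simp
    qed
    then show "\<exists>N. \<forall>n\<ge>N. ereal (b - (\<integral>\<omega>. Dn (Suc n) \<omega> \<partial>M)) \<le> ext_expectation M (payoff' \<tau>)"
      by blast
  qed
  moreover have "ext_expectation M (payoff' \<tau>) \<le> ereal (b - R)"
  proof -
    define Q where "Q \<omega> = (\<integral>\<^sup>+s\<in>upto_time (\<tau> \<omega>). ennreal (k s \<omega>) \<partial>lborel)" for \<omega>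
    have Q_meas[measurable]: "Q \<in> borel_measurable M"
      unfolding Q_def [abs_def] by (rule cost_meas) measurable
    have Q_lim: "(\<lambda>n. ennreal (In n \<omega>)) \<longlonglongrightarrow> Q \<omega>" and In_mono: "incseq (\<lambda>n. ennreal (In n \<omega>))"
      if \<omega>: "\<omega> \<in> space M" for \<omega>
    proof -
      let ?f = "\<lambda>n s. ennreal (k (max 0 s) \<omega>) * indicator (upto_time (min (\<tau> \<omega>) (ennreal (real n)))) s"
      have meas: "(\<lambda>s. k (max 0 s) \<omega>) \<in> borel_measurable lborel"
      proof -
        have "continuous_on UNIV (\<lambda>s. k (max 0 s) \<omega>)"
          by (rule continuous_on_compose2[OF k(2)[OF \<omega>]]) (auto intro!: continuous_intros)
        then show ?thesis by (simp add: borel_measurable_continuous_onI)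
      qed
      have eq: "ennreal (In n \<omega>) = (\<integral>\<^sup>+s. ?f n s \<partial>lborel)" for n
        unfolding In_eq[OF \<omega>] by (intro nn_integral_cong) (auto simp: upto_time_def indicator_def)
      have inc: "incseq ?f"
        unfolding incseq_def le_fun_def
        by (auto intro!: mult_left_mono simp: indicator_def upto_time_def ennreal_le_iff2)
      show "incseq (\<lambda>n. ennreal (In n \<omega>))"
        unfolding eq using inc by (auto simp: incseq_def le_fun_def intro!: nn_integral_mono)
      have "(\<lambda>n. \<integral>\<^sup>+s. ?f n s \<partial>lborel) \<longlonglongrightarrow> (\<integral>\<^sup>+s. ennreal (k (max 0 s) \<omega>) * indicator (upto_time (\<tau> \<omega>)) s \<partial>lborel)"
      proof (rule nn_integral_LIMSEQ[OF inc])
        fix s :: real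
        have "\<forall>\<^sub>F n in sequentially. s \<le> real n"
          using filterlim_real_sequentially by (simp add: filterlim_at_top)
        then have "\<forall>\<^sub>F n in sequentially. ?f n s = ennreal (k (max 0 s) \<omega>) * indicator (upto_time (\<tau> \<omega>)) s"
          by eventually_elim (auto simp: indicator_def upto_time_def ennreal_leI)
        then show "(\<lambda>n. ?f n s) \<longlonglongrightarrow> ennreal (k (max 0 s) \<omega>) * indicator (upto_time (\<tau> \<omega>)) s"
          by (rule tendsto_eventually)
      qed (use meas in measurable)
      also have "(\<integral>\<^sup>+s. ennreal (k (max 0 s) \<omega>) * indicator (upto_time (\<tau> \<omega>)) s \<partial>lborel) = Q \<omega>"
        unfolding Q_def by (intro nn_integral_cong) (auto simp: upto_time_def indicator_def)
      finally show "(\<lambda>n. ennreal (In n \<omega>)) \<longlonglongrightarrow> Q \<omega>" unfolding eq .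
    qed
    \<comment> \<open>The expectation identity is solved for the cost. The right-hand side does not
      depend on \<open>n\<close>, so Fatou makes the whole cost up to \<tau> integrable, and it then
      dominates the truncated costs.\<close>
    have In_exp_bound: "(\<integral>\<omega>. In n \<omega> \<partial>M) \<le> (\<integral>\<omega>. S \<omega> \<partial>M) + \<bar>b\<bar> + (\<integral>\<omega>. h \<omega> \<partial>M)" if "0 < n" for n
    proof -
      have "(\<integral>\<omega>. gn n \<omega> \<partial>M) \<le> (\<integral>\<omega>. S \<omega> \<partial>M)"
      proof (rule integral_mono_AE[OF gn_int S(1)])
        show "AE \<omega> in M. gn n \<omega> \<le> S \<omega>"
          using S_bounds by eventually_elim (use cut(1) in \<open>auto simp: gn_def\<close>)
      qed
      moreover have "(\<integral>\<omega>. Dn n \<omega> \<partial>M) \<le> (\<integral>\<omega>. h \<omega> \<partial>M)"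
      proof (rule integral_mono_AE[OF Dn_int[OF that] h(1)])
        show "AE \<omega> in M. Dn n \<omega> \<le> h \<omega>"
          using Dn_bound by eventually_elim (auto simp: abs_le_iff)
      qed
      ultimately show ?thesis using Dn_exp[OF that] by linarith
    qed
    have "(\<integral>\<^sup>+\<omega>. Q \<omega> \<partial>M) \<le> ennreal ((\<integral>\<omega>. S \<omega> \<partial>M) + \<bar>b\<bar> + (\<integral>\<omega>. h \<omega> \<partial>M))"
    proof -
      have "(\<integral>\<^sup>+\<omega>. Q \<omega> \<partial>M) = (\<integral>\<^sup>+\<omega>. liminf (\<lambda>n. ennreal (In (Suc n) \<omega>)) \<partial>M)"
      proof (rule nn_integral_cong)
        fix \<omega> assume "\<omega> \<in> space M"
        then show "Q \<omega> = liminf (\<lambda>n. ennreal (In (Suc n) \<omega>))"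
          using lim_imp_Liminf[OF _ LIMSEQ_Suc[OF Q_lim]] by simp
      qed
      also have "\<dots> \<le> liminf (\<lambda>n. \<integral>\<^sup>+\<omega>. ennreal (In (Suc n) \<omega>) \<partial>M)"
        by (rule nn_integral_liminf) measurable
      also have "\<dots> \<le> liminf (\<lambda>n::nat. ennreal ((\<integral>\<omega>. S \<omega> \<partial>M) + \<bar>b\<bar> + (\<integral>\<omega>. h \<omega> \<partial>M)))"
      proof (intro Liminf_mono always_eventually allI)
        fix n
        have "(\<integral>\<^sup>+\<omega>. ennreal (In (Suc n) \<omega>) \<partial>M) = ennreal (\<integral>\<omega>. In (Suc n) \<omega> \<partial>M)"
          using In_nonneg by (intro nn_integral_eq_integral In_int) auto
        then show "(\<integral>\<^sup>+\<omega>. ennreal (In (Suc n) \<omega>) \<partial>M) \<le> ennreal ((\<integral>\<omega>. S \<omega> \<partial>M) + \<bar>b\<bar> + (\<integral>\<omega>. h \<omega> \<partial>M))"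
          using In_exp_bound[of "Suc n"] by (simp add: ennreal_leI)
      qed
      finally show ?thesis by (simp add: Liminf_const)
    qed
    then have Q_fin: "(\<integral>\<^sup>+\<omega>. Q \<omega> \<partial>M) < \<infinity>"
      by (rule le_less_trans) simp
    note Q_AE = integrable_enn2real_of_nn_integral(1)[OF Q_meas Q_fin]
    note Q_int = integrable_enn2real_of_nn_integral(2)[OF Q_meas Q_fin]
    have In_exp_lim: "(\<lambda>n. \<integral>\<omega>. In (Suc n) \<omega> \<partial>M) \<longlonglongrightarrow> (\<integral>\<omega>. enn2real (Q \<omega>) \<partial>M)"
    proof (rule integral_dominated_convergence[OF _ _ Q_int])
      show "AE \<omega> in M. (\<lambda>n. In (Suc n) \<omega>) \<longlonglongrightarrow> enn2real (Q \<omega>)"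
        using Q_AE AE_space
      proof eventually_elim
        case (elim \<omega>)
        have "(\<lambda>n. ennreal (In (Suc n) \<omega>)) \<longlonglongrightarrow> ennreal (enn2real (Q \<omega>))"
          using LIMSEQ_Suc[OF Q_lim[OF elim(2)]] elim(1) by (simp add: less_top)
        then have "(\<lambda>n. enn2real (ennreal (In (Suc n) \<omega>))) \<longlonglongrightarrow> enn2real (Q \<omega>)"
          by (rule tendsto_enn2real) simp
        then show ?case using In_nonneg[OF elim(2)] by simp
      qed
      show "AE \<omega> in M. norm (In (Suc n) \<omega>) \<le> enn2real (Q \<omega>)" for n
        using Q_AE AE_space
      proof eventually_elim
        case (elim \<omega>)
        have "ennreal (In (Suc n) \<omega>) \<le> Q \<omega>"
          by (rule incseq_le[OF In_mono Q_lim]) (use elim in auto)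
        then have "enn2real (ennreal (In (Suc n) \<omega>)) \<le> enn2real (Q \<omega>)"
          using elim(1) by (intro enn2real_mono) (auto simp: less_top)
        then show ?case using In_nonneg[OF elim(2)] by simp
      qed
    qed measurable
    define g\<tau> where "g\<tau> \<omega> = (if \<tau> \<omega> = \<infinity> then 0 else g (enn2real (\<tau> \<omega>)) \<omega>)" for \<omega>
    \<comment> \<open>The gain counts only if \<tau> has occurred by time \<open>n\<close>. What is
      dropped is nonnegative, which is the source of the inequality, and what remains converges to
      \<open>g\<tau>\<close>, which is \<open>0\<close> where \<tau> is infinite.\<close>
    define gi where "gi n \<omega> = (if \<tau> \<omega> \<le> ennreal (real n) then gn n \<omega> else 0)" for n \<omega>
    have gi_meas[measurable]: "gi n \<in> borel_measurable M" for n
      unfolding gi_def by measurable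
    have gi_eq: "gi n \<omega> = g\<tau> \<omega>" if "\<tau> \<omega> \<le> ennreal (real n)" for n \<omega>
      using that by (auto simp: gi_def gn_def g\<tau>_def cut_def min_absorb2 top_unique)
    have gi_lim: "(\<lambda>n. gi (Suc n) \<omega>) \<longlonglongrightarrow> g\<tau> \<omega>" for \<omega>
    proof (cases "\<tau> \<omega> = \<infinity>")
      case True
      then show ?thesis by (simp add: gi_def g\<tau>_def top_unique)
    next
      case False
      then have "\<tau> \<omega> = ennreal (enn2real (\<tau> \<omega>))" by (simp add: less_top)
      moreover have "\<forall>\<^sub>F n in sequentially. enn2real (\<tau> \<omega>) \<le> real n"
        using filterlim_real_sequentially by (simp add: filterlim_at_top)
      ultimately have "\<forall>\<^sub>F n in sequentially. \<tau> \<omega> \<le> ennreal (real n)"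
        by (elim eventually_mono) (metis ennreal_leI)
      then have "\<forall>\<^sub>F n in sequentially. gi n \<omega> = g\<tau> \<omega>"
        by eventually_elim (rule gi_eq)
      then show ?thesis
        by (intro LIMSEQ_Suc tendsto_eventually)
    qed
    have g\<tau>_meas[measurable]: "g\<tau> \<in> borel_measurable M"
      by (rule borel_measurable_LIMSEQ_real[OF gi_lim]) measurable
    have g\<tau>_int: "integrable M g\<tau>"
    proof (rule Bochner_Integration.integrable_bound[OF S(1)])
      show "AE \<omega> in M. norm (g\<tau> \<omega>) \<le> norm (S \<omega>)"
        using S_bounds AE_space by eventually_elim (use g(3) in \<open>auto simp: g\<tau>_def\<close>)
    qed measurable
    have gi_bounds: "0 \<le> gi n \<omega>" "gi n \<omega> \<le> gn n \<omega>" if "\<omega> \<in> space M" for n \<omega>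
      using g(3)[OF that cut(1)] by (auto simp: gi_def gn_def)
    have "(\<lambda>n. \<integral>\<omega>. gi (Suc n) \<omega> \<partial>M) \<longlonglongrightarrow> (\<integral>\<omega>. g\<tau> \<omega> \<partial>M)"
    proof (rule integral_dominated_convergence[OF _ _ S(1)])
      show "AE \<omega> in M. norm (gi (Suc n) \<omega>) \<le> S \<omega>" for n
        using S_bounds AE_space
      proof eventually_elim
        case (elim \<omega>)
        have "gn (Suc n) \<omega> \<le> S \<omega>"
          using elim(1) cut(1) by (simp add: gn_def)
        then show ?case using gi_bounds[OF elim(2), of "Suc n"] by simp
      qed
    qed (use gi_lim in auto)
    moreover have "(\<lambda>n. b - (\<integral>\<omega>. Dn (Suc n) \<omega> \<partial>M) + (\<integral>\<omega>. In (Suc n) \<omega> \<partial>M)) \<longlonglongrightarrow> b - R + (\<integral>\<omega>. enn2real (Q \<omega>) \<partial>M)"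
      by (intro tendsto_intros R_lim In_exp_lim)
    moreover have "(\<integral>\<omega>. gi (Suc n) \<omega> \<partial>M) \<le> b - (\<integral>\<omega>. Dn (Suc n) \<omega> \<partial>M) + (\<integral>\<omega>. In (Suc n) \<omega> \<partial>M)" for n
    proof -
      have "integrable M (gi (Suc n))"
        by (rule Bochner_Integration.integrable_bound[OF gn_int[of "Suc n"]])
          (use gi_bounds[of _ "Suc n"] in \<open>auto intro!: AE_I2 intro: order_trans[OF _ abs_ge_self]\<close>)
      then have "(\<integral>\<omega>. gi (Suc n) \<omega> \<partial>M) \<le> (\<integral>\<omega>. gn (Suc n) \<omega> \<partial>M)"
        by (rule integral_mono[OF _ gn_int]) (rule gi_bounds)
      then show ?thesis using Dn_exp[of "Suc n"] by simp
    qed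
    ultimately have le: "(\<integral>\<omega>. g\<tau> \<omega> \<partial>M) \<le> b - R + (\<integral>\<omega>. enn2real (Q \<omega>) \<partial>M)"
      by (intro LIMSEQ_le) auto
    have "ext_expectation M (payoff' \<tau>) = ereal (\<integral>\<omega>. g\<tau> \<omega> - enn2real (Q \<omega>) \<partial>M)"
    proof (rule ext_expectation_real)
      show "AE \<omega> in M. payoff' \<tau> \<omega> = ereal (g\<tau> \<omega> - enn2real (Q \<omega>))"
        using Q_AE
      proof eventually_elim
        case (elim \<omega>)
        then obtain q where "Q \<omega> = ennreal q" "0 \<le> q"
          by (cases "Q \<omega>") auto
        then show ?case
          unfolding payoff'_def g\<tau>_def Q_def[symmetric] by (simp add: enn2ereal_ennreal)
      qed
    qed (use g\<tau>_int Q_int in simp)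
    then show ?thesis
      using le g\<tau>_int Q_int by simp
  qed
  ultimately show ?thesis
    unfolding R_def by (rule antisym[rotated])
qed

section \<open>The additive functional along the reflected diffusion\<close>

lemma continuously_controlled_diff:
  assumes "continuously_controlled f1" "continuously_controlled f2"
  shows "continuously_controlled (\<lambda>t. f1 t - f2 t)"
  unfolding continuously_controlled_def
proof (intro allI impI)
  fix T :: real assume T: "0 \<le> T"
  obtain g1 where g1: "continuous_on {0..T} g1" "\<forall>s\<ge>0. \<forall>t\<ge>s. t \<le> T \<longrightarrow> \<bar>f1 t - f1 s\<bar> \<le> g1 t - g1 s"
    using continuously_controlledE[OF assms(1) T] by blast
  obtain g2 where g2: "continuous_on {0..T} g2" "\<forall>s\<ge>0. \<forall>t\<ge>s. t \<le> T \<longrightarrow> \<bar>f2 t - f2 s\<bar> \<le> g2 t - g2 s"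
    using continuously_controlledE[OF assms(2) T] by blast
  show "\<exists>g. continuous_on {0..T} g \<and>
      (\<forall>s\<ge>0. \<forall>t\<ge>s. t \<le> T \<longrightarrow> \<bar>f1 t - f2 t - (f1 s - f2 s)\<bar> \<le> g t - g s)"
  proof (intro exI[of _ "\<lambda>t. g1 t + g2 t"] conjI allI impI)
    fix s t assume "0 \<le> s" "s \<le> t" "t \<le> T"
    then have "\<bar>f1 t - f1 s\<bar> \<le> g1 t - g1 s" "\<bar>f2 t - f2 s\<bar> \<le> g2 t - g2 s"
      using g1(2) g2(2) by auto
    then show "\<bar>f1 t - f2 t - (f1 s - f2 s)\<bar> \<le> g1 t + g2 t - (g1 s + g2 s)"
      by linarith
  qed (intro continuous_on_add g1 g2)
qed

lemma continuously_controlled_cmult: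
  assumes "continuously_controlled f"
  shows "continuously_controlled (\<lambda>t. a * f t)"
  unfolding continuously_controlled_def
proof (intro allI impI)
  fix T :: real assume T: "0 \<le> T"
  obtain g where g: "continuous_on {0..T} g" "\<forall>s\<ge>0. \<forall>t\<ge>s. t \<le> T \<longrightarrow> \<bar>f t - f s\<bar> \<le> g t - g s"
    using continuously_controlledE[OF assms T] by blast
  show "\<exists>g. continuous_on {0..T} g \<and> (\<forall>s\<ge>0. \<forall>t\<ge>s. t \<le> T \<longrightarrow> \<bar>a * f t - a * f s\<bar> \<le> g t - g s)"
  proof (intro exI[of _ "\<lambda>t. \<bar>a\<bar> * g t"] conjI allI impI)
    fix s t assume "0 \<le> s" "s \<le> t" "t \<le> T"
    then have "\<bar>a\<bar> * \<bar>f t - f s\<bar> \<le> \<bar>a\<bar> * (g t - g s)"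
      using g(2) by (intro mult_left_mono) auto
    then show "\<bar>a * f t - a * f s\<bar> \<le> \<bar>a\<bar> * g t - \<bar>a\<bar> * g s"
      by (simp add: abs_mult[symmetric] right_diff_distrib)
  qed (intro continuous_on_mult_left g)
qed

lemma continuously_controlled_mono:
  assumes "mono_on {0..} f" "continuous_on {0..} f"
  shows "continuously_controlled f"
  unfolding continuously_controlled_def
proof (intro allI impI exI[of _ f] conjI)
  fix s t :: real assume "0 \<le> s" "s \<le> t"
  then have "f s \<le> f t"
    by (intro mono_onD[OF assms(1)]) auto
  then show "\<bar>f t - f s\<bar> \<le> f t - f s" by simp
qed (use assms(2) in \<open>auto elim: continuous_on_subset\<close>)

text \<open>The control is linear with slope a bound of the density on \<open>{0..T}\<close>.
  Continuity of the density is not asked for, as \<open>Gamma_ac\<close> may jump across the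
  diagonal.\<close>

lemma continuously_controlled_integral:
  assumes int: "\<And>T. 0 \<le> T \<Longrightarrow> set_integrable lborel {0..T} \<gamma>"
    and bd: "\<And>T. 0 \<le> T \<Longrightarrow> \<exists>B. \<forall>s\<in>{0..T}. \<bar>\<gamma> s\<bar> \<le> B"
  shows "continuously_controlled (\<lambda>t. LBINT s:{0..t}. \<gamma> s)"
  unfolding continuously_controlled_def
proof (intro allI impI)
  fix T :: real assume T: "0 \<le> T"
  then obtain B where B: "\<And>s. s \<in> {0..T} \<Longrightarrow> \<bar>\<gamma> s\<bar> \<le> B"
    using bd by blast
  show "\<exists>g. continuous_on {0..T} g \<and> (\<forall>s\<ge>0. \<forall>t\<ge>s. t \<le> T \<longrightarrow>
      \<bar>(LBINT s:{0..t}. \<gamma> s) - (LBINT s:{0..s}. \<gamma> s)\<bar> \<le> g t - g s)"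
  proof (intro exI[of _ "\<lambda>t. B * t"] conjI allI impI)
    fix s t assume st: "0 \<le> s" "s \<le> t" "t \<le> T"
    have int_st: "set_integrable lborel {s<..t} \<gamma>"
      by (rule set_integrable_subset[OF int[OF T]]) (use st in auto)
    have "{0..t} = {0..s} \<union> {s<..t}" using st by auto
    then have "(LBINT u:{0..t}. \<gamma> u) = (LBINT u:{0..s}. \<gamma> u) + (LBINT u:{s<..t}. \<gamma> u)"
      using set_integral_Un[OF _ int[OF st(1)] int_st] by (simp add: disjoint_iff)
    moreover have "\<bar>LBINT u:{s<..t}. \<gamma> u\<bar> \<le> (LBINT u:{s<..t}. B)"
      unfolding set_lebesgue_integral_def
    proof (rule order_trans[OF integral_abs_bound], rule integral_mono)
      show "integrable lborel (\<lambda>u. \<bar>indicat_real {s<..t} u *\<^sub>R \<gamma> u\<bar>)"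
        using int_st by (simp add: set_integrable_def)
      show "\<bar>indicat_real {s<..t} u *\<^sub>R \<gamma> u\<bar> \<le> indicat_real {s<..t} u *\<^sub>R B" for u
        using B[of u] st by (auto simp: indicator_def)
    qed (use st in simp)
    moreover have "(LBINT u:{s<..t}. B) = B * t - B * s"
      using st by (simp add: set_lebesgue_integral_def algebra_simps)
    ultimately show "\<bar>(LBINT u:{0..t}. \<gamma> u) - (LBINT u:{0..s}. \<gamma> u)\<bar> \<le> B * t - B * s"
      by simp
  qed (intro continuous_intros)
qed

section \<open>Coefficients on the closed quadrant along paths\<close>

lemma closed_orthant: "closed orthant"
proof -
  have "orthant = (\<Inter>i. {x :: real^2. 0 \<le> x $ i})"
    by (auto simp: orthant_def)
  also have "closed \<dots>"
    by (intro closed_INT ballI closed_Collect_le continuous_intros)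
  finally show ?thesis .
qed

lemma orthant_sets [measurable]: "orthant \<in> sets borel"
  using closed_orthant by (rule borel_closed)

text \<open>The coefficients are constrained on the quadrant only. Multiplying by its indicator
  gives a Borel function on the plane, and paths in the quadrant do not see the difference.\<close>

lemma measurable_comp_orthant:
  fixes f :: "real^2 \<Rightarrow> real"
  assumes f: "(\<lambda>x. indicator orthant x * f x) \<in> borel_measurable borel"
    and X: "X \<in> borel_measurable N" "\<And>x. x \<in> space N \<Longrightarrow> X x \<in> orthant"
  shows "(\<lambda>x. f (X x)) \<in> borel_measurable N"
proof -
  have "(\<lambda>x. indicator orthant (X x) * f (X x)) \<in> borel_measurable N"
    by (rule measurable_compose[OF X(1) f])
  then show ?thesis
    by (rule measurable_cong[THEN iffD1, rotated]) (simp add: X(2))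
qed

lemma continuous_on_orthant_measurable:
  fixes f :: "real^2 \<Rightarrow> real"
  assumes "continuous_on orthant f"
  shows "(\<lambda>x. indicator orthant x * f x) \<in> borel_measurable borel"
  using borel_measurable_continuous_on_indicator[OF orthant_sets assms] by simp

lemma continuous_on_gain: "continuous_on A (gain \<alpha>)"
  unfolding gain_def [abs_def] by (intro continuous_intros)

lemma Gamma_ac_measurable:
  assumes "continuous_on orthant \<beta>" "continuous_on orthant c"
  shows "(\<lambda>x. indicator orthant x * Gamma_ac r \<alpha> c \<beta> x) \<in> borel_measurable borel"
proof -
  have [measurable]: "(\<lambda>x. indicator orthant x * c x) \<in> borel_measurable borel"
    "(\<lambda>x. indicator orthant x * gain \<alpha> x) \<in> borel_measurable borel"
    "(\<lambda>x. indicator orthant x * \<beta> x $ i) \<in> borel_measurable borel" for i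
    by (intro continuous_on_orthant_measurable continuous_on_gain assms continuous_intros)+
  have [measurable]: "{x. x $ 1 > \<alpha> * x $ 2} \<in> sets (borel :: (real^2) measure)"
    "{x. x $ 1 < \<alpha> * x $ 2} \<in> sets (borel :: (real^2) measure)"
    by (intro borel_open open_Collect_less continuous_intros)+
  have "(\<lambda>x. indicator orthant x * c x + r * (indicator orthant x * gain \<alpha> x)
      - (indicator orthant x * \<beta> x $ 1) * indicator {x. x $ 1 > \<alpha> * x $ 2} x
      - \<alpha> * (indicator orthant x * \<beta> x $ 2) * indicator {x. x $ 1 < \<alpha> * x $ 2} x) \<in> borel_measurable borel"
    by measurable
  also have "(\<lambda>x. indicator orthant x * c x + r * (indicator orthant x * gain \<alpha> x)
      - (indicator orthant x * \<beta> x $ 1) * indicator {x. x $ 1 > \<alpha> * x $ 2} x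
      - \<alpha> * (indicator orthant x * \<beta> x $ 2) * indicator {x. x $ 1 < \<alpha> * x $ 2} x)
    = (\<lambda>x. indicator orthant x * Gamma_ac r \<alpha> c \<beta> x)"
    by (auto simp: Gamma_ac_def indicator_def algebra_simps)
  finally show ?thesis .
qed

text \<open>Compactness is applied to the continuous majorant obtained by dropping the two
  indicators and taking absolute values termwise.\<close>

lemma Gamma_ac_bounded_on_compact:
  assumes "continuous_on orthant \<beta>" "continuous_on orthant c" "compact Q" "Q \<subseteq> orthant"
  shows "\<exists>B. \<forall>x\<in>Q. \<bar>Gamma_ac r \<alpha> c \<beta> x\<bar> \<le> B"
proof -
  let ?b = "\<lambda>x. \<bar>c x\<bar> + \<bar>r\<bar> * \<bar>gain \<alpha> x\<bar> + \<bar>\<beta> x $ 1\<bar> + \<bar>\<alpha>\<bar> * \<bar>\<beta> x $ 2\<bar>"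
  have "continuous_on Q ?b"
    using assms by (intro continuous_intros continuous_on_gain) (auto elim: continuous_on_subset)
  then have "bounded (?b ` Q)"
    using assms(3) by (intro compact_imp_bounded compact_continuous_image)
  then obtain B where B: "\<And>x. x \<in> Q \<Longrightarrow> \<bar>?b x\<bar> \<le> B"
    by (auto simp: bounded_iff)
  have "\<bar>Gamma_ac r \<alpha> c \<beta> x\<bar> \<le> ?b x" for x
  proof -
    have "\<bar>Gamma_ac r \<alpha> c \<beta> x\<bar> \<le> \<bar>c x\<bar> + \<bar>r * gain \<alpha> x\<bar> + \<bar>\<beta> x $ 1\<bar> + \<bar>\<alpha> * \<beta> x $ 2\<bar>"
      unfolding Gamma_ac_def by (auto simp: indicator_def)
    then show ?thesis by (simp add: abs_mult)
  qed
  then have "\<bar>Gamma_ac r \<alpha> c \<beta> x\<bar> \<le> B" if "x \<in> Q" for x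
    using B[OF that] by (meson abs_ge_self order_trans)
  then show ?thesis by blast
qed

context
  fixes M :: "'w measure" and X :: "real \<Rightarrow> 'w \<Rightarrow> real^2"
  assumes X_meas: "\<And>t. 0 \<le> t \<Longrightarrow> X t \<in> borel_measurable M"
    and X_cont: "\<And>\<omega>. \<omega> \<in> space M \<Longrightarrow> continuous_on {0..} (\<lambda>t. X t \<omega>)"
    and X_orth: "\<And>\<omega> t. \<omega> \<in> space M \<Longrightarrow> 0 \<le> t \<Longrightarrow> X t \<omega> \<in> orthant"
begin

lemma continuous_on_comp_path:
  fixes f :: "real^2 \<Rightarrow> real"
  assumes "continuous_on orthant f" "\<omega> \<in> space M"
  shows "continuous_on {0..} (\<lambda>t. f (X t \<omega>))"
  by (rule continuous_on_compose2[OF assms(1) X_cont]) (use assms(2) X_orth in auto)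

lemma measurable_comp_path:
  fixes f :: "real^2 \<Rightarrow> real"
  assumes "continuous_on orthant f" "0 \<le> t"
  shows "(\<lambda>\<omega>. f (X t \<omega>)) \<in> borel_measurable M"
  by (rule measurable_comp_orthant[OF continuous_on_orthant_measurable[OF assms(1)] X_meas]) (use assms(2) X_orth in auto)

lemma continuously_controlled_Gamma_ac:
  assumes \<beta>: "continuous_on orthant \<beta>" and c: "continuous_on orthant c" and \<omega>: "\<omega> \<in> space M"
  shows "continuously_controlled (\<lambda>t. LBINT s:{0..t}. Gamma_ac r \<alpha> c \<beta> (X s \<omega>))"
proof (rule continuously_controlled_integral)
  fix T :: real assume T: "0 \<le> T"
  have "continuous_on {0..T} (\<lambda>t. X t \<omega>)"
    using X_cont[OF \<omega>] by (rule continuous_on_subset) auto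
  then have "compact ((\<lambda>t. X t \<omega>) ` {0..T})"
    by (rule compact_continuous_image) simp
  then show bd: "\<exists>B. \<forall>s\<in>{0..T}. \<bar>Gamma_ac r \<alpha> c \<beta> (X s \<omega>)\<bar> \<le> B"
    using Gamma_ac_bounded_on_compact[OF \<beta> c, of "(\<lambda>t. X t \<omega>) ` {0..T}"] X_orth[OF \<omega>] by force
  then obtain B where B: "\<And>s. s \<in> {0..T} \<Longrightarrow> \<bar>Gamma_ac r \<alpha> c \<beta> (X s \<omega>)\<bar> \<le> B"
    by blast
  have "continuous_on UNIV (\<lambda>s. X (max 0 s) \<omega>)"
    by (rule continuous_on_compose2[OF X_cont[OF \<omega>]]) (auto intro!: continuous_intros)
  then have "(\<lambda>s. X (max 0 s) \<omega>) \<in> borel_measurable lborel"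
    by (simp add: borel_measurable_continuous_onI)
  then have "(\<lambda>s. Gamma_ac r \<alpha> c \<beta> (X (max 0 s) \<omega>)) \<in> borel_measurable lborel"
    by (rule measurable_comp_orthant[OF Gamma_ac_measurable[OF \<beta> c]]) (use X_orth[OF \<omega>] in auto)
  then have "(\<lambda>s. indicat_real {0..T} s *\<^sub>R Gamma_ac r \<alpha> c \<beta> (X (max 0 s) \<omega>)) \<in> borel_measurable lborel"
    by measurable
  then have meas: "set_borel_measurable lborel {0..T} (\<lambda>s. Gamma_ac r \<alpha> c \<beta> (X s \<omega>))"
    unfolding set_borel_measurable_def
    by (rule measurable_cong[THEN iffD1, rotated]) (auto simp: indicator_def)
  have int_B: "set_integrable lborel {0..T} (\<lambda>s. B)"
    by (rule borel_integrable_atLeastAtMost'[OF continuous_on_const])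
  have "AE s in lborel. s \<in> {0..T} \<longrightarrow> norm (Gamma_ac r \<alpha> c \<beta> (X s \<omega>)) \<le> norm B"
    using order_trans[OF B abs_ge_self] by (intro AE_I2 impI) simp
  then show "set_integrable lborel {0..T} (\<lambda>s. Gamma_ac r \<alpha> c \<beta> (X s \<omega>))"
    by (rule set_integrable_bound[OF int_B meas])
qed

lemma measurable_integral_Gamma_ac:
  assumes \<beta>: "continuous_on orthant \<beta>" and c: "continuous_on orthant c"
  shows "(\<lambda>\<omega>. LBINT s:{0..t}. Gamma_ac r \<alpha> c \<beta> (X s \<omega>)) \<in> borel_measurable M"
proof -
  have "(\<lambda>x. X (max 0 (snd x)) (fst x)) \<in> borel_measurable (M \<Otimes>\<^sub>M lborel)"
    by (rule measurable_process_at_time[OF measurable_right_continuous_process[OF X_meas continuous_on_imp_at_right[OF X_cont]]]) auto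
  then have [measurable]: "(\<lambda>x. Gamma_ac r \<alpha> c \<beta> (X (max 0 (snd x)) (fst x))) \<in> borel_measurable (M \<Otimes>\<^sub>M lborel)"
    by (rule measurable_comp_orthant[OF Gamma_ac_measurable[OF \<beta> c]]) (use X_orth in \<open>auto simp: space_pair_measure\<close>)
  have [measurable]: "(\<lambda>x. indicat_real {0..t} (snd x)) \<in> borel_measurable (M \<Otimes>\<^sub>M lborel)"
    by (rule measurable_compose[OF measurable_snd]) measurable
  have "(\<lambda>\<omega>. \<integral>s. indicat_real {0..t} s * Gamma_ac r \<alpha> c \<beta> (X (max 0 s) \<omega>) \<partial>lborel) \<in> borel_measurable M"
    by (rule lborel.borel_measurable_lebesgue_integral) (unfold case_prod_beta, measurable)
  also have "(\<lambda>\<omega>. \<integral>s. indicat_real {0..t} s * Gamma_ac r \<alpha> c \<beta> (X (max 0 s) \<omega>) \<partial>lborel)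
      = (\<lambda>\<omega>. LBINT s:{0..t}. Gamma_ac r \<alpha> c \<beta> (X s \<omega>))"
    unfolding set_lebesgue_integral_def
    by (intro ext Bochner_Integration.integral_cong) (auto simp: indicator_def)
  finally show ?thesis .
qed

end

lemma LBINT_singleton:
  fixes f :: "real \<Rightarrow> 'b::{banach, second_countable_topology}"
  shows "(LBINT s:{a..a}. f s) = 0"
  unfolding set_lebesgue_integral_def
  by (rule integral_eq_zero_AE) (use AE_lborel_singleton[of a] in \<open>eventually_elim, simp\<close>)

text \<open>The initial condition is contained in the equation: at \<open>t = 0\<close> the drift
  integral, the Ito integral and the reflection term vanish.\<close>

lemma reflected_solution_start:
  assumes "reflected_solution M F W \<beta> \<sigma> \<theta>1 \<theta>2 x X L"
  shows "AE \<omega> in M. X 0 \<omega> = x"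
proof -
  obtain J where J: "\<And>i. ito_integral M F W (\<lambda>s \<omega>. \<sigma> (X s \<omega>) $ i) (\<lambda>t \<omega>. J t \<omega> $ i)"
    and eq: "AE \<omega> in M. \<forall>t\<ge>0. X t \<omega> = x + (LBINT s:{0..t}. \<beta> (X s \<omega>)) + J t \<omega>
             + (\<Sum>i\<in>UNIV. (L t \<omega> $ i) *\<^sub>R refl_vec \<theta>1 \<theta>2 i)"
    using assms unfolding reflected_solution_def by blast
  have L0: "L 0 \<omega> = 0" if "\<omega> \<in> space M" for \<omega>
    using assms that unfolding reflected_solution_def by blast
  have "AE \<omega> in M. \<forall>i. J 0 \<omega> $ i = 0"
    unfolding AE_all_countable
  proof
    fix i show "AE \<omega> in M. J 0 \<omega> $ i = 0"
      using J[of i] unfolding ito_integral_def by blast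
  qed
  with eq AE_space show ?thesis
  proof eventually_elim
    case (elim \<omega>)
    then have "J 0 \<omega> = 0" by (simp add: vec_eq_iff)
    with elim L0[of \<omega>] show ?case
      using LBINT_singleton[of 0 "\<lambda>s. \<beta> (X s \<omega>)"] by simp
  qed
qed

lemma disc_functional_0: "disc_functional r A 0 \<omega> = 0"
proof -
  have "upto_time 0 = {}" by (auto simp: upto_time_def)
  then show ?thesis
    by (simp add: disc_functional_def stieltjes_integral_def set_lebesgue_integral_def)
qed

text \<open>The functional is a linear combination of an integral with locally bounded density and
  of continuous nondecreasing processes, each of which has a continuous control.\<close>

lemma A_tot_controlled_measurable:
  assumes sp: "usual_filtered_space M F"
    and sol: "reflected_solution M F W \<beta> \<sigma> \<theta>1 \<theta>2 x X L"
    and \<Lambda>: "local_time_at_zero M F W Y \<Lambda>"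
    and \<beta>: "continuous_on orthant \<beta>" and c: "continuous_on orthant c"
  shows "\<omega> \<in> space M \<Longrightarrow> continuously_controlled (\<lambda>t. A_tot r \<alpha> c \<beta> \<theta>1 \<theta>2 X L \<Lambda> t \<omega>)"
    and "0 \<le> t \<Longrightarrow> A_tot r \<alpha> c \<beta> \<theta>1 \<theta>2 X L \<Lambda> t \<in> borel_measurable M"
proof -
  have X: "adapted F X" "continuous_paths M X" "\<forall>\<omega>\<in>space M. \<forall>t\<ge>0. X t \<omega> \<in> orthant"
    and L: "adapted F L" "continuous_paths M L" "\<forall>\<omega>\<in>space M. \<forall>i. mono_on {0..} (\<lambda>t. L t \<omega> $ i)"
    using sol unfolding reflected_solution_def by blast+
  have \<Lambda>: "adapted F \<Lambda>" "continuous_paths M \<Lambda>" "\<forall>\<omega>\<in>space M. mono_on {0..} (\<lambda>t. \<Lambda> t \<omega>)"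
    using \<Lambda> unfolding local_time_at_zero_def by blast+
  have X': "X t \<in> borel_measurable M" if "0 \<le> t" for t
    using adapted_measurable[OF sp X(1) that] .
  have X'': "continuous_on {0..} (\<lambda>t. X t \<omega>)" if "\<omega> \<in> space M" for \<omega>
    using X(2) that by (simp add: continuous_paths_def)
  have X''': "X t \<omega> \<in> orthant" if "\<omega> \<in> space M" "0 \<le> t" for t \<omega>
    using X(3) that by blast
  {
    assume \<omega>: "\<omega> \<in> space M"
    have "continuously_controlled (\<lambda>t. \<Lambda> t \<omega>)"
      by (rule continuously_controlled_mono) (use \<Lambda> \<omega> in \<open>auto simp: continuous_paths_def\<close>)
    moreover have "continuously_controlled (\<lambda>t. L t \<omega> $ i)" for i
      by (rule continuously_controlled_mono) (use L \<omega> in \<open>auto simp: continuous_paths_def intro!: continuous_intros\<close>)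
    moreover have "continuously_controlled (\<lambda>t. LBINT s:{0..t}. Gamma_ac r \<alpha> c \<beta> (X s \<omega>))"
      by (rule continuously_controlled_Gamma_ac[OF X' X'' X''' \<beta> c \<omega>])
    ultimately have "continuously_controlled (\<lambda>t. (LBINT s:{0..t}. Gamma_ac r \<alpha> c \<beta> (X s \<omega>)) - (1 / 2) * \<Lambda> t \<omega>
        - (\<alpha> * \<theta>1) * L t \<omega> $ 1 - \<theta>2 * L t \<omega> $ 2)"
      by (intro continuously_controlled_diff continuously_controlled_cmult)
    then show "continuously_controlled (\<lambda>t. A_tot r \<alpha> c \<beta> \<theta>1 \<theta>2 X L \<Lambda> t \<omega>)"
      by (simp add: A_tot_def)
  }
  {
    assume t: "0 \<le> t"
    have [measurable]: "L t \<in> borel_measurable M" "\<Lambda> t \<in> borel_measurable M"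
      using adapted_measurable[OF sp _ t] L(1) \<Lambda>(1) by blast+
    have [measurable]: "(\<lambda>\<omega>. L t \<omega> $ i) \<in> borel_measurable M" for i
      by (rule measurable_compose[OF _ borel_measurable_continuous_onI]) (auto intro!: continuous_intros)
    have [measurable]: "(\<lambda>\<omega>. LBINT s:{0..t}. Gamma_ac r \<alpha> c \<beta> (X s \<omega>)) \<in> borel_measurable M"
      by (rule measurable_integral_Gamma_ac[OF X' X'' X''' \<beta> c])
    show "A_tot r \<alpha> c \<beta> \<theta>1 \<theta>2 X L \<Lambda> t \<in> borel_measurable M"
      unfolding A_tot_def [abs_def] by measurable
  }
qed

text \<open>\<open>S\<close> is \<open>K\<close> times the supremum over time of the discounted
  \<open>\<Psi>\<close> along the path. As gain and cost rate are nonnegative, each is bounded by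
  their sum, hence by \<open>K * \<Psi>\<close>.\<close>

lemma condition_Gr_dominating:
  assumes Gr: "condition_Gr M \<beta> \<sigma> \<theta>1 \<theta>2 r \<alpha> c X" and x: "x \<in> orthant"
    and c: "\<forall>x\<in>orthant. 0 \<le> c x"
    and X_meas: "\<And>t. 0 \<le> t \<Longrightarrow> X x t \<in> borel_measurable M"
    and X_cont: "\<And>\<omega>. \<omega> \<in> space M \<Longrightarrow> continuous_on {0..} (\<lambda>t. X x t \<omega>)"
    and X_orth: "\<And>\<omega> t. \<omega> \<in> space M \<Longrightarrow> 0 \<le> t \<Longrightarrow> X x t \<omega> \<in> orthant"
  obtains S where "integrable M S"
    "AE \<omega> in M. \<forall>t\<ge>0. exp (- r * t) * gain \<alpha> (X x t \<omega>) \<le> S \<omega> \<and> exp (- r * t) * c (X x t \<omega>) \<le> S \<omega>"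
proof -
  obtain \<Psi> g H K where \<Psi>: "C2_orthant \<Psi> g H" and K: "K > 0"
    and le: "\<forall>x\<in>orthant. gain \<alpha> x + c x \<le> K * \<Psi> x"
    and fin: "\<forall>x\<in>orthant. (\<integral>\<^sup>+\<omega>. (SUP t\<in>{0..}. ennreal (exp (- r * t) * \<Psi> (X x t \<omega>))) \<partial>M) < \<infinity>"
    using Gr unfolding condition_Gr_def by blast
  have \<Psi>_cont: "continuous_on orthant \<Psi>"
    unfolding continuous_on_eq_continuous_within
    using \<Psi> by (auto simp: C2_orthant_def intro: has_derivative_continuous)
  have gain_nonneg: "0 \<le> gain \<alpha> y" if "y \<in> orthant" for y
    using that by (auto simp: gain_def orthant_def le_max_iff_disj)
  let ?Y = "\<lambda>t \<omega>. exp (- r * t) * \<Psi> (X x t \<omega>)"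
  have Y_meas[measurable]: "?Y t \<in> borel_measurable M" if "0 \<le> t" for t
    using measurable_comp_path[OF X_meas X_cont X_orth \<Psi>_cont that] by measurable
  have Y_cont: "continuous_on {0..} (\<lambda>t. ?Y t \<omega>)" if "\<omega> \<in> space M" for \<omega>
    by (intro continuous_intros continuous_on_comp_path[OF X_meas X_cont X_orth \<Psi>_cont that])
  define T where "T \<omega> = (SUP t\<in>{0..}. ennreal (?Y t \<omega>))" for \<omega>
  have "(\<lambda>\<omega>. SUP t\<in>{0..} \<inter> \<rat>. ennreal (?Y t \<omega>)) \<in> borel_measurable M"
  proof (rule borel_measurable_SUP)
    show "countable ({0..} \<inter> \<rat> :: real set)"
      by (intro countable_Int2 countable_rat)
    show "(\<lambda>\<omega>. ennreal (?Y t \<omega>)) \<in> borel_measurable M" if "t \<in> {0..} \<inter> \<rat>" for t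
      by (rule measurable_compose[OF Y_meas measurable_ennreal]) (use that in auto)
  qed
  then have T_meas[measurable]: "T \<in> borel_measurable M"
    by (rule measurable_cong[THEN iffD2, rotated]) (unfold T_def, rule SUP_continuous_eq_SUP_Rats[OF Y_cont])
  have T_fin: "(\<integral>\<^sup>+\<omega>. T \<omega> \<partial>M) < \<infinity>"
    unfolding T_def using fin x by blast
  note T_AE = integrable_enn2real_of_nn_integral(1)[OF T_meas T_fin]
  have "integrable M (\<lambda>\<omega>. enn2real (T \<omega>))"
    by (rule integrable_enn2real_of_nn_integral(2)[OF T_meas T_fin])
  then have "integrable M (\<lambda>\<omega>. K * enn2real (T \<omega>))"
    by simp
  moreover have "AE \<omega> in M. \<forall>t\<ge>0. exp (- r * t) * gain \<alpha> (X x t \<omega>) \<le> K * enn2real (T \<omega>)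
      \<and> exp (- r * t) * c (X x t \<omega>) \<le> K * enn2real (T \<omega>)"
    using T_AE AE_space
  proof eventually_elim
    case (elim \<omega>)
    show ?case
    proof (intro allI impI)
      fix t :: real assume t: "0 \<le> t"
      note o = X_orth[OF elim(2) t]
      have "ennreal (?Y t \<omega>) \<le> T \<omega>"
        unfolding T_def using t by (intro SUP_upper) simp
      also have "T \<omega> = ennreal (enn2real (T \<omega>))"
        using elim(1) by (simp add: less_top)
      finally have "?Y t \<omega> \<le> enn2real (T \<omega>)"
        by (simp add: ennreal_le_iff)
      then have *: "K * ?Y t \<omega> \<le> K * enn2real (T \<omega>)"
        using K by (intro mult_left_mono) auto
      have "gain \<alpha> (X x t \<omega>) \<le> K * \<Psi> (X x t \<omega>)" "c (X x t \<omega>) \<le> K * \<Psi> (X x t \<omega>)"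
        using le c gain_nonneg[OF o] o by fastforce+
      then have "exp (- r * t) * gain \<alpha> (X x t \<omega>) \<le> exp (- r * t) * (K * \<Psi> (X x t \<omega>))"
        "exp (- r * t) * c (X x t \<omega>) \<le> exp (- r * t) * (K * \<Psi> (X x t \<omega>))"
        by (auto intro: mult_left_mono)
      moreover have "exp (- r * t) * (K * \<Psi> (X x t \<omega>)) \<le> K * enn2real (T \<omega>)"
        using * by (simp add: mult.left_commute)
      ultimately show "exp (- r * t) * gain \<alpha> (X x t \<omega>) \<le> K * enn2real (T \<omega>)
          \<and> exp (- r * t) * c (X x t \<omega>) \<le> K * enn2real (T \<omega>)"
        by linarith
    qed
  qed
  ultimately show thesis by (rule that)
qed

section \<open>The value identity on the continuation set\<close>

theorem theorem4p3:
  fixes M :: "'w measure" and F :: "ennreal \<Rightarrow> 'w measure"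
    and W :: "real \<Rightarrow> 'w \<Rightarrow> real^2"
    and \<beta> :: "real^2 \<Rightarrow> real^2" and \<sigma> :: "real^2 \<Rightarrow> real^2^2"
    and \<theta>1 \<theta>2 r \<alpha> :: real and c :: "real^2 \<Rightarrow> real"
    and X L :: "real^2 \<Rightarrow> real \<Rightarrow> 'w \<Rightarrow> real^2"
    and \<Lambda> :: "real^2 \<Rightarrow> real \<Rightarrow> 'w \<Rightarrow> real"
    and A MG :: "real^2 \<Rightarrow> real \<Rightarrow> 'w \<Rightarrow> real"
    and m \<Gamma>p \<Gamma>n :: "(real^2) measure"
    and V :: "real^2 \<Rightarrow> ereal" and C D :: "(real^2) set"
    and \<tau>D :: "real^2 \<Rightarrow> 'w \<Rightarrow> ennreal"
  assumes space: "usual_filtered_space M F"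
    and BM: "brownian_motion M F W"
    and D: "condition_D M F W \<beta> \<sigma> \<theta>1 \<theta>2 X L"
    and r: "r > 0" and \<alpha>: "\<alpha> > 0"
    and c: "continuous_on orthant c" "\<forall>x\<in>orthant. c x \<ge> 0"
    and Gr: "condition_Gr M \<beta> \<sigma> \<theta>1 \<theta>2 r \<alpha> c X"
    and local_time: "\<forall>x\<in>orthant. local_time_at_zero M F W (diag_process \<alpha> (X x)) (\<Lambda> x)"
    and A: "A = (\<lambda>x. A_tot r \<alpha> c \<beta> \<theta>1 \<theta>2 (X x) (L x) (\<Lambda> x))"
    and ref: "reference_measure M X r m"
    and \<Gamma>tot: "signed_revuz_measure M X m A \<Gamma>p \<Gamma>n"
    and Sm: "condition_Sm M X r m A \<Gamma>p \<Gamma>n"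
    and V: "V = value_fun M F r \<alpha> c X"
    and C_set: "C = continuation_set \<alpha> V" and D_set: "D = stopping_set \<alpha> V"
    and \<tau>D: "\<tau>D = (\<lambda>x. entry_time (X x) D)"
    and V_cont: "continuous_on orthant V"
    and optimal: "\<forall>x\<in>orthant. optimal_stopping_time M F r \<alpha> c X x (\<tau>D x)"
    and finite: "\<forall>x\<in>C. (\<integral>\<^sup>+\<omega>. disc_abs_var r (A x) (\<tau>D x \<omega>) \<omega> \<partial>M) < \<infinity>"
    and MG_local_martingale: "\<forall>x\<in>C. local_martingale M F (MG x)"
    and MG_identity: "\<forall>x\<in>C. AE \<omega> in M. \<forall>t\<ge>0.
        exp (- r * t) * gain \<alpha> (X x t \<omega>) - (LBINT s:{0..t}. exp (- r * s) * c (X x s \<omega>))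
          = gain \<alpha> x - disc_functional r (A x) (ennreal t) \<omega> + MG x t \<omega>"
    and MG_UI: "\<forall>x\<in>C. uniformly_integrable_on M {0..} (stopped (MG x) (\<tau>D x))"
  shows "\<forall>x\<in>C. V x = ereal (gain \<alpha> x - resolvent_functional M r A \<tau>D x) \<and>
           excess \<alpha> V x = ereal (- resolvent_functional M r A \<tau>D x)"
proof
  fix x assume x: "x \<in> C"
  then have xo: "x \<in> orthant"
    by (simp add: C_set continuation_set_def)
  have \<beta>: "continuous_on orthant \<beta>"
    using D by (simp add: condition_D_def)
  have sol: "reflected_solution M F W \<beta> \<sigma> \<theta>1 \<theta>2 x (X x) (L x)"
    using D xo unfolding condition_D_def unique_strong_solution_def by blast
  then have X: "adapted F (X x)" "continuous_paths M (X x)" "\<forall>\<omega>\<in>space M. \<forall>t\<ge>0. X x t \<omega> \<in> orthant"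
    unfolding reflected_solution_def by blast+
  have X_meas: "X x t \<in> borel_measurable M" if "0 \<le> t" for t
    using adapted_measurable[OF space X(1) that] .
  have X_cont: "continuous_on {0..} (\<lambda>t. X x t \<omega>)" if "\<omega> \<in> space M" for \<omega>
    using X(2) that by (simp add: continuous_paths_def)
  have X_orth: "X x t \<omega> \<in> orthant" if "\<omega> \<in> space M" "0 \<le> t" for t \<omega>
    using X(3) that by blast
  have path_cont: "continuous_on {0..} (\<lambda>t. f (X x t \<omega>))"
    if "continuous_on orthant f" "\<omega> \<in> space M" for f :: "real^2 \<Rightarrow> real" and \<omega>
    by (rule continuous_on_comp_path[OF X_meas X_cont X_orth that])
  have path_meas: "(\<lambda>\<omega>. f (X x t \<omega>)) \<in> borel_measurable M"
    if "continuous_on orthant f" "0 \<le> t" for f :: "real^2 \<Rightarrow> real" and t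
    by (rule measurable_comp_path[OF X_meas X_cont X_orth that])
  have gain_nonneg: "0 \<le> gain \<alpha> y" if "y \<in> orthant" for y
    using that by (auto simp: gain_def orthant_def le_max_iff_disj)
  obtain S where S: "integrable M S"
    "AE \<omega> in M. \<forall>t\<ge>0. exp (- r * t) * gain \<alpha> (X x t \<omega>) \<le> S \<omega> \<and> exp (- r * t) * c (X x t \<omega>) \<le> S \<omega>"
    using condition_Gr_dominating[OF Gr xo c(2) X_meas X_cont X_orth] by blast
  have A_ctl: "continuously_controlled (\<lambda>t. A x t \<omega>)" if "\<omega> \<in> space M" for \<omega>
    unfolding A using A_tot_controlled_measurable(1)[OF space sol _ \<beta> c(1) that] local_time xo by blast
  have A_meas: "A x t \<in> borel_measurable M" if "0 \<le> t" for t
    unfolding A using A_tot_controlled_measurable(2)[OF space sol _ \<beta> c(1) that] local_time xo by blast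
  have \<tau>: "stopping_time F (\<tau>D x)"
    using optimal xo by (simp add: optimal_stopping_time_def)
  let ?h = "\<lambda>\<omega>. disc_abs_var r (A x) (\<tau>D x \<omega>) \<omega>"
  have h_meas: "?h \<in> borel_measurable M"
    by (rule measurable_disc_abs_var[OF r A_meas A_ctl stopping_time_measurable[OF space \<tau>]])
  have h_fin: "(\<integral>\<^sup>+\<omega>. ?h \<omega> \<partial>M) < \<infinity>"
    using finite x by blast
  note h_AE = integrable_enn2real_of_nn_integral(1)[OF h_meas h_fin]
  note h_int = integrable_enn2real_of_nn_integral(2)[OF h_meas h_fin]
  \<comment> \<open>\<open>local_martingale\<close> leaves the initial value free. It is fixed by
    the identity at \<open>t = 0\<close>, where both integrals vanish and the diffusion starts at
    \<open>x\<close> almost surely.\<close>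
  have MG0: "(\<integral>\<omega>. MG x 0 \<omega> \<partial>M) = 0"
  proof (rule integral_eq_zero_AE)
    show "AE \<omega> in M. MG x 0 \<omega> = 0"
      using bspec[OF MG_identity x] reflected_solution_start[OF sol]
    proof eventually_elim
      case (elim \<omega>)
      from elim(1)[rule_format, of 0] elim(2) show ?case
        using LBINT_singleton[of 0 "\<lambda>s. exp (- r * s) * c (X x s \<omega>)"] by (simp add: disc_functional_0)
    qed
  qed
  \<comment> \<open>The value is a supremum attained at \<open>\<tau>D\<close>, so every competitor
    can be compared with \<open>\<tau>D\<close> directly.\<close>
  have payoff_le: "ext_expectation M (payoff r \<alpha> c (X x) \<sigma>) \<le> ext_expectation M (payoff r \<alpha> c (X x) (\<tau>D x))"
    if "stopping_time F \<sigma>" for \<sigma>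
  proof -
    have "ext_expectation M (payoff r \<alpha> c (X x) \<sigma>) \<le> value_fun M F r \<alpha> c X x"
      unfolding value_fun_def using that by (intro SUP_upper) simp
    then show ?thesis
      using optimal xo by (simp add: optimal_stopping_time_def)
  qed
  have "ext_expectation M (payoff r \<alpha> c (X x) (\<tau>D x))
      = ereal (gain \<alpha> x - (\<integral>\<omega>. disc_functional r (A x) (\<tau>D x \<omega>) \<omega> \<partial>M))"
    unfolding payoff_def [abs_def]
  proof (rule optimal_stopping_value_eq[OF space \<tau> _ _ _ _ _ _ S h_int _ _ bspec[OF MG_local_martingale x] MG0 bspec[OF MG_identity x]])
    show "(\<lambda>\<omega>. exp (- r * t) * gain \<alpha> (X x t \<omega>)) \<in> borel_measurable M"
      "(\<lambda>\<omega>. exp (- r * t) * c (X x t \<omega>)) \<in> borel_measurable M" if "0 \<le> t" for t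
      using path_meas[OF continuous_on_gain that] path_meas[OF c(1) that] by measurable
    show "continuous_on {0..} (\<lambda>t. exp (- r * t) * gain \<alpha> (X x t \<omega>))"
      "continuous_on {0..} (\<lambda>t. exp (- r * t) * c (X x t \<omega>))" if "\<omega> \<in> space M" for \<omega>
      by (intro continuous_intros path_cont continuous_on_gain c(1) that)+
    show "0 \<le> exp (- r * t) * gain \<alpha> (X x t \<omega>)" "0 \<le> exp (- r * t) * c (X x t \<omega>)"
      if "\<omega> \<in> space M" "0 \<le> t" for t \<omega>
      using gain_nonneg c(2) X_orth[OF that] by auto
    show "AE \<omega> in M. \<forall>\<sigma>\<le>\<tau>D x \<omega>. \<bar>disc_functional r (A x) \<sigma> \<omega>\<bar> \<le> enn2real (?h \<omega>)"
      using h_AE AE_space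
    proof eventually_elim
      case (elim \<omega>)
      then show ?case
        using disc_abs_var_bound[where A="A x", OF r A_ctl] by (auto simp: less_top)
    qed
    show "AE \<omega> in M. (\<lambda>n. disc_functional r (A x) (min (\<tau>D x \<omega>) (ennreal (real n))) \<omega>)
        \<longlonglongrightarrow> disc_functional r (A x) (\<tau>D x \<omega>) \<omega>"
      using h_AE AE_space
    proof eventually_elim
      case (elim \<omega>)
      then show ?case
        by (intro disc_functional_tendsto r A_ctl) (auto simp: less_top)
    qed
    show "ext_expectation M (\<lambda>\<omega>. (if \<sigma> \<omega> = \<infinity> then 0 else ereal (exp (- r * enn2real (\<sigma> \<omega>)) * gain \<alpha> (X x (enn2real (\<sigma> \<omega>)) \<omega>)))
          - enn2ereal (\<integral>\<^sup>+s\<in>upto_time (\<sigma> \<omega>). ennreal (exp (- r * s) * c (X x s \<omega>)) \<partial>lborel))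
      \<le> ext_expectation M (\<lambda>\<omega>. (if \<tau>D x \<omega> = \<infinity> then 0 else ereal (exp (- r * enn2real (\<tau>D x \<omega>)) * gain \<alpha> (X x (enn2real (\<tau>D x \<omega>)) \<omega>)))
          - enn2ereal (\<integral>\<^sup>+s\<in>upto_time (\<tau>D x \<omega>). ennreal (exp (- r * s) * c (X x s \<omega>)) \<partial>lborel))"
      if "stopping_time F \<sigma>" for \<sigma>
      using payoff_le[OF that] unfolding payoff_def [abs_def] .
  qed
  then have "V x = ereal (gain \<alpha> x - resolvent_functional M r A \<tau>D x)"
    using optimal xo by (simp add: V optimal_stopping_time_def resolvent_functional_def)
  then show "V x = ereal (gain \<alpha> x - resolvent_functional M r A \<tau>D x) \<and>
      excess \<alpha> V x = ereal (- resolvent_functional M r A \<tau>D x)"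
    by (simp add: excess_def)
qed

end
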